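(* Let $A=\mathbb{K}Q/J^2$ be a radical square zero algebra, where $Q$ has $n$ vertices. Let $\mathcal{S}_D$ be the set of isomorphism classes of simple $A$-modules that are neither projective nor injective, and let $k$ be the number of isomorphism classes of simple $A$-modules that are projective or injective. If $A$ has infinite global dimension and the member $M(Q)$ is not empty, then $\phi\dim(A)\le \#\mathcal{S}_D=n-k$.
   Context: $\mathbb{K}$ is a field, $Q$ is a finite connected quiver, $J$ is the ideal of $\mathbb{K}Q$ generated by the arrows. Modules are finitely generated right modules, with the convention that the simple modules $S_i$ (one per vertex) satisfy $\Omega(S_i)=\bigoplus_{\alpha:i\to j}S_j$. $A_0$ is the direct sum of all simple modules $S_i$. The heart $C(Q)$ is the full subquiver of $Q$ on the vertices whose simple modules lie both in the support of $\Omega^n(A_0)$ and in the support of $\Omega^{-n}(A_0)$ ($\Omega^{-n}$ is the $n$-th cosyzygy); the member $M(Q)$ is the full subquiver on the vertices not in the heart. $K_0(A)$ is the abelian group generated by symbols $[M]$, one for each isomorphism class of finitely generated $A$-modules, modulo the relations $[M]-[M']-[M'']$ whenever $M\cong M'\oplus M''$ and $[P]$ for each projective $P$. The syzygy $\Omega$ induces a group endomorphism $\overline{\Omega}:K_0(A)\to K_0(A)$. For a module $M$, $\langle \mathrm{add}\, M\rangle$ is the subgroup of $K_0(A)$ generated by the classes of the indecomposable direct summands of $M$, and $\phi(M)=\min\{l\in\mathbb{N}: \overline{\Omega}|_{\overline{\Omega}^{l+s}\langle \mathrm{add}\, M\rangle}\text{ is injective for all } s\in\mathbb{N}\}$ ($0\in\mathbb{N}$).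 $\phi\dim(A)=\sup\{\phi(M): M\in \mathrm{mod}\,A\}$. *)

theory Defs
  imports
    "HOL-Algebra.Algebra"
    "HOL-Library.Extended_Nat"
    "Graph_Theory.Graph_Theory"
begin

section \<open>Finitely generated right modules\<close>

text \<open>
  \<^locale>\<open>module\<close> is restricted to commutative base rings, so right modules over an arbitrary ring
  are introduced here on the same record type. The scalar operation \<open>a \<odot> x\<close> is to be read as
  \<open>x \<cdot> a\<close>; hence the order of the factors in \<open>smult_assoc\<close>. The fields \<open>mult\<close> and \<open>one\<close> of the
  record play no role.
\<close>

locale right_module = R?: ring R + M?: abelian_group M
  for R :: "'r ring" and M :: "('r, 'm) module" (structure) +
  assumes smult_closed: "\<lbrakk>a \<in> carrier R; x \<in> carrier M\<rbrakk> \<Longrightarrow> a \<odot>\<^bsub>M\<^esub> x \<in> carrier M"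
    and smult_add_scalar: "\<lbrakk>a \<in> carrier R; b \<in> carrier R; x \<in> carrier M\<rbrakk>
      \<Longrightarrow> (a \<oplus>\<^bsub>R\<^esub> b) \<odot>\<^bsub>M\<^esub> x = a \<odot>\<^bsub>M\<^esub> x \<oplus>\<^bsub>M\<^esub> b \<odot>\<^bsub>M\<^esub> x"
    and smult_add: "\<lbrakk>a \<in> carrier R; x \<in> carrier M; y \<in> carrier M\<rbrakk>
      \<Longrightarrow> a \<odot>\<^bsub>M\<^esub> (x \<oplus>\<^bsub>M\<^esub> y) = a \<odot>\<^bsub>M\<^esub> x \<oplus>\<^bsub>M\<^esub> a \<odot>\<^bsub>M\<^esub> y"
    and smult_assoc: "\<lbrakk>a \<in> carrier R; b \<in> carrier R; x \<in> carrier M\<rbrakk>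
      \<Longrightarrow> (a \<otimes>\<^bsub>R\<^esub> b) \<odot>\<^bsub>M\<^esub> x = b \<odot>\<^bsub>M\<^esub> (a \<odot>\<^bsub>M\<^esub> x)"
    and smult_one: "x \<in> carrier M \<Longrightarrow> \<one>\<^bsub>R\<^esub> \<odot>\<^bsub>M\<^esub> x = x"

definition fin_gen :: "'r ring \<Rightarrow> ('r, 'm) module \<Rightarrow> bool" where
  "fin_gen R M \<longleftrightarrow> (\<exists>S. finite S \<and> S \<subseteq> carrier M \<and>
     (\<forall>H. submodule H R M \<longrightarrow> S \<subseteq> H \<longrightarrow> H = carrier M))"

definition mod_hom :: "'r ring \<Rightarrow> ('r, 'm) module \<Rightarrow> ('r, 'n) module \<Rightarrow> ('m \<Rightarrow> 'n) set" where
  "mod_hom R M N = {f \<in> carrier M \<rightarrow> carrier N.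
     (\<forall>x\<in>carrier M. \<forall>y\<in>carrier M. f (x \<oplus>\<^bsub>M\<^esub> y) = f x \<oplus>\<^bsub>N\<^esub> f y) \<and>
     (\<forall>a\<in>carrier R. \<forall>x\<in>carrier M. f (a \<odot>\<^bsub>M\<^esub> x) = a \<odot>\<^bsub>N\<^esub> f x)}"

definition mod_iso :: "'r ring \<Rightarrow> ('r, 'm) module \<Rightarrow> ('r, 'n) module \<Rightarrow> bool" where
  "mod_iso R M N \<longleftrightarrow> (\<exists>f \<in> mod_hom R M N. bij_betw f (carrier M) (carrier N))"

definition zero_module :: "('r, 'm) module \<Rightarrow> bool" where
  "zero_module M \<longleftrightarrow> carrier M = {\<zero>\<^bsub>M\<^esub>}"

definition simple_module :: "'r ring \<Rightarrow> ('r, 'm) module \<Rightarrow> bool" where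
  "simple_module R M \<longleftrightarrow> \<not> zero_module M \<and>
     (\<forall>H. submodule H R M \<longrightarrow> H = {\<zero>\<^bsub>M\<^esub>} \<or> H = carrier M)"

definition direct_sum2 :: "('r, 'm) module \<Rightarrow> ('r, 'n) module \<Rightarrow> ('r, 'm \<times> 'n) module" where
  "direct_sum2 M N = \<lparr>carrier = carrier M \<times> carrier N,
     monoid.mult = undefined, one = undefined,
     ring.zero = (\<zero>\<^bsub>M\<^esub>, \<zero>\<^bsub>N\<^esub>),
     ring.add = (\<lambda>(x, y) (x', y'). (x \<oplus>\<^bsub>M\<^esub> x', y \<oplus>\<^bsub>N\<^esub> y')),
     smult = (\<lambda>a (x, y). (a \<odot>\<^bsub>M\<^esub> x, a \<odot>\<^bsub>N\<^esub> y))\<rparr>"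

text \<open>Only used for finite index sets, where direct sum and direct product agree.\<close>

definition direct_sum :: "'i set \<Rightarrow> ('i \<Rightarrow> ('r, 'm) module) \<Rightarrow> ('r, 'i \<Rightarrow> 'm) module" where
  "direct_sum I M = \<lparr>carrier = (\<Pi>\<^sub>E i\<in>I. carrier (M i)),
     monoid.mult = undefined, one = undefined,
     ring.zero = (\<lambda>i\<in>I. \<zero>\<^bsub>M i\<^esub>),
     ring.add = (\<lambda>x y. \<lambda>i\<in>I. x i \<oplus>\<^bsub>M i\<^esub> y i),
     smult = (\<lambda>a x. \<lambda>i\<in>I. a \<odot>\<^bsub>M i\<^esub> x i)\<rparr>"

text \<open>
  The category of finitely generated right modules. Every finitely generated right module is
  isomorphic to a quotient of some \<open>R\<^sup>m\<close>, whose elements are cosets of tuples over \<open>R\<close>. So the carrier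
  type \<open>(nat \<Rightarrow> 'r) set\<close> is large enough to contain a copy of each of them, and quantifying
  over \<open>fg_modules R\<close> is quantifying over all finitely generated modules up to isomorphism.
\<close>

type_synonym 'r umodule = "('r, (nat \<Rightarrow> 'r) set) module"

definition fg_modules :: "'r ring \<Rightarrow> 'r umodule set" where
  "fg_modules R = {M. right_module R M \<and> fin_gen R M}"

text \<open>A copy in \<open>fg_modules R\<close> of a finitely generated module with another carrier type.\<close>

definition ucopy :: "'r ring \<Rightarrow> ('r, 'm) module \<Rightarrow> 'r umodule" where
  "ucopy R M = (SOME N. N \<in> fg_modules R \<and> mod_iso R M N)"

definition iso_class :: "'r ring \<Rightarrow> 'r umodule \<Rightarrow> 'r umodule set" where
  "iso_class R M = {N \<in> fg_modules R. mod_iso R M N}"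

definition indecomposable :: "'r ring \<Rightarrow> 'r umodule \<Rightarrow> bool" where
  "indecomposable R M \<longleftrightarrow> \<not> zero_module M \<and>
     (\<forall>N\<in>fg_modules R. \<forall>N'\<in>fg_modules R.
        mod_iso R M (direct_sum2 N N') \<longrightarrow> zero_module N \<or> zero_module N')"


section \<open>Projective and injective modules, syzygies and cosyzygies\<close>

definition projective :: "'r ring \<Rightarrow> 'r umodule \<Rightarrow> bool" where
  "projective R P \<longleftrightarrow> (\<forall>M\<in>fg_modules R. \<forall>N\<in>fg_modules R. \<forall>g\<in>mod_hom R M N. \<forall>h\<in>mod_hom R P N.
     g ` carrier M = carrier N \<longrightarrow>
     (\<exists>h'\<in>mod_hom R P M. \<forall>x\<in>carrier P. g (h' x) = h x))"

definition injective :: "'r ring \<Rightarrow> 'r umodule \<Rightarrow> bool" where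
  "injective R E \<longleftrightarrow> (\<forall>M\<in>fg_modules R. \<forall>N\<in>fg_modules R. \<forall>g\<in>mod_hom R M N. \<forall>h\<in>mod_hom R M E.
     inj_on g (carrier M) \<longrightarrow>
     (\<exists>h'\<in>mod_hom R N E. \<forall>x\<in>carrier M. h' (g x) = h x))"

definition mod_kernel :: "('r, 'm) module \<Rightarrow> ('r, 'n) module \<Rightarrow> ('m \<Rightarrow> 'n) \<Rightarrow> 'm set" where
  "mod_kernel M N f = {x \<in> carrier M. f x = \<zero>\<^bsub>N\<^esub>}"

definition short_exact ::
  "'r ring \<Rightarrow> 'r umodule \<Rightarrow> ((nat \<Rightarrow> 'r) set \<Rightarrow> (nat \<Rightarrow> 'r) set) \<Rightarrow> 'r umodule
    \<Rightarrow> ((nat \<Rightarrow> 'r) set \<Rightarrow> (nat \<Rightarrow> 'r) set) \<Rightarrow> 'r umodule \<Rightarrow> bool" where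
  "short_exact R L f M g N \<longleftrightarrow> f \<in> mod_hom R L M \<and> g \<in> mod_hom R M N \<and>
     inj_on f (carrier L) \<and> f ` carrier L = mod_kernel M N g \<and> g ` carrier M = carrier N"

text \<open>The kernel of a projective cover is superfluous.\<close>

definition projective_cover ::
  "'r ring \<Rightarrow> 'r umodule \<Rightarrow> ((nat \<Rightarrow> 'r) set \<Rightarrow> (nat \<Rightarrow> 'r) set) \<Rightarrow> 'r umodule \<Rightarrow> bool" where
  "projective_cover R P f M \<longleftrightarrow> P \<in> fg_modules R \<and> projective R P \<and>
     f \<in> mod_hom R P M \<and> f ` carrier P = carrier M \<and>
     (\<forall>H. submodule H R P \<longrightarrow> H <+>\<^bsub>P\<^esub> mod_kernel P M f = carrier P \<longrightarrow> H = carrier P)"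

text \<open>The image of an injective envelope is essential.\<close>

definition injective_envelope ::
  "'r ring \<Rightarrow> 'r umodule \<Rightarrow> ((nat \<Rightarrow> 'r) set \<Rightarrow> (nat \<Rightarrow> 'r) set) \<Rightarrow> 'r umodule \<Rightarrow> bool" where
  "injective_envelope R M f E \<longleftrightarrow> E \<in> fg_modules R \<and> injective R E \<and>
     f \<in> mod_hom R M E \<and> inj_on f (carrier M) \<and>
     (\<forall>H. submodule H R E \<longrightarrow> H \<inter> f ` carrier M = {\<zero>\<^bsub>E\<^esub>} \<longrightarrow> H = {\<zero>\<^bsub>E\<^esub>})"

text \<open>
  The kernel of a projective cover and the cokernel of an injective envelope; both are unique
  up to isomorphism, and a representative is chosen.
\<close>

definition syzygy :: "'r ring \<Rightarrow> 'r umodule \<Rightarrow> 'r umodule" where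
  "syzygy R M = (SOME N. N \<in> fg_modules R \<and>
     (\<exists>P f i. projective_cover R P f M \<and> short_exact R N i P f M))"

definition cosyzygy :: "'r ring \<Rightarrow> 'r umodule \<Rightarrow> 'r umodule" where
  "cosyzygy R M = (SOME N. N \<in> fg_modules R \<and>
     (\<exists>E f p. injective_envelope R M f E \<and> short_exact R M f E p N))"


section \<open>Global dimension\<close>

text \<open>A resolution \<open>\<dots> \<rightarrow> P 1 \<rightarrow> P 0 \<rightarrow> M \<rightarrow> 0\<close>, with \<open>d 0 : P 0 \<rightarrow> M\<close> and \<open>d (Suc i) : P (Suc i) \<rightarrow> P i\<close>.\<close>

definition projective_resolution ::
  "'r ring \<Rightarrow> 'r umodule \<Rightarrow> (nat \<Rightarrow> 'r umodule) \<Rightarrow> (nat \<Rightarrow> (nat \<Rightarrow> 'r) set \<Rightarrow> (nat \<Rightarrow> 'r) set) \<Rightarrow> bool"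
  where
  "projective_resolution R M P d \<longleftrightarrow>
     (\<forall>i. P i \<in> fg_modules R \<and> projective R (P i)) \<and>
     d 0 \<in> mod_hom R (P 0) M \<and> d 0 ` carrier (P 0) = carrier M \<and>
     (\<forall>i. d (Suc i) \<in> mod_hom R (P (Suc i)) (P i)) \<and>
     d 1 ` carrier (P 1) = mod_kernel (P 0) M (d 0) \<and>
     (\<forall>i. d (Suc (Suc i)) ` carrier (P (Suc (Suc i))) = mod_kernel (P (Suc i)) (P i) (d (Suc i)))"

text \<open>In \<^typ>\<open>enat\<close> the infimum of the empty set is \<open>\<infinity>\<close>.\<close>

definition proj_dim :: "'r ring \<Rightarrow> 'r umodule \<Rightarrow> enat" where
  "proj_dim R M = (INF l \<in> {l. \<exists>P d. projective_resolution R M P d \<and> (\<forall>i>l. zero_module (P i))}. enat l)"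

definition global_dim :: "'r ring \<Rightarrow> enat" where
  "global_dim R = (SUP M \<in> fg_modules R. proj_dim R M)"


section \<open>The group \<open>K\<^sub>0\<close> and the \<open>\<phi>\<close>-dimension\<close>

definition K0_free :: "'r ring \<Rightarrow> ('r umodule set \<Rightarrow>\<^sub>0 int) monoid" where
  "K0_free R = free_Abelian_group (iso_class R ` fg_modules R)"

definition K0_rels :: "'r ring \<Rightarrow> ('r umodule set \<Rightarrow>\<^sub>0 int) set" where
  "K0_rels R =
     {frag_of (iso_class R M) - frag_of (iso_class R M') - frag_of (iso_class R M'') | M M' M''.
        M \<in> fg_modules R \<and> M' \<in> fg_modules R \<and> M'' \<in> fg_modules R \<and> mod_iso R M (direct_sum2 M' M'')} \<union>
     {frag_of (iso_class R P) | P. P \<in> fg_modules R \<and> projective R P}"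

definition K0 :: "'r ring \<Rightarrow> ('r umodule set \<Rightarrow>\<^sub>0 int) set monoid" where
  "K0 R = K0_free R Mod generate (K0_free R) (K0_rels R)"

definition K0_class :: "'r ring \<Rightarrow> 'r umodule \<Rightarrow> ('r umodule set \<Rightarrow>\<^sub>0 int) set" where
  "K0_class R M = generate (K0_free R) (K0_rels R) #>\<^bsub>K0_free R\<^esub> frag_of (iso_class R M)"

text \<open>
  The endomorphism induced by the syzygy. It is determined by its values on the generators
  \<open>[M]\<close>; extensionality only fixes the (irrelevant) values outside the carrier.
\<close>

definition omega_bar ::
  "'r ring \<Rightarrow> ('r umodule set \<Rightarrow>\<^sub>0 int) set \<Rightarrow> ('r umodule set \<Rightarrow>\<^sub>0 int) set" where
  "omega_bar R = (THE h. h \<in> hom (K0 R) (K0 R) \<and> h \<in> extensional (carrier (K0 R)) \<and>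
     (\<forall>M\<in>fg_modules R. h (K0_class R M) = K0_class R (syzygy R M)))"

definition add_subgroup :: "'r ring \<Rightarrow> 'r umodule \<Rightarrow> ('r umodule set \<Rightarrow>\<^sub>0 int) set set" where
  "add_subgroup R M = generate (K0 R) {K0_class R N | N. N \<in> fg_modules R \<and> indecomposable R N \<and>
     (\<exists>N'\<in>fg_modules R. mod_iso R M (direct_sum2 N N'))}"

definition phi :: "'r ring \<Rightarrow> 'r umodule \<Rightarrow> enat" where
  "phi R M = (INF l \<in> {l. \<forall>s. inj_on (omega_bar R) ((omega_bar R ^^ (l + s)) ` add_subgroup R M)}. enat l)"

definition phi_dim :: "'r ring \<Rightarrow> enat" where
  "phi_dim R = (SUP M \<in> fg_modules R. phi R M)"


section \<open>Radical square zero algebras of quivers\<close>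

text \<open>
  A quiver is a digraph in the sense of \<^locale>\<open>wf_digraph\<close>, which admits loops and parallel arcs;
  \<open>tail\<close> is the source and \<open>head\<close> the target of an arc. A path is given by its source, its list of
  arcs and its target; the trivial path at \<open>i\<close> is \<open>(i, [], i)\<close>.
\<close>

type_synonym ('v, 'a) path = "'v \<times> 'a list \<times> 'v"

definition quiver_paths :: "('v, 'a) pre_digraph \<Rightarrow> ('v, 'a) path set" where
  "quiver_paths Q = {(u, p, v). pre_digraph.awalk Q u p v}"

definition factorizations :: "('v, 'a) pre_digraph \<Rightarrow> ('v, 'a) path \<Rightarrow> (('v, 'a) path \<times> ('v, 'a) path) set" where
  "factorizations Q z = {((u, p, v), (v', q, w)) | u p v v' q w.
     (u, p, v) \<in> quiver_paths Q \<and> (v', q, w) \<in> quiver_paths Q \<and> v = v' \<and> z = (u, p @ q, w)}"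

definition path_elt :: "('v, 'a) path \<Rightarrow> ('v, 'a) path \<Rightarrow> 'k::field" where
  "path_elt x = (\<lambda>z. if z = x then 1 else 0)"

text \<open>
  The path algebra: finitely supported functions on the paths. Paths are composed from left to
  right, so the right module \<open>e\<^sub>i A\<close> is spanned by the paths starting at \<open>i\<close>; over \<open>\<bbbK>Q/J\<^sup>2\<close>
  this yields \<open>\<Omega>(S\<^sub>i) = \<Oplus>\<^bsub>\<alpha>:i\<rightarrow>j\<^esub> S\<^sub>j\<close>.
\<close>

definition path_algebra :: "('v, 'a) pre_digraph \<Rightarrow> (('v, 'a) path \<Rightarrow> 'k::field) ring" where
  "path_algebra Q = \<lparr>carrier = {f. finite {x. f x \<noteq> 0} \<and> {x. f x \<noteq> 0} \<subseteq> quiver_paths Q},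
     monoid.mult = (\<lambda>f g z. \<Sum>(x, y)\<in>factorizations Q z. f x * g y),
     monoid.one = (\<lambda>z. \<Sum>i\<in>verts Q. path_elt (i, [], i) z),
     ring.zero = (\<lambda>z. 0),
     ring.add = (\<lambda>f g z. f z + g z)\<rparr>"

definition arrow_ideal :: "('v, 'a) pre_digraph \<Rightarrow> (('v, 'a) path \<Rightarrow> 'k::field) set" where
  "arrow_ideal Q = Idl\<^bsub>path_algebra Q\<^esub> {path_elt (tail Q \<alpha>, [\<alpha>], head Q \<alpha>) | \<alpha>. \<alpha> \<in> arcs Q}"

definition rad_square :: "('v, 'a) pre_digraph \<Rightarrow> (('v, 'a) path \<Rightarrow> 'k::field) set" where
  "rad_square Q = arrow_ideal Q \<cdot>\<^bsub>path_algebra Q\<^esub> arrow_ideal Q"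

definition rad_square_zero_algebra ::
  "('v, 'a) pre_digraph \<Rightarrow> (('v, 'a) path \<Rightarrow> 'k::field) set ring" where
  "rad_square_zero_algebra Q = path_algebra Q Quot rad_square Q"

definition vertex_idem :: "('v, 'a) pre_digraph \<Rightarrow> 'v \<Rightarrow> (('v, 'a) path \<Rightarrow> 'k::field) set" where
  "vertex_idem Q i = rad_square Q +>\<^bsub>path_algebra Q\<^esub> path_elt (i, [], i)"

text \<open>
  The simple module \<open>S\<^sub>i\<close> is \<open>\<bbbK>\<close> with a residue class acting by its coefficient at the trivial
  path at \<open>i\<close>. This coefficient is the same for all representatives, since no element of \<open>J\<^sup>2\<close>
  involves a trivial path.
\<close>

definition vertex_simple ::
  "'v \<Rightarrow> ((('v, 'a) path \<Rightarrow> 'k::field) set, 'k) module" where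
  "vertex_simple i = \<lparr>carrier = UNIV, monoid.mult = undefined, one = undefined,
     ring.zero = 0, ring.add = (+),
     smult = (\<lambda>a x. x * the_elem ((\<lambda>f. f (i, [], i)) ` a))\<rparr>"

definition sum_of_simples ::
  "('v, 'a) pre_digraph \<Rightarrow> (('v, 'a) path \<Rightarrow> 'k::field) set umodule" where
  "sum_of_simples Q = ucopy (rad_square_zero_algebra Q) (direct_sum (verts Q) vertex_simple)"

text \<open>\<open>S\<^sub>i\<close> is a composition factor of \<open>M\<close> iff \<open>M e\<^sub>i \<noteq> 0\<close>.\<close>

definition support ::
  "('v, 'a) pre_digraph \<Rightarrow> (('v, 'a) path \<Rightarrow> 'k::field) set umodule \<Rightarrow> 'v set" where
  "support Q M = {i \<in> verts Q. \<exists>x\<in>carrier M. vertex_idem Q i \<odot>\<^bsub>M\<^esub> x \<noteq> \<zero>\<^bsub>M\<^esub>}"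

text \<open>
  The heart \<open>C(Q)\<close> and the member \<open>M(Q)\<close>. The type argument is the ground field.
\<close>

definition heart :: "'k::field itself \<Rightarrow> ('v, 'a) pre_digraph \<Rightarrow> ('v, 'a) pre_digraph" where
  "heart K Q =
     (let A = (rad_square_zero_algebra Q :: (('v, 'a) path \<Rightarrow> 'k) set ring);
          n = card (verts Q)
      in Q \<restriction> (support Q ((syzygy A ^^ n) (sum_of_simples Q)) \<inter>
              support Q ((cosyzygy A ^^ n) (sum_of_simples Q))))"

definition member :: "'k::field itself \<Rightarrow> ('v, 'a) pre_digraph \<Rightarrow> ('v, 'a) pre_digraph" where
  "member K Q = Q \<restriction> (verts Q - verts (heart K Q))"

end

theory Submission
  imports Defs
begin

text \<open>
  A syzygy is a semisimple module, and its composition factors are simple modules at vertices with an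
  incoming arrow; those at sinks are projective. So \<open>\<Omega>\<close> maps \<open>K\<^sub>0\<close> into the subgroup \<open>L\<close> spanned by
  the simple modules at the \<open>d\<close> interior vertices, i.e. those with both an incoming and an outgoing
  arrow. These classes are linearly independent, since the multiplicity of \<open>S\<^sub>j\<close> as a direct summand,
  \<open>dim (soc M)e\<^sub>j - dim (rad M)e\<^sub>j\<close>, is additive and vanishes on projectives whenever \<open>j\<close> is not a sink.
  On \<open>L\<close> the operator \<open>\<Omega>\<close> acts by the adjacency matrix \<open>T\<close> of the interior vertices. If \<open>T\<close> is
  nilpotent, then the minimal projective resolutions stop after at most \<open>d + 2\<close> steps. Otherwise the
  nilpotent part of \<open>T\<close> has dimension less than \<open>d\<close>, so that \<open>T\<close> is injective on the image of
  \<open>T\<^bsup>d-1\<^esup>\<close>, and \<open>\<Omega>\<close> is injective on the image of \<open>\<Omega>\<^bsup>d\<^esup>\<close>. Finally, the simple module at an interior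
  vertex is neither projective nor injective.
\<close>

section \<open>Right modules\<close>

text \<open>K_0 is a quotient of a free group and gives no direct way to tell classes apart. All
  information about it comes from integer invariants that are additive on direct sums and vanish on
  projectives. Besides the summand multiplicity there is the multiplicity of S_j in the syzygy: the
  sum of dim (M/MJ)e_i over the arrows i -> j, minus dim (MJ)e_j. A module and its projective cover
  have the same top, and the cover itself has value 0. As this number depends only on dimensions of
  M, \<open>\<Omega>\<close> is well defined on K_0 without comparing resolutions. Dimension is
  length, the supremum of the sizes of chains of submodules, and its additivity along surjections is
  the main tool of linear algebra. The exponent d splits as 1 + (d - 1): one application of
  \<open>\<Omega>\<close> enters L, and powers of T do the rest. If T^d u = 0 while T^(d-1) u is
  nonzero, the kernels of T, ..., T^d form a strict chain of d nonzero subspaces in a space of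
  dimension d, so T^d = 0, which infinite global dimension excludes.\<close>

lemma submodule_iff_subgroup:
  "submodule H R M \<longleftrightarrow> subgroup H (add_monoid M) \<and> (\<forall>a\<in>carrier R. \<forall>x\<in>H. a \<odot>\<^bsub>M\<^esub> x \<in> H)"
  by (auto simp: submodule_def submodule_axioms_def)

lemma submodule_subset: "submodule H R M \<Longrightarrow> H \<subseteq> carrier M"
  using subgroup.subset[of H "add_monoid M"] by (simp add: submodule_def)

lemma submodule_zero: "submodule H R M \<Longrightarrow> \<zero>\<^bsub>M\<^esub> \<in> H"
  using subgroup.one_closed[of H "add_monoid M"] by (simp add: submodule_def)

lemma submodule_add: "submodule H R M \<Longrightarrow> x \<in> H \<Longrightarrow> y \<in> H \<Longrightarrow> x \<oplus>\<^bsub>M\<^esub> y \<in> H"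
  using subgroup.m_closed[of H "add_monoid M" x y] by (simp add: submodule_def)

lemma submodule_smult: "submodule H R M \<Longrightarrow> a \<in> carrier R \<Longrightarrow> x \<in> H \<Longrightarrow> a \<odot>\<^bsub>M\<^esub> x \<in> H"
  by (simp add: submodule_iff_subgroup)

context right_module
begin

lemma smult_zero [simp]: "a \<in> carrier R \<Longrightarrow> a \<odot>\<^bsub>M\<^esub> \<zero>\<^bsub>M\<^esub> = \<zero>\<^bsub>M\<^esub>"
  by (metis M.r_zero M.zero_closed M.add.l_cancel_one smult_add smult_closed)

lemma zero_smult [simp]: "x \<in> carrier M \<Longrightarrow> \<zero>\<^bsub>R\<^esub> \<odot>\<^bsub>M\<^esub> x = \<zero>\<^bsub>M\<^esub>"
  by (metis M.add.l_cancel_one R.r_zero R.zero_closed smult_add_scalar smult_closed)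

lemma minus_one_smult: "x \<in> carrier M \<Longrightarrow> (\<ominus>\<^bsub>R\<^esub> \<one>\<^bsub>R\<^esub>) \<odot>\<^bsub>M\<^esub> x = \<ominus>\<^bsub>M\<^esub> x"
  by (metis M.minus_equality R.add.inv_closed R.l_neg R.one_closed smult_add_scalar smult_closed
      smult_one zero_smult)

lemma smult_finsum:
  assumes "a \<in> carrier R" and "finite I" and "f \<in> I \<rightarrow> carrier M"
  shows "a \<odot>\<^bsub>M\<^esub> finsum M f I = finsum M (\<lambda>i. a \<odot>\<^bsub>M\<^esub> f i) I"
  using assms(2,3)
proof (induction I rule: finite_induct)
  case empty
  then show ?case using assms(1) by simp
next
  case (insert i I)
  then show ?case using assms(1)
    by (subst M.finsum_insert, simp, simp, blast, blast, subst M.finsum_insert)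
       (auto simp: smult_add smult_closed Pi_iff intro!: M.finsum_closed)
qed

text \<open>Closure under negatives is automatic, since -x = x(-1) is a scalar multiple.\<close>

lemma submoduleI:
  assumes "H \<subseteq> carrier M" and "\<zero>\<^bsub>M\<^esub> \<in> H"
    and "\<And>x y. x \<in> H \<Longrightarrow> y \<in> H \<Longrightarrow> x \<oplus>\<^bsub>M\<^esub> y \<in> H"
    and "\<And>a x. a \<in> carrier R \<Longrightarrow> x \<in> H \<Longrightarrow> a \<odot>\<^bsub>M\<^esub> x \<in> H"
  shows "submodule H R M"
proof -
  have "\<ominus>\<^bsub>M\<^esub> x \<in> H" if "x \<in> H" for x
    using assms(4)[OF _ that, of "\<ominus>\<^bsub>R\<^esub> \<one>\<^bsub>R\<^esub>"] minus_one_smult[of x] assms(1) that by auto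
  then show ?thesis
    unfolding submodule_iff_subgroup subgroup_def using assms
    by (auto simp: a_inv_def[symmetric])
qed

lemma submodule_neg: "submodule H R M \<Longrightarrow> x \<in> H \<Longrightarrow> \<ominus>\<^bsub>M\<^esub> x \<in> H"
  using minus_one_smult[of x] submodule_smult[of H R M "\<ominus>\<^bsub>R\<^esub> \<one>\<^bsub>R\<^esub>" x] submodule_subset[of H R M] by auto

lemma submodule_carrier: "submodule (carrier M) R M"
  by (rule submoduleI) (auto simp: smult_closed)

lemma submodule_0: "submodule {\<zero>\<^bsub>M\<^esub>} R M"
  by (rule submoduleI) (auto)

lemma right_module_submodule:
  assumes "submodule H R M"
  shows "right_module R (M\<lparr>carrier := H\<rparr>)"
proof -
  have sub: "H \<subseteq> carrier M" by (rule submodule_subset[OF assms])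
  have "abelian_group (M\<lparr>carrier := H\<rparr>)"
  proof (rule abelian_groupI)
    fix x assume "x \<in> carrier (M\<lparr>carrier := H\<rparr>)"
    then show "\<exists>y\<in>carrier (M\<lparr>carrier := H\<rparr>). y \<oplus>\<^bsub>M\<lparr>carrier := H\<rparr>\<^esub> x = \<zero>\<^bsub>M\<lparr>carrier := H\<rparr>\<^esub>"
      using submodule_neg[OF assms, of x] sub by (auto intro!: bexI[of _ "\<ominus>\<^bsub>M\<^esub> x"] simp: M.l_neg subsetD)
  qed (use sub submodule_add[OF assms] submodule_zero[OF assms] in
      \<open>auto simp: subsetD M.a_ac\<close>)
  then show ?thesis
    unfolding right_module_def right_module_axioms_def
    using R.ring_axioms submodule_smult[OF assms] sub
    by (auto simp: subsetD smult_add_scalar smult_add smult_assoc smult_one)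
qed

text \<open>Submodules of a submodule are sets of the same type as submodules of \<open>M\<close>,
  so chains can be moved between \<open>M\<close> and its submodules without maps.\<close>

lemma submodule_of_submodule:
  assumes "submodule H R M"
  shows "submodule K R (M\<lparr>carrier := H\<rparr>) \<longleftrightarrow> submodule K R M \<and> K \<subseteq> H"
proof
  assume K: "submodule K R (M\<lparr>carrier := H\<rparr>)"
  have KH: "K \<subseteq> H" using submodule_subset[OF K] by simp
  have "submodule K R M"
    using submodule_subset[OF assms] KH submodule_zero[OF K] submodule_add[OF K] submodule_smult[OF K]
    by (intro submoduleI) auto
  then show "submodule K R M \<and> K \<subseteq> H" using KH by simp
next
  assume K: "submodule K R M \<and> K \<subseteq> H"
  interpret H: right_module R "M\<lparr>carrier := H\<rparr>" by (rule right_module_submodule[OF assms])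
  show "submodule K R (M\<lparr>carrier := H\<rparr>)"
    using K submodule_zero[of K] submodule_add[of K] submodule_smult[of K]
    by (intro H.submoduleI) auto
qed

lemma submodule_sum:
  assumes "submodule H R M" and "submodule K R M"
  shows "submodule (H <+>\<^bsub>M\<^esub> K) R M"
proof (rule submoduleI)
  note sub = submodule_subset[OF assms(1)] submodule_subset[OF assms(2)]
  show "H <+>\<^bsub>M\<^esub> K \<subseteq> carrier M" using sub by (auto simp: set_add_def' subsetD)
  show "\<zero>\<^bsub>M\<^esub> \<in> H <+>\<^bsub>M\<^esub> K"
    using submodule_zero[OF assms(1)] submodule_zero[OF assms(2)] M.r_zero[of "\<zero>\<^bsub>M\<^esub>"]
    by (force simp: set_add_def')
  fix x y assume "x \<in> H <+>\<^bsub>M\<^esub> K" "y \<in> H <+>\<^bsub>M\<^esub> K"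
  then obtain h k h' k' where *: "h \<in> H" "k \<in> K" "h' \<in> H" "k' \<in> K" "x = h \<oplus>\<^bsub>M\<^esub> k" "y = h' \<oplus>\<^bsub>M\<^esub> k'"
    by (auto simp: set_add_def')
  then have "x \<oplus>\<^bsub>M\<^esub> y = (h \<oplus>\<^bsub>M\<^esub> h') \<oplus>\<^bsub>M\<^esub> (k \<oplus>\<^bsub>M\<^esub> k')"
    using sub by (simp add: subsetD M.a_ac)
  then show "x \<oplus>\<^bsub>M\<^esub> y \<in> H <+>\<^bsub>M\<^esub> K"
    using submodule_add[OF assms(1) *(1,3)] submodule_add[OF assms(2) *(2,4)] by (auto simp: set_add_def')
next
  note sub = submodule_subset[OF assms(1)] submodule_subset[OF assms(2)]
  fix a x assume a: "a \<in> carrier R" "x \<in> H <+>\<^bsub>M\<^esub> K"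
  then obtain h k where *: "h \<in> H" "k \<in> K" "x = h \<oplus>\<^bsub>M\<^esub> k" by (auto simp: set_add_def')
  then show "a \<odot>\<^bsub>M\<^esub> x \<in> H <+>\<^bsub>M\<^esub> K"
    using a(1) sub submodule_smult[OF assms(1) a(1) *(1)] submodule_smult[OF assms(2) a(1) *(2)]
      smult_add[OF a(1), of h k]
    unfolding set_add_def' by blast
qed

lemma subset_sum_left:
  assumes "submodule H R M" and "submodule K R M"
  shows "H \<subseteq> H <+>\<^bsub>M\<^esub> K"
proof
  fix x assume x: "x \<in> H"
  then have "x = x \<oplus>\<^bsub>M\<^esub> \<zero>\<^bsub>M\<^esub>" using submodule_subset[OF assms(1)] by (simp add: subsetD)
  then show "x \<in> H <+>\<^bsub>M\<^esub> K"
    using x submodule_zero[OF assms(2)] unfolding set_add_def' by blast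
qed

lemma subset_sum_right:
  assumes "submodule H R M" and "submodule K R M"
  shows "K \<subseteq> H <+>\<^bsub>M\<^esub> K"
proof
  fix x assume x: "x \<in> K"
  then have "x = \<zero>\<^bsub>M\<^esub> \<oplus>\<^bsub>M\<^esub> x" using submodule_subset[OF assms(2)] by (simp add: subsetD)
  then show "x \<in> H <+>\<^bsub>M\<^esub> K"
    using x submodule_zero[OF assms(1)] unfolding set_add_def' by blast
qed

lemma submodule_Inter:
  assumes "\<And>H. H \<in> \<H> \<Longrightarrow> submodule H R M" and "\<H> \<noteq> {}"
  shows "submodule (\<Inter>\<H>) R M"
proof (rule submoduleI)
  show "\<Inter>\<H> \<subseteq> carrier M" using assms submodule_subset[of _ R M] by (meson Inter_subset order_trans)
qed (auto intro: submodule_zero[OF assms(1)] submodule_add[OF assms(1)] submodule_smult[OF assms(1)])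

end

section \<open>Homomorphisms and isomorphisms of right modules\<close>

lemma mod_homI:
  assumes "\<And>x. x \<in> carrier M \<Longrightarrow> f x \<in> carrier N"
    and "\<And>x y. x \<in> carrier M \<Longrightarrow> y \<in> carrier M \<Longrightarrow> f (x \<oplus>\<^bsub>M\<^esub> y) = f x \<oplus>\<^bsub>N\<^esub> f y"
    and "\<And>a x. a \<in> carrier R \<Longrightarrow> x \<in> carrier M \<Longrightarrow> f (a \<odot>\<^bsub>M\<^esub> x) = a \<odot>\<^bsub>N\<^esub> f x"
  shows "f \<in> mod_hom R M N"
  using assms by (auto simp: mod_hom_def)

lemma mod_hom_closed: "f \<in> mod_hom R M N \<Longrightarrow> x \<in> carrier M \<Longrightarrow> f x \<in> carrier N"
  by (auto simp: mod_hom_def)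

lemma mod_hom_add:
  "f \<in> mod_hom R M N \<Longrightarrow> x \<in> carrier M \<Longrightarrow> y \<in> carrier M \<Longrightarrow> f (x \<oplus>\<^bsub>M\<^esub> y) = f x \<oplus>\<^bsub>N\<^esub> f y"
  by (auto simp: mod_hom_def)

lemma mod_hom_smult:
  "f \<in> mod_hom R M N \<Longrightarrow> a \<in> carrier R \<Longrightarrow> x \<in> carrier M \<Longrightarrow> f (a \<odot>\<^bsub>M\<^esub> x) = a \<odot>\<^bsub>N\<^esub> f x"
  by (auto simp: mod_hom_def)

lemma mod_hom_comp:
  "f \<in> mod_hom R L M \<Longrightarrow> g \<in> mod_hom R M N \<Longrightarrow> (\<lambda>x. g (f x)) \<in> mod_hom R L N"
  by (auto simp: mod_hom_def Pi_iff)

lemma mod_hom_id: "(\<lambda>x. x) \<in> mod_hom R M M"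
  by (auto simp: mod_hom_def)

lemma mod_hom_incl: "H \<subseteq> carrier M \<Longrightarrow> (\<lambda>x. x) \<in> mod_hom R (M\<lparr>carrier := H\<rparr>) M"
  by (auto simp: mod_hom_def)

locale right_module_hom = M: right_module R M + N: right_module R N
  for R :: "'r ring" and M :: "('r, 'm) module" and N :: "('r, 'n) module" +
  fixes f assumes hom: "f \<in> mod_hom R M N"
begin

lemmas closed = mod_hom_closed[OF hom]
lemmas add = mod_hom_add[OF hom]
lemmas smult = mod_hom_smult[OF hom]

lemma zero: "f \<zero>\<^bsub>M\<^esub> = \<zero>\<^bsub>N\<^esub>"
  by (metis M.M.zero_closed M.zero_smult N.zero_smult M.R.zero_closed closed smult)

lemma neg: "x \<in> carrier M \<Longrightarrow> f (\<ominus>\<^bsub>M\<^esub> x) = \<ominus>\<^bsub>N\<^esub> f x"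
  by (metis M.minus_one_smult M.R.add.inv_closed M.R.one_closed N.minus_one_smult closed smult)

lemma finsum:
  "finite I \<Longrightarrow> h \<in> I \<rightarrow> carrier M \<Longrightarrow> f (finsum M h I) = finsum N (\<lambda>i. f (h i)) I"
proof (induction I rule: finite_induct)
  case empty
  then show ?case by (simp add: zero)
next
  case (insert i I)
  then show ?case
    by (subst M.M.finsum_insert, simp, simp, blast, blast, subst N.M.finsum_insert)
       (auto simp: add closed Pi_iff intro!: M.M.finsum_closed)
qed

lemma submodule_kernel: "submodule (mod_kernel M N f) R M"
  by (rule M.submoduleI) (auto simp: mod_kernel_def zero add smult M.smult_closed)

lemma submodule_image:
  assumes H: "submodule H R M"
  shows "submodule (f ` H) R N"
proof (rule N.submoduleI)
  note sub = submodule_subset[OF H]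
  show "f ` H \<subseteq> carrier N" using sub closed by blast
  show "\<zero>\<^bsub>N\<^esub> \<in> f ` H" using submodule_zero[OF H] by (simp add: zero[symmetric])
  show "x \<oplus>\<^bsub>N\<^esub> y \<in> f ` H" if "x \<in> f ` H" "y \<in> f ` H" for x y
  proof -
    from that obtain x' y' where "x' \<in> H" "y' \<in> H" "x = f x'" "y = f y'" by blast
    then show ?thesis
      using submodule_add[OF H, of x' y'] sub by (simp add: add[symmetric] subsetD)
  qed
  show "a \<odot>\<^bsub>N\<^esub> x \<in> f ` H" if "a \<in> carrier R" "x \<in> f ` H" for a x
  proof -
    from that obtain x' where "x' \<in> H" "x = f x'" by blast
    then show ?thesis
      using submodule_smult[OF H that(1), of x'] sub that(1) by (simp add: smult[symmetric] subsetD)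
  qed
qed

lemma submodule_preimage: "submodule H R N \<Longrightarrow> submodule {x \<in> carrier M. f x \<in> H} R M"
  by (rule M.submoduleI)
     (auto simp: zero add smult M.smult_closed submodule_zero submodule_add submodule_smult)

lemma inj_on_iff_kernel: "inj_on f (carrier M) \<longleftrightarrow> mod_kernel M N f = {\<zero>\<^bsub>M\<^esub>}"
proof
  assume "inj_on f (carrier M)"
  then show "mod_kernel M N f = {\<zero>\<^bsub>M\<^esub>}"
    using zero by (auto simp: mod_kernel_def dest: inj_onD[of f "carrier M" _ "\<zero>\<^bsub>M\<^esub>"])
next
  assume k: "mod_kernel M N f = {\<zero>\<^bsub>M\<^esub>}"
  show "inj_on f (carrier M)"
  proof (rule inj_onI)
    fix x y assume xy: "x \<in> carrier M" "y \<in> carrier M" "f x = f y"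
    then have "x \<ominus>\<^bsub>M\<^esub> y \<in> mod_kernel M N f"
      by (simp add: mod_kernel_def a_minus_def add neg closed N.M.r_neg)
    then have "x \<oplus>\<^bsub>M\<^esub> \<ominus>\<^bsub>M\<^esub> y = \<zero>\<^bsub>M\<^esub>" using k by (simp add: a_minus_def)
    then show "x = y" using xy M.M.minus_equality[of x "\<ominus>\<^bsub>M\<^esub> y"] by simp
  qed
qed

end

lemma mod_iso_inverse:
  assumes "right_module R M" and "right_module R N"
    and "f \<in> mod_hom R M N" and "bij_betw f (carrier M) (carrier N)"
  shows "the_inv_into (carrier M) f \<in> mod_hom R N M"
    and "bij_betw (the_inv_into (carrier M) f) (carrier N) (carrier M)"
proof -
  interpret right_module_hom R M N f
    using assms by (simp add: right_module_hom_def right_module_hom_axioms_def)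
  let ?g = "the_inv_into (carrier M) f"
  have inj: "inj_on f (carrier M)" and im: "f ` carrier M = carrier N"
    using assms(4) by (auto simp: bij_betw_def)
  have g: "?g y \<in> carrier M" "f (?g y) = y" if "y \<in> carrier N" for y
    using that inj im the_inv_into_into[OF inj, of y "carrier M"] f_the_inv_into_f[OF inj, of y] by auto
  have gI: "?g y = x" if "x \<in> carrier M" "f x = y" for x y
    using the_inv_into_f_eq[OF inj that(2) that(1)] .
  show "?g \<in> mod_hom R N M"
    by (rule mod_homI) (auto intro!: gI simp: g add smult M.smult_closed)
  show "bij_betw ?g (carrier N) (carrier M)"
    by (rule bij_betw_the_inv_into[OF assms(4)])
qed

lemma mod_iso_refl: "mod_iso R M M"
  unfolding mod_iso_def by (rule bexI[OF _ mod_hom_id]) (simp add: bij_betw_def)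

lemma mod_iso_sym:
  "right_module R M \<Longrightarrow> right_module R N \<Longrightarrow> mod_iso R M N \<Longrightarrow> mod_iso R N M"
  unfolding mod_iso_def using mod_iso_inverse by blast

lemma mod_iso_trans: "mod_iso R L M \<Longrightarrow> mod_iso R M N \<Longrightarrow> mod_iso R L N"
proof -
  assume "mod_iso R L M" "mod_iso R M N"
  then obtain f g where f: "f \<in> mod_hom R L M" "bij_betw f (carrier L) (carrier M)"
    and g: "g \<in> mod_hom R M N" "bij_betw g (carrier M) (carrier N)"
    by (auto simp: mod_iso_def)
  then show ?thesis
    using mod_hom_comp[OF f(1) g(1)] bij_betw_trans[OF f(2) g(2)]
    by (auto simp: mod_iso_def comp_def)
qed

lemma right_module_direct_sum2:
  assumes "right_module R M" and "right_module R N"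
  shows "right_module R (direct_sum2 M N)"
proof -
  interpret M: right_module R M by fact
  interpret N: right_module R N by fact
  have "abelian_group (direct_sum2 M N)"
  proof (rule abelian_groupI)
    fix z assume "z \<in> carrier (direct_sum2 M N)"
    then show "\<exists>y\<in>carrier (direct_sum2 M N). y \<oplus>\<^bsub>direct_sum2 M N\<^esub> z = \<zero>\<^bsub>direct_sum2 M N\<^esub>"
      by (auto simp: direct_sum2_def M.M.l_neg N.M.l_neg
          intro!: bexI[of _ "\<ominus>\<^bsub>M\<^esub> fst z"] bexI[of _ "\<ominus>\<^bsub>N\<^esub> snd z"])
  qed (auto simp: direct_sum2_def M.M.a_ac N.M.a_ac)
  then show ?thesis
    unfolding right_module_def right_module_axioms_def
    by (auto simp: M.R.ring_axioms direct_sum2_def M.smult_closed N.smult_closed M.smult_add_scalar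
        N.smult_add_scalar M.smult_add N.smult_add M.smult_assoc N.smult_assoc M.smult_one N.smult_one)
qed

section \<open>Length\<close>

text \<open>The zero submodule is left out, so that the cardinality of a chain counts its steps
  starting from 0.\<close>

definition submodule_chain :: "'r ring \<Rightarrow> ('r, 'm) module \<Rightarrow> 'm set set \<Rightarrow> bool" where
  "submodule_chain R M C \<longleftrightarrow> finite C \<and> (\<forall>H\<in>C. submodule H R M \<and> H \<noteq> {\<zero>\<^bsub>M\<^esub>}) \<and>
     (\<forall>H\<in>C. \<forall>K\<in>C. H \<subseteq> K \<or> K \<subseteq> H)"

text \<open>A supremum in \<open>enat\<close>, so that infinite length is a value like any other and
  no particular chain has to be chosen.\<close>

definition mod_length :: "'r ring \<Rightarrow> ('r, 'm) module \<Rightarrow> enat" where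
  "mod_length R M = (SUP C\<in>{C. submodule_chain R M C}. enat (card C))"

lemma submodule_chain_subset: "submodule_chain R M C \<Longrightarrow> C' \<subseteq> C \<Longrightarrow> submodule_chain R M C'"
  unfolding submodule_chain_def by (meson finite_subset subsetD)

lemma submodule_chain_image:
  assumes C: "submodule_chain R M C" and mono: "\<And>H K. H \<subseteq> K \<Longrightarrow> g H \<subseteq> g K"
    and sub: "\<And>H. submodule H R M \<Longrightarrow> submodule (g H) R N"
  shows "submodule_chain R N (g ` C - {{\<zero>\<^bsub>N\<^esub>}})"
  unfolding submodule_chain_def
proof (intro conjI ballI)
  show "finite (g ` C - {{\<zero>\<^bsub>N\<^esub>}})" using C by (simp add: submodule_chain_def)
  fix H assume "H \<in> g ` C - {{\<zero>\<^bsub>N\<^esub>}}"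
  then obtain H' where H': "H' \<in> C" "H = g H'" "H \<noteq> {\<zero>\<^bsub>N\<^esub>}" by blast
  then show "submodule H R N" "H \<noteq> {\<zero>\<^bsub>N\<^esub>}" using sub C by (auto simp: submodule_chain_def)
  fix K assume "K \<in> g ` C - {{\<zero>\<^bsub>N\<^esub>}}"
  then obtain K' where K': "K' \<in> C" "K = g K'" by blast
  have "H' \<subseteq> K' \<or> K' \<subseteq> H'" using C H'(1) K'(1) unfolding submodule_chain_def by blast
  then show "H \<subseteq> K \<or> K \<subseteq> H" using mono H'(2) K'(2) by blast
qed

lemma card_le_mod_length: "submodule_chain R M C \<Longrightarrow> enat (card C) \<le> mod_length R M"
  unfolding mod_length_def by (rule SUP_upper) simp

text \<open>A subset of a chain is a chain, so every finite number up to the supremum is the size of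
  an actual chain. This turns inequalities of lengths into constructions of chains.\<close>

lemma enat_le_mod_length_iff: "enat k \<le> mod_length R M \<longleftrightarrow> (\<exists>C. submodule_chain R M C \<and> card C = k)"
proof
  assume k: "enat k \<le> mod_length R M"
  show "\<exists>C. submodule_chain R M C \<and> card C = k"
  proof (cases k)
    case 0
    have "submodule_chain R M {}" by (simp add: submodule_chain_def)
    then show ?thesis using 0 by (intro exI[of _ "{}"]) simp
  next
    case (Suc k')
    then have "enat k' < mod_length R M" using k Suc_ile_eq by auto
    then obtain C where C: "submodule_chain R M C" "enat k' < enat (card C)"
      unfolding mod_length_def by (auto simp: less_SUP_iff)
    then obtain C' where "C' \<subseteq> C" "card C' = k"
      using Suc obtain_subset_with_card_n[of k C] by auto
    then show ?thesis using submodule_chain_subset[OF C(1)] by blast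
  qed
next
  assume "\<exists>C. submodule_chain R M C \<and> card C = k"
  then show "enat k \<le> mod_length R M" using card_le_mod_length by blast
qed

text \<open>Splits a lower bound for a sum of lengths, of which either may be infinite, into two
  finite bounds that chains can realise.\<close>

lemma enat_le_add_split:
  fixes a b :: enat
  assumes "enat k \<le> a + b"
  obtains i j where "i + j = k" and "enat i \<le> a" and "enat j \<le> b"
proof (cases "enat k \<le> a")
  case True
  then show thesis using that[of k 0] by (simp add: zero_enat_def[symmetric])
next
  case False
  then obtain i where i: "a = enat i" "i < k" by (cases a) auto
  then have "enat (k - i) \<le> b" using assms by (cases b) auto
  then show thesis using that[of i "k - i"] i by simp
qed

lemma card_add_strict_mono:
  assumes "x \<in> A - A' \<or> y \<in> B - B'" and "finite A" and "finite B" and "A' \<subseteq> A" and "B' \<subseteq> B"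
  shows "card A' + card B' < card A + card B"
proof -
  have "card A' \<le> card A" "card B' \<le> card B" using assms by (auto intro: card_mono)
  moreover have "card A' < card A \<or> card B' < card B"
    using assms by (metis Diff_iff psubsetI psubset_card_mono)
  ultimately show ?thesis by linarith
qed

context right_module_hom
begin

text \<open>A strict step in a chain is still strict after intersecting with the kernel or after
  passing to the image.\<close>

lemma image_kernel_strict:
  assumes H: "submodule H R M" and K: "submodule K R M" and "H \<subseteq> K"
    and "mod_kernel M N f \<inter> K \<subseteq> H" and "f ` K \<subseteq> f ` H"
  shows "H = K"
proof
  show "K \<subseteq> H"
  proof
    fix x assume x: "x \<in> K"
    then obtain y where y: "y \<in> H" "f x = f y" using assms(5) by auto
    have c: "x \<in> carrier M" "y \<in> carrier M" using x y submodule_subset H K by blast+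
    have "x \<ominus>\<^bsub>M\<^esub> y \<in> mod_kernel M N f \<inter> K"
      using c y x assms(3) submodule_add[OF K] M.submodule_neg[OF K]
      by (auto simp: mod_kernel_def a_minus_def add neg closed N.M.r_neg)
    then have "x \<ominus>\<^bsub>M\<^esub> y \<in> H" using assms(4) by auto
    then have "(x \<ominus>\<^bsub>M\<^esub> y) \<oplus>\<^bsub>M\<^esub> y \<in> H" using submodule_add[OF H] y by auto
    then show "x \<in> H" using c by (simp add: a_minus_def M.M.a_assoc M.M.l_neg)
  qed
qed fact

text \<open>Induction by removing the largest member \<open>K\<close>. It lies strictly above all
  others, so by \<open>image_kernel_strict\<close> either its intersection with the kernel or its
  image is not obtained from the remaining members.\<close>

lemma chain_card_le:
  assumes "submodule_chain R M C"
  shows "card C \<le> card ((\<lambda>H. mod_kernel M N f \<inter> H) ` C - {{\<zero>\<^bsub>M\<^esub>}}) + card ((\<lambda>H. f ` H) ` C - {{\<zero>\<^bsub>N\<^esub>}})"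
proof -
  have "finite C" using assms by (simp add: submodule_chain_def)
  then show ?thesis using assms
  proof (induction "card C" arbitrary: C)
    case 0
    then show ?case by simp
  next
    case (Suc n)
    let ?A = "\<lambda>C. (\<lambda>H. mod_kernel M N f \<inter> H) ` C - {{\<zero>\<^bsub>M\<^esub>}}"
    let ?B = "\<lambda>C. (\<lambda>H. f ` H) ` C - {{\<zero>\<^bsub>N\<^esub>}}"
    have fin: "finite C" and ne: "C \<noteq> {}" using Suc by auto
    obtain K where K: "K \<in> C" "\<And>H. H \<in> C \<Longrightarrow> K \<subseteq> H \<Longrightarrow> K = H"
      using finite_has_maximal[OF fin ne] by metis
    have tot: "\<And>H H'. H \<in> C \<Longrightarrow> H' \<in> C \<Longrightarrow> H \<subseteq> H' \<or> H' \<subseteq> H"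
      using Suc.prems(2) by (simp add: submodule_chain_def)
    have top: "H \<subseteq> K" if "H \<in> C" for H
      using tot[OF that K(1)] K(2)[OF that] by auto
    let ?C = "C - {K}"
    have ch: "submodule_chain R M ?C" using Suc.prems(2) submodule_chain_subset by blast
    have IH: "card ?C \<le> card (?A ?C) + card (?B ?C)"
      using Suc.hyps ch fin K(1) by (intro Suc.hyps(1)) auto
    have sm: "submodule H R M" "H \<noteq> {\<zero>\<^bsub>M\<^esub>}" if "H \<in> C" for H
      using that Suc.prems(2) by (auto simp: submodule_chain_def)
    \<comment> \<open>The member just below \<open>K\<close>, or 0 if \<open>K\<close> is the only
      one; as chains do not contain 0, the inclusion is strict in the second case too.\<close>
    obtain H where H: "submodule H R M" "H \<subset> K" "\<And>H'. H' \<in> ?C \<Longrightarrow> H' \<subseteq> H"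
    proof (cases "?C = {}")
      case True
      have "{\<zero>\<^bsub>M\<^esub>} \<subset> K" using sm[OF K(1)] submodule_zero by blast
      then show thesis using that[OF M.submodule_0] True by auto
    next
      case False
      have "finite ?C" using fin by simp
      from finite_has_maximal[OF this False]
      obtain H where H: "H \<in> ?C" "\<And>H'. H' \<in> ?C \<Longrightarrow> H \<subseteq> H' \<Longrightarrow> H = H'"
        by metis
      have "H' \<subseteq> H" if "H' \<in> ?C" for H'
        using tot[of H H'] H(2)[OF that] H(1) that by auto
      then show thesis
        using that[of H] sm(1)[of H] top[of H] H(1) by auto
    qed
    have "\<not> mod_kernel M N f \<inter> K \<subseteq> H \<or> \<not> f ` K \<subseteq> f ` H"
      using image_kernel_strict[OF H(1) sm(1)[OF K(1)]] H(2) by blast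
    then have "mod_kernel M N f \<inter> K \<in> ?A C - ?A ?C \<or> f ` K \<in> ?B C - ?B ?C"
    proof
      assume n: "\<not> mod_kernel M N f \<inter> K \<subseteq> H"
      then have "mod_kernel M N f \<inter> K \<noteq> {\<zero>\<^bsub>M\<^esub>}" using submodule_zero[OF H(1)] n
        by (metis empty_subsetI insert_subset)
      moreover have "mod_kernel M N f \<inter> K \<noteq> mod_kernel M N f \<inter> H'" if "H' \<in> ?C" for H'
        using H(3)[OF that] n by blast
      ultimately show ?thesis using K(1) by blast
    next
      assume n: "\<not> f ` K \<subseteq> f ` H"
      then have "f ` K \<noteq> {\<zero>\<^bsub>N\<^esub>}" using submodule_zero[OF submodule_image[OF H(1)]] n
        by (metis empty_subsetI insert_subset)
      moreover have "f ` K \<noteq> f ` H'" if "H' \<in> ?C" for H'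
        using H(3)[OF that] n by blast
      ultimately show ?thesis using K(1) by blast
    qed
    moreover have fA: "finite (?A C)" "finite (?B C)" using fin by simp_all
    moreover have sA: "?A ?C \<subseteq> ?A C" "?B ?C \<subseteq> ?B C"
      by (rule Diff_mono[OF image_mono order_refl], rule Diff_subset)+
    ultimately have "card (?A ?C) + card (?B ?C) < card (?A C) + card (?B C)"
      by (intro card_add_strict_mono)
    then show ?case using IH fin K(1) by (simp add: card_Diff_singleton)
  qed
qed

text \<open>Upper bound: a chain of \<open>M\<close> is split into its traces on the kernel and its
  images. Lower bound: a chain of the kernel is continued by the preimages of a chain of
  \<open>N\<close>, which all contain the kernel strictly.\<close>

theorem mod_length_add:
  assumes surj: "f ` carrier M = carrier N"
  shows "mod_length R M = mod_length R (M\<lparr>carrier := mod_kernel M N f\<rparr>) + mod_length R N"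
proof (rule antisym)
  let ?K = "mod_kernel M N f"
  note K = submodule_kernel
  show "mod_length R M \<le> mod_length R (M\<lparr>carrier := ?K\<rparr>) + mod_length R N"
    unfolding mod_length_def[of R M]
  proof (rule SUP_least, simp only: mem_Collect_eq)
    fix C assume C: "submodule_chain R M C"
    let ?A = "(\<lambda>H. ?K \<inter> H) ` C - {{\<zero>\<^bsub>M\<^esub>}}" and ?B = "(\<lambda>H. f ` H) ` C - {{\<zero>\<^bsub>N\<^esub>}}"
    have "submodule (?K \<inter> H) R (M\<lparr>carrier := ?K\<rparr>)" if "submodule H R M" for H
      using M.submodule_Inter[of "{?K, H}"] K that by (auto simp: M.submodule_of_submodule[OF K])
    then have A: "submodule_chain R (M\<lparr>carrier := ?K\<rparr>) ?A"
      using submodule_chain_image[OF C, of "\<lambda>H. ?K \<inter> H" "M\<lparr>carrier := ?K\<rparr>"]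
      by (simp add: le_infI2)
    have B: "submodule_chain R N ?B"
      by (rule submodule_chain_image[OF C]) (simp_all add: image_mono submodule_image)
    have "enat (card C) \<le> enat (card ?A) + enat (card ?B)" using chain_card_le[OF C] by simp
    also have "\<dots> \<le> mod_length R (M\<lparr>carrier := ?K\<rparr>) + mod_length R N"
      by (rule add_mono[OF card_le_mod_length[OF A] card_le_mod_length[OF B]])
    finally show "enat (card C) \<le> mod_length R (M\<lparr>carrier := ?K\<rparr>) + mod_length R N" .
  qed
  show "mod_length R (M\<lparr>carrier := ?K\<rparr>) + mod_length R N \<le> mod_length R M"
  proof (rule ccontr)
    \<comment> \<open>If the bound fails, the length of \<open>M\<close> is some finite
      \<open>k\<close>, whereas the sum admits chains with \<open>k + 1\<close> members in total,
      also when a summand is infinite.\<close>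
    assume "\<not> ?thesis"
    then obtain k where k: "mod_length R M = enat k" "enat k < mod_length R (M\<lparr>carrier := ?K\<rparr>) + mod_length R N"
      by (cases "mod_length R M") (auto simp: not_le)
    then have "enat (Suc k) \<le> mod_length R (M\<lparr>carrier := ?K\<rparr>) + mod_length R N"
      by (simp add: Suc_ile_eq)
    then obtain i j where ij: "i + j = Suc k" "enat i \<le> mod_length R (M\<lparr>carrier := ?K\<rparr>)" "enat j \<le> mod_length R N"
      by (rule enat_le_add_split)
    then obtain A B where A: "submodule_chain R (M\<lparr>carrier := ?K\<rparr>) A" "card A = i"
      and B: "submodule_chain R N B" "card B = j"
      by (auto simp: enat_le_mod_length_iff)
    let ?p = "\<lambda>H. {x \<in> carrier M. f x \<in> H}"
    have sA: "\<And>H. H \<in> A \<Longrightarrow> submodule H R M \<and> H \<subseteq> ?K" "\<And>H. H \<in> A \<Longrightarrow> H \<noteq> {\<zero>\<^bsub>M\<^esub>}"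
      using A(1) by (auto simp: submodule_chain_def M.submodule_of_submodule[OF K])
    have sB: "\<And>H. H \<in> B \<Longrightarrow> submodule H R N" "\<And>H. H \<in> B \<Longrightarrow> H \<noteq> {\<zero>\<^bsub>N\<^esub>}"
      using B(1) by (auto simp: submodule_chain_def)
    have im: "f ` ?p H = H" if "H \<in> B" for H
      using submodule_subset[OF sB(1)[OF that]] surj by auto
    then have inj: "inj_on ?p B" by (metis (no_types, lifting) inj_on_def)
    have KB: "?K \<subset> ?p H" if "H \<in> B" for H
    proof -
      have "\<zero>\<^bsub>N\<^esub> \<in> H" by (rule submodule_zero[OF sB(1)[OF that]])
      then have 1: "?K \<subseteq> ?p H" by (auto simp: mod_kernel_def)
      have "H \<noteq> {\<zero>\<^bsub>N\<^esub>}" by (rule sB(2)[OF that])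
      then obtain y where y: "y \<in> H" "y \<noteq> \<zero>\<^bsub>N\<^esub>" using \<open>\<zero>\<^bsub>N\<^esub> \<in> H\<close> by blast
      have "f ` ?p H = H" by (rule im[OF that])
      then have "y \<in> f ` ?p H" using y(1) by simp
      then obtain x where x: "x \<in> ?p H" "y = f x" by (rule imageE)
      then have "x \<notin> ?K" using y(2) by (simp add: mod_kernel_def)
      then show ?thesis using 1 x(1) by (metis psubsetI)
    qed
    have AB: "L \<subset> ?p H" if "L \<in> A" and "H \<in> B" for L H
      by (rule order_le_less_trans[OF conjunct2[OF sA(1)[OF that(1)]] KB[OF that(2)]])
    then have disj: "A \<inter> ?p ` B = {}" by (auto simp del: mem_Collect_eq)
    have "submodule_chain R M (A \<union> ?p ` B)"
      unfolding submodule_chain_def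
    proof (intro conjI ballI)
      show "finite (A \<union> ?p ` B)" using A B by (simp add: submodule_chain_def)
      fix H assume H: "H \<in> A \<union> ?p ` B"
      show "submodule H R M" using H sA(1) submodule_preimage[OF sB(1)] by auto
      show "H \<noteq> {\<zero>\<^bsub>M\<^esub>}"
      proof (cases "H \<in> A")
        case False
        then obtain Y where "Y \<in> B" "H = ?p Y" using H by auto
        then have "?K \<subset> H" using KB by simp
        then show ?thesis using submodule_zero[OF K] by auto
      qed (rule sA(2))
      fix L assume L: "L \<in> A \<union> ?p ` B"
      have "U \<subseteq> W \<or> W \<subseteq> U" if "U \<in> A" "W \<in> A" for U W
        using that A(1) by (auto simp: submodule_chain_def)
      moreover have "U \<subseteq> W \<or> W \<subseteq> U" if "U \<in> B" "W \<in> B" for U W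
        using that B(1) by (auto simp: submodule_chain_def)
      moreover have "?p U \<subseteq> ?p W" if "U \<subseteq> W" for U W using that by auto
      moreover have "U \<subseteq> ?p W" if "U \<in> A" "W \<in> B" for U W using AB[OF that] by simp
      ultimately show "H \<subseteq> L \<or> L \<subseteq> H" using H L by (smt (verit) UnE imageE)
    qed
    then have "enat (card (A \<union> ?p ` B)) \<le> mod_length R M" by (rule card_le_mod_length)
    moreover have "card (A \<union> ?p ` B) = Suc k"
      using A B disj inj ij(1) by (subst card_Un_disjoint) (auto simp: submodule_chain_def card_image)
    ultimately show False using k(1) by simp
  qed
qed

end

lemma (in right_module) mod_length_mono:
  assumes "submodule H R M" and "submodule K R M" and "H \<subseteq> K"
  shows "mod_length R (M\<lparr>carrier := H\<rparr>) \<le> mod_length R (M\<lparr>carrier := K\<rparr>)"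
proof -
  have "submodule_chain R (M\<lparr>carrier := K\<rparr>) C" if "submodule_chain R (M\<lparr>carrier := H\<rparr>) C" for C
    using that assms(3) unfolding submodule_chain_def
    by (simp add: submodule_of_submodule[OF assms(1)] submodule_of_submodule[OF assms(2)]) (meson order_trans)
  then show ?thesis unfolding mod_length_def by (intro SUP_subset_mono) auto
qed

text \<open>A chain realising the length of \<open>H\<close> is extended by \<open>K\<close> on top;
  finiteness guarantees that such a chain exists.\<close>

lemma (in right_module) mod_length_strict_mono:
  assumes H: "submodule H R M" and K: "submodule K R M" and "H \<subset> K"
    and fin: "mod_length R (M\<lparr>carrier := K\<rparr>) \<noteq> \<infinity>"
  shows "mod_length R (M\<lparr>carrier := H\<rparr>) < mod_length R (M\<lparr>carrier := K\<rparr>)"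
proof -
  have "mod_length R (M\<lparr>carrier := H\<rparr>) \<noteq> \<infinity>"
    using mod_length_mono[OF H K] assms(3) fin by (auto simp: top.extremum_unique)
  then obtain n where n: "mod_length R (M\<lparr>carrier := H\<rparr>) = enat n" by auto
  then obtain C where C: "submodule_chain R (M\<lparr>carrier := H\<rparr>) C" "card C = n"
    by (metis enat_le_mod_length_iff order_refl)
  have CH: "submodule L R M" "L \<subseteq> H" "L \<noteq> {\<zero>\<^bsub>M\<^esub>}" if "L \<in> C" for L
    using C(1) that by (auto simp: submodule_chain_def submodule_of_submodule[OF H])
  have "K \<noteq> {\<zero>\<^bsub>M\<^esub>}" using assms(3) submodule_zero[OF H] by blast
  then have "submodule_chain R (M\<lparr>carrier := K\<rparr>) (insert K C)"
    unfolding submodule_chain_def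
  proof (intro conjI ballI)
    show "finite (insert K C)" using C(1) by (simp add: submodule_chain_def)
    have LK: "L \<subseteq> K" if "L \<in> insert K C" for L using that CH(2) assms(3) by blast
    fix L assume L: "L \<in> insert K C"
    then show "submodule L R (M\<lparr>carrier := K\<rparr>)"
      using CH(1) K LK[OF L] by (auto simp: submodule_of_submodule[OF K])
    show "L \<noteq> {\<zero>\<^bsub>M\<lparr>carrier := K\<rparr>\<^esub>}" using L CH(3) \<open>K \<noteq> {\<zero>\<^bsub>M\<^esub>}\<close> by auto
    fix L' assume L': "L' \<in> insert K C"
    have "L \<in> C \<Longrightarrow> L' \<in> C \<Longrightarrow> L \<subseteq> L' \<or> L' \<subseteq> L"
      using C(1) unfolding submodule_chain_def by blast
    then show "L \<subseteq> L' \<or> L' \<subseteq> L" using L L' LK[OF L] LK[OF L'] by blast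
  qed
  then have "enat (card (insert K C)) \<le> mod_length R (M\<lparr>carrier := K\<rparr>)" by (rule card_le_mod_length)
  moreover have "K \<notin> C" using CH assms(3) by blast
  ultimately show ?thesis
    using n C by (simp add: submodule_chain_def Suc_ile_eq)
qed

lemma (in right_module) mod_length_eq_0_iff: "mod_length R M = 0 \<longleftrightarrow> carrier M = {\<zero>\<^bsub>M\<^esub>}"
proof
  assume 0: "mod_length R M = 0"
  show "carrier M = {\<zero>\<^bsub>M\<^esub>}"
  proof (rule ccontr)
    assume "carrier M \<noteq> {\<zero>\<^bsub>M\<^esub>}"
    then have "submodule_chain R M {carrier M}"
      by (auto simp: submodule_chain_def submodule_carrier)
    from card_le_mod_length[OF this] 0 show False by (simp add: zero_enat_def)
  qed
next
  assume "carrier M = {\<zero>\<^bsub>M\<^esub>}"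
  then have z: "H = {\<zero>\<^bsub>M\<^esub>}" if "submodule H R M" for H
    using submodule_subset[OF that] submodule_zero[OF that] by auto
  then have "C = {}" if "submodule_chain R M C" for C
    using that z unfolding submodule_chain_def by (metis all_not_in_conv)
  then have "mod_length R M \<le> 0"
    unfolding mod_length_def by (intro SUP_least) (metis card.empty mem_Collect_eq order_refl zero_enat_def)
  then show "mod_length R M = 0" by simp
qed

lemma (in right_module) mod_length_simple:
  assumes "simple_module R M"
  shows "mod_length R M = 1"
proof -
  have "enat (card C) \<le> 1" if "submodule_chain R M C" for C
  proof -
    have "C \<subseteq> {carrier M}" using that assms by (auto simp: submodule_chain_def simple_module_def)
    then have "card C \<le> 1" using card_mono[of "{carrier M}" C] by simp
    then show ?thesis by (simp add: one_enat_def)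
  qed
  then have "mod_length R M \<le> 1" unfolding mod_length_def by (auto intro: SUP_least)
  moreover have "mod_length R M \<noteq> 0"
    using assms mod_length_eq_0_iff by (simp add: simple_module_def zero_module_def)
  ultimately show ?thesis by (cases "mod_length R M") (auto simp: one_enat_def zero_enat_def)
qed

text \<open>Rank-nullity for a map given only on the submodule \<open>H\<close> and not assumed
  onto: the target is cut down to the image before \<open>mod_length_add\<close> is applied.\<close>

lemma mod_length_map:
  assumes "right_module R M" and "right_module R N" and "submodule H R M"
    and f: "f \<in> mod_hom R (M\<lparr>carrier := H\<rparr>) N"
  shows "mod_length R (M\<lparr>carrier := H\<rparr>) =
    mod_length R (M\<lparr>carrier := {x \<in> H. f x = \<zero>\<^bsub>N\<^esub>}\<rparr>) + mod_length R (N\<lparr>carrier := f ` H\<rparr>)"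
proof -
  interpret M: right_module R M by fact
  interpret N: right_module R N by fact
  interpret H: right_module R "M\<lparr>carrier := H\<rparr>" by (rule M.right_module_submodule[OF assms(3)])
  interpret h: right_module_hom R "M\<lparr>carrier := H\<rparr>" N f
    by unfold_locales (rule f)
  have im: "submodule (f ` H) R N" using h.submodule_image[OF H.submodule_carrier] by simp
  interpret I: right_module R "N\<lparr>carrier := f ` H\<rparr>" by (rule N.right_module_submodule[OF im])
  interpret g: right_module_hom R "M\<lparr>carrier := H\<rparr>" "N\<lparr>carrier := f ` H\<rparr>" f
    by unfold_locales (use f in \<open>auto simp: mod_hom_def\<close>)
  show ?thesis using g.mod_length_add by (simp add: mod_kernel_def)
qed

section \<open>Vector spaces\<close>

text \<open>The ground field as a ring record, so that vector spaces are right modules over it and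
  their dimension is \<open>mod_length\<close>.\<close>

definition kring :: "'k::field ring" where
  "kring = \<lparr>carrier = UNIV, monoid.mult = (*), one = 1, ring.zero = 0, ring.add = (+)\<rparr>"

lemma kring_simps [simp]:
  "carrier kring = UNIV" "\<zero>\<^bsub>kring\<^esub> = 0" "\<one>\<^bsub>kring\<^esub> = 1"
  "a \<oplus>\<^bsub>kring\<^esub> b = a + b" "a \<otimes>\<^bsub>kring\<^esub> b = a * b"
  by (simp_all add: kring_def)

lemma ring_kring: "ring (kring :: 'k::field ring)"
proof (rule ringI)
  show "abelian_group (kring :: 'k ring)"
    by (rule abelian_groupI) (auto simp: algebra_simps intro: exI[of _ "- x" for x] ab_left_minus)
  show "Group.monoid (kring :: 'k ring)"
    by (rule monoidI) auto
qed (auto simp: algebra_simps)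

text \<open>Functions are extended by 0 outside \<open>S\<close> instead of being restricted to it,
  so the operations are those of the full function type.\<close>

definition fun_space :: "'s set \<Rightarrow> ('k::field, 's \<Rightarrow> 'k) module" where
  "fun_space S = \<lparr>carrier = {f. \<forall>s. s \<notin> S \<longrightarrow> f s = 0}, monoid.mult = undefined, one = undefined,
     ring.zero = (\<lambda>_. 0), ring.add = (\<lambda>f g s. f s + g s), smult = (\<lambda>c f s. c * f s)\<rparr>"

lemma right_module_fun_space: "right_module kring (fun_space S :: ('k::field, 's \<Rightarrow> 'k) module)"
proof -
  have "abelian_group (fun_space S :: ('k, 's \<Rightarrow> 'k) module)"
  proof (rule abelian_groupI)
    fix f :: "'s \<Rightarrow> 'k" assume "f \<in> carrier (fun_space S)"
    then show "\<exists>g\<in>carrier (fun_space S). g \<oplus>\<^bsub>fun_space S\<^esub> f = \<zero>\<^bsub>fun_space S\<^esub>"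
      by (intro bexI[of _ "\<lambda>s. - f s"]) (auto simp: fun_space_def)
  qed (auto simp: fun_space_def fun_eq_iff)
  then show ?thesis
    unfolding right_module_def right_module_axioms_def
    by (auto simp: ring_kring fun_space_def fun_eq_iff algebra_simps)
qed

text \<open>Evaluation at the new point maps onto the functions on a one-point set, a simple module,
  and its kernel is the space for the smaller set.\<close>

lemma mod_length_fun_space:
  fixes S :: "'s set"
  assumes "finite S"
  shows "mod_length kring (fun_space S :: ('k::field, 's \<Rightarrow> 'k) module) = enat (card S)"
  using assms
proof (induction S rule: finite_induct)
  case empty
  interpret right_module kring "fun_space {} :: ('k, 's \<Rightarrow> 'k) module" by (rule right_module_fun_space)
  show ?case using mod_length_eq_0_iff by (auto simp: fun_space_def zero_enat_def)
next
  case (insert s S)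
  let ?U = "fun_space (insert s S) :: ('k, 's \<Rightarrow> 'k) module"
  let ?W = "fun_space {()} :: ('k, unit \<Rightarrow> 'k) module"
  let ?f = "\<lambda>h :: 's \<Rightarrow> 'k. \<lambda>_::unit. h s"
  interpret U: right_module kring ?U by (rule right_module_fun_space)
  interpret W: right_module kring ?W by (rule right_module_fun_space)
  interpret right_module_hom kring ?U ?W ?f
    by unfold_locales (auto simp: mod_hom_def fun_space_def)
  have surj: "?f ` carrier ?U = carrier ?W"
  proof -
    have "h \<in> ?f ` carrier ?U" for h
      by (intro image_eqI[of _ _ "\<lambda>t. if t = s then h () else 0"]) (auto simp: fun_space_def)
    then show ?thesis by (auto simp: fun_space_def)
  qed
  have ker: "?U\<lparr>carrier := mod_kernel ?U ?W ?f\<rparr> = fun_space S"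
    using insert.hyps by (auto simp: fun_space_def mod_kernel_def fun_eq_iff)
  have "simple_module kring ?W"
  proof -
    have "H = {\<zero>\<^bsub>?W\<^esub>} \<or> H = carrier ?W" if H: "submodule H kring ?W" for H
    proof (cases "H \<subseteq> {\<zero>\<^bsub>?W\<^esub>}")
      case True
      then show ?thesis using submodule_zero[OF H] by blast
    next
      case False
      then obtain h where h: "h \<in> H" "h \<noteq> \<zero>\<^bsub>?W\<^esub>" by blast
      then have "h () \<noteq> 0" by (auto simp: fun_space_def fun_eq_iff)
      then have "g \<in> H" for g
        using submodule_smult[OF H _ h(1), of "g () / h ()"]
        by (simp add: fun_space_def)
      then show ?thesis by (auto simp: fun_space_def)
    qed
    moreover have "\<not> zero_module ?W"
      by (auto simp: zero_module_def fun_space_def set_eq_iff fun_eq_iff intro: exI[of _ "\<lambda>_. 1"])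
    ultimately show ?thesis by (simp add: simple_module_def)
  qed
  then have "mod_length kring ?W = 1" by (rule W.mod_length_simple)
  then show ?case
    using mod_length_add[OF surj] insert by (simp add: ker one_enat_def)
qed

section \<open>Radical square zero rings in coordinates\<close>

text \<open>An axiomatic form of KQ/J^2: \<open>vc r i\<close> and \<open>ac r \<alpha>\<close> are
  the coefficients of \<open>r\<close> at the trivial path of \<open>i\<close> and at the arrow
  \<open>\<alpha>\<close>. They determine \<open>r\<close> and can be prescribed freely, and by the
  product rules two arrows multiply to 0. The whole module theory rests on these axioms; paths and
  cosets occur only where the quiver algebra is shown to satisfy them.\<close>

locale rad_sq_zero = R: ring R
  for R :: "'r ring" +
  fixes V :: "'v set" and E :: "'a set" and src trg :: "'a \<Rightarrow> 'v"
    and vc :: "'r \<Rightarrow> 'v \<Rightarrow> 'k::field" and ac :: "'r \<Rightarrow> 'a \<Rightarrow> 'k"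
  assumes finite_V: "finite V" and finite_E: "finite E"
    and src_in: "\<alpha> \<in> E \<Longrightarrow> src \<alpha> \<in> V" and trg_in: "\<alpha> \<in> E \<Longrightarrow> trg \<alpha> \<in> V"
    and coord_eqI: "\<lbrakk>r \<in> carrier R; s \<in> carrier R; \<And>i. i \<in> V \<Longrightarrow> vc r i = vc s i;
      \<And>\<alpha>. \<alpha> \<in> E \<Longrightarrow> ac r \<alpha> = ac s \<alpha>\<rbrakk> \<Longrightarrow> r = s"
    and coord_ex: "\<exists>r\<in>carrier R. (\<forall>i\<in>V. vc r i = f i) \<and> (\<forall>\<alpha>\<in>E. ac r \<alpha> = g \<alpha>)"
    and vc_add: "\<lbrakk>r \<in> carrier R; s \<in> carrier R; i \<in> V\<rbrakk> \<Longrightarrow> vc (r \<oplus>\<^bsub>R\<^esub> s) i = vc r i + vc s i"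
    and ac_add: "\<lbrakk>r \<in> carrier R; s \<in> carrier R; \<alpha> \<in> E\<rbrakk> \<Longrightarrow> ac (r \<oplus>\<^bsub>R\<^esub> s) \<alpha> = ac r \<alpha> + ac s \<alpha>"
    and vc_mult: "\<lbrakk>r \<in> carrier R; s \<in> carrier R; i \<in> V\<rbrakk> \<Longrightarrow> vc (r \<otimes>\<^bsub>R\<^esub> s) i = vc r i * vc s i"
    and ac_mult: "\<lbrakk>r \<in> carrier R; s \<in> carrier R; \<alpha> \<in> E\<rbrakk> \<Longrightarrow>
      ac (r \<otimes>\<^bsub>R\<^esub> s) \<alpha> = vc r (src \<alpha>) * ac s \<alpha> + ac r \<alpha> * vc s (trg \<alpha>)"
    and vc_one: "i \<in> V \<Longrightarrow> vc \<one>\<^bsub>R\<^esub> i = 1" and ac_one: "\<alpha> \<in> E \<Longrightarrow> ac \<one>\<^bsub>R\<^esub> \<alpha> = 0"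
begin

definition elt :: "('v \<Rightarrow> 'k) \<Rightarrow> ('a \<Rightarrow> 'k) \<Rightarrow> 'r" where
  "elt f g = (SOME r. r \<in> carrier R \<and> (\<forall>i\<in>V. vc r i = f i) \<and> (\<forall>\<alpha>\<in>E. ac r \<alpha> = g \<alpha>))"

lemma elt: "elt f g \<in> carrier R \<and> (\<forall>i\<in>V. vc (elt f g) i = f i) \<and> (\<forall>\<alpha>\<in>E. ac (elt f g) \<alpha> = g \<alpha>)"
  unfolding elt_def by (rule someI_ex) (use coord_ex[of f g] in blast)

text \<open>For vertices \<open>i\<close> and arrows \<open>\<alpha>\<close> these are the residue
  classes of the trivial path at \<open>i\<close>, of \<open>\<alpha>\<close>, and of
  \<open>c\<close> times the identity. The elements \<open>sc c\<close> embed the field in the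
  centre of \<open>R\<close>.\<close>

definition idem :: "'v \<Rightarrow> 'r" where "idem i = elt (\<lambda>j. if j = i then 1 else 0) (\<lambda>_. 0)"
definition arr :: "'a \<Rightarrow> 'r" where "arr \<alpha> = elt (\<lambda>_. 0) (\<lambda>\<beta>. if \<beta> = \<alpha> then 1 else 0)"
definition sc :: "'k \<Rightarrow> 'r" where "sc c = elt (\<lambda>_. c) (\<lambda>_. 0)"

lemma idem_closed [simp]: "idem i \<in> carrier R" and arr_closed [simp]: "arr \<alpha> \<in> carrier R"
  and sc_closed [simp]: "sc c \<in> carrier R"
  by (simp_all add: idem_def arr_def sc_def elt)

lemma coord_simps [simp]:
  "j \<in> V \<Longrightarrow> vc (idem i) j = (if j = i then 1 else 0)" "\<beta> \<in> E \<Longrightarrow> ac (idem i) \<beta> = 0"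
  "j \<in> V \<Longrightarrow> vc (arr \<alpha>) j = 0" "\<beta> \<in> E \<Longrightarrow> ac (arr \<alpha>) \<beta> = (if \<beta> = \<alpha> then 1 else 0)"
  "j \<in> V \<Longrightarrow> vc (sc c) j = c" "\<beta> \<in> E \<Longrightarrow> ac (sc c) \<beta> = 0"
  by (simp_all add: idem_def arr_def sc_def elt)

lemma vc_zero [simp]: "i \<in> V \<Longrightarrow> vc \<zero>\<^bsub>R\<^esub> i = 0" and ac_zero [simp]: "\<alpha> \<in> E \<Longrightarrow> ac \<zero>\<^bsub>R\<^esub> \<alpha> = 0"
  by (metis R.l_zero R.zero_closed add_cancel_right_right vc_add,
      metis R.l_zero R.zero_closed add_cancel_right_right ac_add)

lemmas coords = vc_add ac_add vc_mult ac_mult vc_one ac_one src_in trg_in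

lemma vc_finsum: "finite I \<Longrightarrow> f \<in> I \<rightarrow> carrier R \<Longrightarrow> i \<in> V \<Longrightarrow> vc (finsum R f I) i = (\<Sum>k\<in>I. vc (f k) i)"
proof (induction I rule: finite_induct)
  case (insert k I)
  have "finsum R f (insert k I) = f k \<oplus>\<^bsub>R\<^esub> finsum R f I"
    using insert by (intro R.finsum_insert) auto
  moreover have "finsum R f I \<in> carrier R" using insert by (intro R.finsum_closed) auto
  ultimately show ?case using insert by (simp add: vc_add Pi_iff)
qed simp

lemma ac_finsum: "finite I \<Longrightarrow> f \<in> I \<rightarrow> carrier R \<Longrightarrow> \<alpha> \<in> E \<Longrightarrow> ac (finsum R f I) \<alpha> = (\<Sum>k\<in>I. ac (f k) \<alpha>)"
proof (induction I rule: finite_induct)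
  case (insert k I)
  have "finsum R f (insert k I) = f k \<oplus>\<^bsub>R\<^esub> finsum R f I"
    using insert by (intro R.finsum_insert) auto
  moreover have "finsum R f I \<in> carrier R" using insert by (intro R.finsum_closed) auto
  ultimately show ?case using insert by (simp add: ac_add Pi_iff)
qed simp

lemma sc_add: "sc (c + d) = sc c \<oplus>\<^bsub>R\<^esub> sc d"
  and sc_mult: "sc (c * d) = sc c \<otimes>\<^bsub>R\<^esub> sc d"
  and sc_1: "sc 1 = \<one>\<^bsub>R\<^esub>" and sc_0: "sc 0 = \<zero>\<^bsub>R\<^esub>"
  by (rule coord_eqI; simp add: coords)+

lemma sc_commute: "r \<in> carrier R \<Longrightarrow> sc c \<otimes>\<^bsub>R\<^esub> r = r \<otimes>\<^bsub>R\<^esub> sc c"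
  by (rule coord_eqI) (simp_all add: coords)

lemma idem_idem: "idem i \<otimes>\<^bsub>R\<^esub> idem j = (if i = j then idem i else \<zero>\<^bsub>R\<^esub>)"
  and idem_arr: "\<alpha> \<in> E \<Longrightarrow> idem i \<otimes>\<^bsub>R\<^esub> arr \<alpha> = (if i = src \<alpha> then arr \<alpha> else \<zero>\<^bsub>R\<^esub>)"
  and arr_idem: "\<alpha> \<in> E \<Longrightarrow> arr \<alpha> \<otimes>\<^bsub>R\<^esub> idem i = (if i = trg \<alpha> then arr \<alpha> else \<zero>\<^bsub>R\<^esub>)"
  and arr_arr: "arr \<alpha> \<otimes>\<^bsub>R\<^esub> arr \<beta> = \<zero>\<^bsub>R\<^esub>"
  by (rule coord_eqI; auto simp: coords)+

lemma coord_expand: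
  assumes "r \<in> carrier R"
  shows "r = finsum R (\<lambda>i. idem i \<otimes>\<^bsub>R\<^esub> sc (vc r i)) V \<oplus>\<^bsub>R\<^esub> finsum R (\<lambda>\<alpha>. arr \<alpha> \<otimes>\<^bsub>R\<^esub> sc (ac r \<alpha>)) E"
proof (rule coord_eqI[OF assms])
  have cl: "finsum R (\<lambda>i. idem i \<otimes>\<^bsub>R\<^esub> sc (vc r i)) V \<in> carrier R"
    "finsum R (\<lambda>\<alpha>. arr \<alpha> \<otimes>\<^bsub>R\<^esub> sc (ac r \<alpha>)) E \<in> carrier R"
    by (auto intro!: R.finsum_closed)
  then show "finsum R (\<lambda>i. idem i \<otimes>\<^bsub>R\<^esub> sc (vc r i)) V \<oplus>\<^bsub>R\<^esub> finsum R (\<lambda>\<alpha>. arr \<alpha> \<otimes>\<^bsub>R\<^esub> sc (ac r \<alpha>)) E \<in> carrier R"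
    by simp
  have *: "(\<Sum>k\<in>V. (if j = k then 1 else 0) * vc r k) = vc r j" if "j \<in> V" for j
    using that finite_V by (simp add: if_distrib if_distribR sum.If_cases cong: if_cong)
  have **: "(\<Sum>k\<in>E. (if j = k then 1 else 0) * ac r k) = ac r j" if "j \<in> E" for j
    using that finite_E by (simp add: if_distrib if_distribR sum.If_cases cong: if_cong)
  show "vc r i = vc (finsum R (\<lambda>i. idem i \<otimes>\<^bsub>R\<^esub> sc (vc r i)) V \<oplus>\<^bsub>R\<^esub> finsum R (\<lambda>\<alpha>. arr \<alpha> \<otimes>\<^bsub>R\<^esub> sc (ac r \<alpha>)) E) i"
    if "i \<in> V" for i
    using that cl by (simp add: coords vc_finsum finite_V finite_E Pi_iff *)
  show "ac r \<alpha> = ac (finsum R (\<lambda>i. idem i \<otimes>\<^bsub>R\<^esub> sc (vc r i)) V \<oplus>\<^bsub>R\<^esub> finsum R (\<lambda>\<alpha>. arr \<alpha> \<otimes>\<^bsub>R\<^esub> sc (ac r \<alpha>)) E) \<alpha>"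
    if "\<alpha> \<in> E" for \<alpha>
    using that cl by (simp add: coords ac_finsum finite_V finite_E Pi_iff **)
qed

subsection \<open>Modules as graded vector spaces\<close>

text \<open>Restriction of scalars along \<open>sc\<close>. The carrier stays the same set, so a
  submodule of \<open>M\<close> is literally a subspace.\<close>

definition ks :: "('r, 'm) module \<Rightarrow> ('k, 'm) module" where
  "ks M = \<lparr>carrier = carrier M, monoid.mult = undefined, one = undefined,
     ring.zero = \<zero>\<^bsub>M\<^esub>, ring.add = ring.add M, smult = (\<lambda>c x. sc c \<odot>\<^bsub>M\<^esub> x)\<rparr>"

lemma ks_simps [simp]:
  "carrier (ks M) = carrier M" "\<zero>\<^bsub>ks M\<^esub> = \<zero>\<^bsub>M\<^esub>" "x \<oplus>\<^bsub>ks M\<^esub> y = x \<oplus>\<^bsub>M\<^esub> y"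
  "c \<odot>\<^bsub>ks M\<^esub> x = sc c \<odot>\<^bsub>M\<^esub> x"
  by (simp_all add: ks_def)

lemma right_module_ks:
  assumes "right_module R M"
  shows "right_module kring (ks M)"
proof -
  interpret right_module R M by fact
  have "abelian_group (ks M)"
  proof (rule abelian_groupI)
    fix x assume "x \<in> carrier (ks M)"
    then show "\<exists>y\<in>carrier (ks M). y \<oplus>\<^bsub>ks M\<^esub> x = \<zero>\<^bsub>ks M\<^esub>"
      by (intro bexI[of _ "\<ominus>\<^bsub>M\<^esub> x"]) (auto simp: M.l_neg)
  qed (auto simp: M.a_ac)
  then show ?thesis
    unfolding right_module_def right_module_axioms_def
    by (auto simp: ring_kring smult_closed sc_add sc_mult sc_1 smult_add_scalar smult_add smult_one
        smult_assoc sc_commute[of "sc c" for c])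
qed

text \<open>In usual notation \<open>comp\<close>, \<open>rad\<close>, \<open>radc\<close> and
  \<open>socc\<close> are M e_i, MJ, (MJ) e_i and (soc M) e_i. One summand per arrow suffices in
  \<open>rad\<close>, because x \<alpha> + y \<alpha> = (x + y) \<alpha>.\<close>

definition comp :: "('r, 'm) module \<Rightarrow> 'v \<Rightarrow> 'm set" where
  "comp M i = {x \<in> carrier M. idem i \<odot>\<^bsub>M\<^esub> x = x}"

definition rad :: "('r, 'm) module \<Rightarrow> 'm set" where
  "rad M = {finsum M (\<lambda>\<alpha>. arr \<alpha> \<odot>\<^bsub>M\<^esub> y \<alpha>) E | y. y \<in> E \<rightarrow> carrier M}"

definition radc :: "('r, 'm) module \<Rightarrow> 'v \<Rightarrow> 'm set" where
  "radc M i = rad M \<inter> comp M i"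

definition socc :: "('r, 'm) module \<Rightarrow> 'v \<Rightarrow> 'm set" where
  "socc M i = {x \<in> comp M i. \<forall>\<alpha>\<in>E. arr \<alpha> \<odot>\<^bsub>M\<^esub> x = \<zero>\<^bsub>M\<^esub>}"

definition kdim :: "('r, 'm) module \<Rightarrow> 'm set \<Rightarrow> enat" where
  "kdim M H = mod_length kring ((ks M)\<lparr>carrier := H\<rparr>)"

definition fin_dim :: "('r, 'm) module \<Rightarrow> bool" where
  "fin_dim M \<longleftrightarrow> kdim M (carrier M) \<noteq> \<infinity>"

text \<open>Integer valued, since multiplicities are differences of dimensions. It carries
  information only for finite dimension, whence the assumptions \<open>fin_dim\<close>
  below.\<close>

definition dm :: "('r, 'm) module \<Rightarrow> 'm set \<Rightarrow> int" where
  "dm M H = int (the_enat (kdim M H))"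

abbreviation subspace :: "('r, 'm) module \<Rightarrow> 'm set \<Rightarrow> bool" where
  "subspace M H \<equiv> submodule H kring (ks M)"

end

section \<open>Idempotents, arrows and the radical of a module; Nakayama's lemma\<close>

locale rsz_module = rad_sq_zero R V E src trg vc ac + right_module R M
  for R :: "'r ring" and V :: "'v set" and E :: "'a set" and src trg
    and vc :: "'r \<Rightarrow> 'v \<Rightarrow> 'k::field" and ac and M :: "('r, 'm) module" (structure)
begin

sublocale K: right_module kring "ks M"
  by (rule right_module_ks[OF right_module_axioms])

lemma subspaceI:
  assumes "H \<subseteq> carrier M" and "\<zero>\<^bsub>M\<^esub> \<in> H"
    and "\<And>x y. x \<in> H \<Longrightarrow> y \<in> H \<Longrightarrow> x \<oplus>\<^bsub>M\<^esub> y \<in> H"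
    and "\<And>c x. x \<in> H \<Longrightarrow> sc c \<odot>\<^bsub>M\<^esub> x \<in> H"
  shows "subspace M H"
  by (rule K.submoduleI) (use assms in auto)

lemma subspace_if_submodule: "submodule H R M \<Longrightarrow> subspace M H"
  by (rule subspaceI) (auto simp: submodule_zero submodule_add submodule_smult dest: submodule_subset[THEN subsetD])

lemma act_expand:
  assumes "r \<in> carrier R" and "x \<in> carrier M"
  shows "r \<odot>\<^bsub>M\<^esub> x = finsum M (\<lambda>i. sc (vc r i) \<odot>\<^bsub>M\<^esub> (idem i \<odot>\<^bsub>M\<^esub> x)) V \<oplus>\<^bsub>M\<^esub>
    finsum M (\<lambda>\<alpha>. sc (ac r \<alpha>) \<odot>\<^bsub>M\<^esub> (arr \<alpha> \<odot>\<^bsub>M\<^esub> x)) E"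
proof -
  have fs: "finsum R f I \<odot>\<^bsub>M\<^esub> x = finsum M (\<lambda>k. f k \<odot>\<^bsub>M\<^esub> x) I"
    if "finite I" "f \<in> I \<rightarrow> carrier R" for f :: "'i \<Rightarrow> 'r" and I
    using that
  proof (induction I rule: finite_induct)
    case (insert k I)
    have 1: "finsum R f (insert k I) = f k \<oplus>\<^bsub>R\<^esub> finsum R f I"
      using insert by (intro R.finsum_insert) auto
    have 2: "finsum M (\<lambda>k. f k \<odot>\<^bsub>M\<^esub> x) (insert k I) = f k \<odot>\<^bsub>M\<^esub> x \<oplus>\<^bsub>M\<^esub> finsum M (\<lambda>k. f k \<odot>\<^bsub>M\<^esub> x) I"
      using insert assms(2) by (intro M.finsum_insert) (auto simp: smult_closed Pi_iff)
    have "finsum R f I \<in> carrier R" using insert by (intro R.finsum_closed) auto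
    then show ?case using insert assms(2) by (simp add: 1 2 smult_add_scalar Pi_iff)
  qed (simp add: assms(2))
  have cl: "finsum R (\<lambda>i. idem i \<otimes>\<^bsub>R\<^esub> sc (vc r i)) V \<in> carrier R"
    "finsum R (\<lambda>\<alpha>. arr \<alpha> \<otimes>\<^bsub>R\<^esub> sc (ac r \<alpha>)) E \<in> carrier R"
    by (auto intro!: R.finsum_closed)
  show ?thesis
    by (subst coord_expand[OF assms(1)], subst smult_add_scalar[OF cl assms(2)])
       (simp add: fs finite_V finite_E smult_assoc assms(2))
qed

lemma smult_commute:
  "r \<in> carrier R \<Longrightarrow> x \<in> carrier M \<Longrightarrow> r \<odot>\<^bsub>M\<^esub> (sc c \<odot>\<^bsub>M\<^esub> x) = sc c \<odot>\<^bsub>M\<^esub> (r \<odot>\<^bsub>M\<^esub> x)"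
  using sc_commute[of r c] by (simp add: smult_assoc[symmetric])

lemma act_idem_idem:
  "x \<in> carrier M \<Longrightarrow> idem i \<odot>\<^bsub>M\<^esub> (idem j \<odot>\<^bsub>M\<^esub> x) = (if i = j then idem i \<odot>\<^bsub>M\<^esub> x else \<zero>\<^bsub>M\<^esub>)"
  by (simp add: smult_assoc[symmetric] idem_idem)

lemma act_arr_idem:
  "\<alpha> \<in> E \<Longrightarrow> x \<in> carrier M \<Longrightarrow> arr \<alpha> \<odot>\<^bsub>M\<^esub> (idem i \<odot>\<^bsub>M\<^esub> x) = (if i = src \<alpha> then arr \<alpha> \<odot>\<^bsub>M\<^esub> x else \<zero>\<^bsub>M\<^esub>)"
  by (simp add: smult_assoc[symmetric] idem_arr)

lemma act_idem_arr:
  "\<alpha> \<in> E \<Longrightarrow> x \<in> carrier M \<Longrightarrow> idem i \<odot>\<^bsub>M\<^esub> (arr \<alpha> \<odot>\<^bsub>M\<^esub> x) = (if i = trg \<alpha> then arr \<alpha> \<odot>\<^bsub>M\<^esub> x else \<zero>\<^bsub>M\<^esub>)"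
  by (simp add: smult_assoc[symmetric] arr_idem)

lemma act_arr_arr: "x \<in> carrier M \<Longrightarrow> arr \<alpha> \<odot>\<^bsub>M\<^esub> (arr \<beta> \<odot>\<^bsub>M\<^esub> x) = \<zero>\<^bsub>M\<^esub>"
  by (simp add: smult_assoc[symmetric] arr_arr)

lemma act_sc: "x \<in> carrier M \<Longrightarrow> sc c \<odot>\<^bsub>M\<^esub> (sc d \<odot>\<^bsub>M\<^esub> x) = sc (c * d) \<odot>\<^bsub>M\<^esub> x"
  by (simp add: smult_assoc[symmetric] sc_mult[symmetric] mult.commute)

text \<open>The Peirce decomposition, i.e. \<open>act_expand\<close> for the identity, whose arrow
  coordinates vanish.\<close>

lemma sum_idem_act:
  assumes "x \<in> carrier M"
  shows "finsum M (\<lambda>i. idem i \<odot>\<^bsub>M\<^esub> x) V = x"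
proof -
  have "finsum M (\<lambda>\<alpha>. sc (ac \<one>\<^bsub>R\<^esub> \<alpha>) \<odot>\<^bsub>M\<^esub> (arr \<alpha> \<odot>\<^bsub>M\<^esub> x)) E = \<zero>\<^bsub>M\<^esub>"
    by (rule M.add.finprod_one_eqI) (simp add: ac_one sc_0 smult_closed assms)
  moreover have "finsum M (\<lambda>i. sc (vc \<one>\<^bsub>R\<^esub> i) \<odot>\<^bsub>M\<^esub> (idem i \<odot>\<^bsub>M\<^esub> x)) V = finsum M (\<lambda>i. idem i \<odot>\<^bsub>M\<^esub> x) V"
    by (rule M.finsum_cong') (auto simp: vc_one sc_1 smult_closed assms smult_one)
  ultimately show ?thesis
    using act_expand[of "\<one>\<^bsub>R\<^esub>" x] assms
    by (simp add: smult_one smult_closed M.finsum_closed Pi_iff)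
qed

lemma subspace_finsum:
  assumes "subspace M H" and "finite I" and "\<And>k. k \<in> I \<Longrightarrow> f k \<in> H"
  shows "finsum M f I \<in> H"
  using assms(2,3)
proof (induction I rule: finite_induct)
  case empty
  then show ?case using submodule_zero[OF assms(1)] by simp
next
  case (insert k I)
  have "H \<subseteq> carrier M" using submodule_subset[OF assms(1)] by simp
  then have "finsum M f (insert k I) = f k \<oplus>\<^bsub>M\<^esub> finsum M f I"
    using insert by (intro M.finsum_insert) auto
  then show ?case using insert submodule_add[OF assms(1), of "f k" "finsum M f I"] by simp
qed

lemma subspace_comp: "subspace M (comp M i)"
  by (rule subspaceI) (auto simp: comp_def smult_add smult_commute smult_closed)

lemma idem_act_comp: "x \<in> carrier M \<Longrightarrow> idem i \<odot>\<^bsub>M\<^esub> x \<in> comp M i"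
  by (simp add: comp_def smult_closed act_idem_idem)

lemma arr_act_comp: "\<alpha> \<in> E \<Longrightarrow> x \<in> carrier M \<Longrightarrow> arr \<alpha> \<odot>\<^bsub>M\<^esub> x \<in> comp M (trg \<alpha>)"
  by (simp add: comp_def smult_closed act_idem_arr)

lemma subspace_socc: "subspace M (socc M i)"
  using subspace_comp[of i]
  by (intro subspaceI)
     (auto simp: comp_def socc_def smult_add smult_commute smult_closed)

lemma radI: "y \<in> E \<rightarrow> carrier M \<Longrightarrow> finsum M (\<lambda>\<alpha>. arr \<alpha> \<odot>\<^bsub>M\<^esub> y \<alpha>) E \<in> rad M"
  by (auto simp: rad_def)

lemma submodule_rad: "submodule (rad M) R M"
proof (rule submoduleI)
  show "rad M \<subseteq> carrier M" by (auto simp: rad_def smult_closed Pi_iff intro!: M.finsum_closed)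
  have "finsum M (\<lambda>\<alpha>. arr \<alpha> \<odot>\<^bsub>M\<^esub> \<zero>\<^bsub>M\<^esub>) E = \<zero>\<^bsub>M\<^esub>" by (rule M.add.finprod_one_eqI) simp
  then show "\<zero>\<^bsub>M\<^esub> \<in> rad M" using radI[of "\<lambda>_. \<zero>\<^bsub>M\<^esub>"] by simp
next
  fix x y assume "x \<in> rad M" "y \<in> rad M"
  then obtain u w where u: "u \<in> E \<rightarrow> carrier M" "x = finsum M (\<lambda>\<alpha>. arr \<alpha> \<odot>\<^bsub>M\<^esub> u \<alpha>) E"
    and w: "w \<in> E \<rightarrow> carrier M" "y = finsum M (\<lambda>\<alpha>. arr \<alpha> \<odot>\<^bsub>M\<^esub> w \<alpha>) E" by (auto simp: rad_def)
  have "finsum M (\<lambda>\<alpha>. arr \<alpha> \<odot>\<^bsub>M\<^esub> (u \<alpha> \<oplus>\<^bsub>M\<^esub> w \<alpha>)) E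
      = finsum M (\<lambda>\<alpha>. arr \<alpha> \<odot>\<^bsub>M\<^esub> u \<alpha> \<oplus>\<^bsub>M\<^esub> arr \<alpha> \<odot>\<^bsub>M\<^esub> w \<alpha>) E"
    by (rule M.finsum_cong') (use u w in \<open>auto simp: smult_add smult_closed Pi_iff\<close>)
  also have "\<dots> = x \<oplus>\<^bsub>M\<^esub> y"
    unfolding u w by (rule M.finsum_addf) (use u w in \<open>auto simp: smult_closed Pi_iff\<close>)
  finally show "x \<oplus>\<^bsub>M\<^esub> y \<in> rad M"
    using radI[of "\<lambda>\<alpha>. u \<alpha> \<oplus>\<^bsub>M\<^esub> w \<alpha>"] u w by (simp add: Pi_iff)
next
  fix a x assume a: "a \<in> carrier R" and "x \<in> rad M"
  then obtain u where u: "u \<in> E \<rightarrow> carrier M" "x = finsum M (\<lambda>\<alpha>. arr \<alpha> \<odot>\<^bsub>M\<^esub> u \<alpha>) E"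
    by (auto simp: rad_def)
  \<comment> \<open>Since J^2 = 0, only the coefficient of \<open>a\<close> at the target of
    \<alpha> survives to the right of \<alpha>, and it can be moved to the left as a scalar.\<close>
  have *: "arr \<alpha> \<otimes>\<^bsub>R\<^esub> a = sc (vc a (trg \<alpha>)) \<otimes>\<^bsub>R\<^esub> arr \<alpha>" if "\<alpha> \<in> E" for \<alpha>
    using that a by (intro coord_eqI) (auto simp: coords)
  have "a \<odot>\<^bsub>M\<^esub> x = finsum M (\<lambda>\<alpha>. a \<odot>\<^bsub>M\<^esub> (arr \<alpha> \<odot>\<^bsub>M\<^esub> u \<alpha>)) E"
    unfolding u by (rule smult_finsum[OF a finite_E]) (use u in \<open>auto simp: smult_closed Pi_iff\<close>)
  also have "\<dots> = finsum M (\<lambda>\<alpha>. arr \<alpha> \<odot>\<^bsub>M\<^esub> (sc (vc a (trg \<alpha>)) \<odot>\<^bsub>M\<^esub> u \<alpha>)) E"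
    by (rule M.finsum_cong')
       (use u a in \<open>auto simp: smult_assoc[symmetric] smult_closed Pi_iff *\<close>)
  finally show "a \<odot>\<^bsub>M\<^esub> x \<in> rad M"
    using radI[of "\<lambda>\<alpha>. sc (vc a (trg \<alpha>)) \<odot>\<^bsub>M\<^esub> u \<alpha>"] u by (simp add: smult_closed Pi_iff)
qed

lemma arr_act_rad:
  assumes "\<alpha> \<in> E" and "x \<in> carrier M"
  shows "arr \<alpha> \<odot>\<^bsub>M\<^esub> x \<in> rad M"
proof -
  have "finsum M (\<lambda>\<beta>. arr \<beta> \<odot>\<^bsub>M\<^esub> (if \<beta> = \<alpha> then x else \<zero>\<^bsub>M\<^esub>)) E
      = finsum M (\<lambda>\<beta>. if \<alpha> = \<beta> then arr \<beta> \<odot>\<^bsub>M\<^esub> x else \<zero>\<^bsub>M\<^esub>) E"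
    by (rule M.finsum_cong') (use assms in \<open>auto simp: smult_closed\<close>)
  also have "\<dots> = arr \<alpha> \<odot>\<^bsub>M\<^esub> x"
    by (rule M.add.finprod_singleton[OF assms(1) finite_E]) (use assms in \<open>auto simp: smult_closed\<close>)
  finally show ?thesis using radI[of "\<lambda>\<beta>. if \<beta> = \<alpha> then x else \<zero>\<^bsub>M\<^esub>"] assms by auto
qed

lemma arr_kills_rad:
  assumes "x \<in> rad M"
  shows "arr \<beta> \<odot>\<^bsub>M\<^esub> x = \<zero>\<^bsub>M\<^esub>"
proof -
  obtain u where u: "u \<in> E \<rightarrow> carrier M" "x = finsum M (\<lambda>\<alpha>. arr \<alpha> \<odot>\<^bsub>M\<^esub> u \<alpha>) E"
    using assms by (auto simp: rad_def)
  have "arr \<beta> \<odot>\<^bsub>M\<^esub> x = finsum M (\<lambda>\<alpha>. arr \<beta> \<odot>\<^bsub>M\<^esub> (arr \<alpha> \<odot>\<^bsub>M\<^esub> u \<alpha>)) E"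
    unfolding u by (rule smult_finsum[OF arr_closed finite_E]) (use u in \<open>auto simp: smult_closed Pi_iff\<close>)
  also have "\<dots> = \<zero>\<^bsub>M\<^esub>"
    by (rule M.add.finprod_one_eqI) (use u in \<open>auto simp: act_arr_arr Pi_iff\<close>)
  finally show ?thesis .
qed

text \<open>From M = H + MJ follows MJ = HJ + MJ^2 = HJ, which is contained in H.\<close>

lemma nakayama:
  assumes H: "submodule H R M" and "H <+>\<^bsub>M\<^esub> rad M = carrier M"
  shows "H = carrier M"
proof -
  note HM = submodule_subset[OF H]
  have arrH: "arr \<alpha> \<odot>\<^bsub>M\<^esub> x \<in> H" if x: "x \<in> carrier M" for \<alpha> x
  proof -
    obtain h r where hr: "h \<in> H" "r \<in> rad M" "x = h \<oplus>\<^bsub>M\<^esub> r"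
      using x unfolding assms(2)[symmetric] by (auto simp: set_add_def')
    have "arr \<alpha> \<odot>\<^bsub>M\<^esub> x = arr \<alpha> \<odot>\<^bsub>M\<^esub> h"
      using hr HM submodule_subset[OF submodule_rad]
      by (simp add: smult_add subsetD arr_kills_rad smult_closed)
    then show ?thesis using submodule_smult[OF H _ hr(1)] by simp
  qed
  have "rad M \<subseteq> H"
    unfolding rad_def
    by (auto intro!: subspace_finsum[OF subspace_if_submodule[OF H] finite_E] arrH)
  then have "H <+>\<^bsub>M\<^esub> rad M \<subseteq> H" using submodule_add[OF H] by (auto simp: set_add_def')
  then show ?thesis using assms(2) HM by auto
qed

lemma zero_if_all_rad: "rad M = carrier M \<Longrightarrow> carrier M = {\<zero>\<^bsub>M\<^esub>}"
  using nakayama[OF submodule_0] subset_sum_right[OF submodule_0 submodule_rad]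
    submodule_subset[OF submodule_sum[OF submodule_0 submodule_rad]] by auto

lemma rad_0_iff: "rad M = {\<zero>\<^bsub>M\<^esub>} \<longleftrightarrow> (\<forall>\<alpha>\<in>E. \<forall>x\<in>carrier M. arr \<alpha> \<odot>\<^bsub>M\<^esub> x = \<zero>\<^bsub>M\<^esub>)"
proof
  assume "rad M = {\<zero>\<^bsub>M\<^esub>}"
  then show "\<forall>\<alpha>\<in>E. \<forall>x\<in>carrier M. arr \<alpha> \<odot>\<^bsub>M\<^esub> x = \<zero>\<^bsub>M\<^esub>" using arr_act_rad by auto
next
  assume k: "\<forall>\<alpha>\<in>E. \<forall>x\<in>carrier M. arr \<alpha> \<odot>\<^bsub>M\<^esub> x = \<zero>\<^bsub>M\<^esub>"
  have "rad M \<subseteq> {\<zero>\<^bsub>M\<^esub>}"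
  proof
    fix x assume "x \<in> rad M"
    then obtain u where u: "u \<in> E \<rightarrow> carrier M" "x = finsum M (\<lambda>\<alpha>. arr \<alpha> \<odot>\<^bsub>M\<^esub> u \<alpha>) E"
      by (auto simp: rad_def)
    then show "x \<in> {\<zero>\<^bsub>M\<^esub>}" using k by (simp add: M.add.finprod_one_eqI Pi_iff)
  qed
  then show "rad M = {\<zero>\<^bsub>M\<^esub>}" using submodule_zero[OF submodule_rad] by auto
qed

lemma subspace_Int: "subspace M H \<Longrightarrow> subspace M H' \<Longrightarrow> subspace M (H \<inter> H')"
  using K.submodule_Inter[of "{H, H'}"] by auto

lemma subspace_radc: "subspace M (radc M i)"
  unfolding radc_def by (rule subspace_Int[OF subspace_if_submodule[OF submodule_rad] subspace_comp])

lemma kdim_mono: "subspace M H \<Longrightarrow> subspace M H' \<Longrightarrow> H \<subseteq> H' \<Longrightarrow> kdim M H \<le> kdim M H'"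
  unfolding kdim_def by (rule K.mod_length_mono)

lemma kdim_finite:
  assumes "fin_dim M" and "subspace M H"
  shows "kdim M H \<noteq> \<infinity>"
proof -
  have "kdim M H \<le> kdim M (carrier M)"
    using kdim_mono[OF assms(2), of "carrier M"] K.submodule_carrier submodule_subset[OF assms(2)] by simp
  then show ?thesis using assms(1) by (metis enat_ord_simps(5) fin_dim_def)
qed

lemma dm_mono:
  "fin_dim M \<Longrightarrow> subspace M H \<Longrightarrow> subspace M H' \<Longrightarrow> H \<subseteq> H' \<Longrightarrow> dm M H \<le> dm M H'"
  using kdim_mono[of H H'] kdim_finite[of H] kdim_finite[of H']
  by (cases "kdim M H"; cases "kdim M H'") (auto simp: dm_def)

lemma dm_strict_mono:
  assumes "fin_dim M" "subspace M H" "subspace M H'" "H \<subset> H'"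
  shows "dm M H < dm M H'"
proof -
  have "kdim M H < kdim M H'"
    using K.mod_length_strict_mono[OF assms(2-4)] kdim_finite[OF assms(1,3)] by (simp add: kdim_def)
  then show ?thesis
    using kdim_finite[OF assms(1,2)] kdim_finite[OF assms(1,3)]
    by (cases "kdim M H"; cases "kdim M H'") (auto simp: dm_def)
qed

lemma kdim_0_iff: "subspace M H \<Longrightarrow> kdim M H = 0 \<longleftrightarrow> H = {\<zero>\<^bsub>M\<^esub>}"
  using right_module.mod_length_eq_0_iff[OF K.right_module_submodule] by (simp add: kdim_def)

lemma dm_0_iff: "fin_dim M \<Longrightarrow> subspace M H \<Longrightarrow> dm M H = 0 \<longleftrightarrow> H = {\<zero>\<^bsub>M\<^esub>}"
  using kdim_0_iff[of H] kdim_finite[of H] by (cases "kdim M H") (auto simp: dm_def zero_enat_def)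

lemma dm_nonneg: "dm M H \<ge> 0" by (simp add: dm_def)

end

section \<open>Dimensions and graded pieces along homomorphisms\<close>

context rad_sq_zero
begin

lemma rsz_moduleI: "right_module R M \<Longrightarrow> rsz_module R V E src trg vc ac M"
  by (simp add: rsz_module_def rad_sq_zero_axioms)

lemma ks_sub [simp]: "ks (M\<lparr>carrier := H\<rparr>) = (ks M)\<lparr>carrier := H\<rparr>"
  by (simp add: ks_def)

lemma kdim_sub [simp]: "kdim (M\<lparr>carrier := H\<rparr>) H' = kdim M H'"
  and dm_sub [simp]: "dm (M\<lparr>carrier := H\<rparr>) H' = dm M H'"
  by (simp_all add: kdim_def dm_def)

lemma comp_sub: "H \<subseteq> carrier M \<Longrightarrow> comp (M\<lparr>carrier := H\<rparr>) i = H \<inter> comp M i"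
  by (auto simp: comp_def)

lemma kdim_map:
  assumes "right_module R M" and "right_module R N" and "subspace M H"
    and "f \<in> mod_hom kring ((ks M)\<lparr>carrier := H\<rparr>) (ks N)"
  shows "kdim M H = kdim M {x \<in> H. f x = \<zero>\<^bsub>N\<^esub>} + kdim N (f ` H)"
  using mod_length_map[OF right_module_ks[OF assms(1)] right_module_ks[OF assms(2)] assms(3,4)]
  by (simp add: kdim_def)

lemma kdim_hom:
  assumes "right_module R M" and "right_module R N" and "subspace M H" and f: "f \<in> mod_hom R M N"
  shows "kdim M H = kdim M {x \<in> H. f x = \<zero>\<^bsub>N\<^esub>} + kdim N (f ` H)"
proof (rule kdim_map[OF assms(1-3)])
  have "H \<subseteq> carrier M" using submodule_subset[OF assms(3)] by simp
  then show "f \<in> mod_hom kring ((ks M)\<lparr>carrier := H\<rparr>) (ks N)"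
    using mod_hom_closed[OF f] mod_hom_add[OF f] mod_hom_smult[OF f]
    by (intro mod_homI) (auto simp: subsetD)
qed

lemma dm_hom:
  assumes "right_module R M" and "right_module R N" and "fin_dim M" and "subspace M H"
    and f: "f \<in> mod_hom R M N"
  shows "dm M H = dm M {x \<in> H. f x = \<zero>\<^bsub>N\<^esub>} + dm N (f ` H)"
proof -
  interpret rsz_module R V E src trg vc ac M by (rule rsz_moduleI[OF assms(1)])
  show ?thesis
    using kdim_hom[OF assms(1,2,4) f] kdim_finite[OF assms(3,4)]
    by (cases "kdim M {x \<in> H. f x = \<zero>\<^bsub>N\<^esub>}"; cases "kdim N (f ` H)") (auto simp: dm_def)
qed

text \<open>Dimension counts by coordinate functionals on a subspace. The common kernel is kept as a
  separate term, because in the count of tops it is the radical part rather than 0.\<close>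

lemma kdim_coord:
  fixes f :: "'m \<Rightarrow> 's \<Rightarrow> 'k"
  assumes "right_module R M" and "subspace M H" and "finite S"
    and "\<And>x y. x \<in> H \<Longrightarrow> y \<in> H \<Longrightarrow> f (x \<oplus>\<^bsub>M\<^esub> y) = (\<lambda>s. f x s + f y s)"
    and "\<And>c x. x \<in> H \<Longrightarrow> f (sc c \<odot>\<^bsub>M\<^esub> x) = (\<lambda>s. c * f x s)"
    and "\<And>x s. x \<in> H \<Longrightarrow> s \<notin> S \<Longrightarrow> f x s = 0"
  shows "kdim M H \<le> kdim M {x \<in> H. \<forall>s. f x s = 0} + enat (card S)"
    and "(\<And>g. (\<And>s. s \<notin> S \<Longrightarrow> g s = 0) \<Longrightarrow> \<exists>x\<in>H. f x = g) \<Longrightarrow>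
      kdim M H = kdim M {x \<in> H. \<forall>s. f x s = 0} + enat (card S)"
proof -
  let ?F = "fun_space S :: ('k, 's \<Rightarrow> 'k) module"
  note rm = right_module_ks[OF assms(1)] right_module_fun_space
  interpret F: right_module kring ?F by (rule right_module_fun_space)
  interpret K: right_module kring "ks M" by (rule rm)
  interpret H: right_module kring "(ks M)\<lparr>carrier := H\<rparr>" by (rule K.right_module_submodule[OF assms(2)])
  have f: "f \<in> mod_hom kring ((ks M)\<lparr>carrier := H\<rparr>) ?F"
    by (rule mod_homI) (use assms in \<open>auto simp: fun_space_def\<close>)
  interpret h: right_module_hom kring "(ks M)\<lparr>carrier := H\<rparr>" ?F f
    by unfold_locales (rule f)
  have k: "{x \<in> H. f x = \<zero>\<^bsub>?F\<^esub>} = {x \<in> H. \<forall>s. f x s = 0}" by (auto simp: fun_space_def fun_eq_iff)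
  have eq: "kdim M H = kdim M {x \<in> H. \<forall>s. f x s = 0} + mod_length kring (?F\<lparr>carrier := f ` H\<rparr>)"
    using mod_length_map[OF rm assms(2) f] by (simp only: k kdim_def)
  have im: "submodule (f ` H) kring ?F" using h.submodule_image[OF H.submodule_carrier] by simp
  have F: "?F\<lparr>carrier := carrier ?F\<rparr> = ?F" by simp
  have "mod_length kring (?F\<lparr>carrier := f ` H\<rparr>) \<le> enat (card S)"
    using F.mod_length_mono[OF im F.submodule_carrier submodule_subset[OF im]]
    by (simp only: F mod_length_fun_space[OF assms(3)])
  then show "kdim M H \<le> kdim M {x \<in> H. \<forall>s. f x s = 0} + enat (card S)"
    unfolding eq by (rule add_left_mono)
  show "kdim M H = kdim M {x \<in> H. \<forall>s. f x s = 0} + enat (card S)"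
    if s: "\<And>g. (\<And>s. s \<notin> S \<Longrightarrow> g s = 0) \<Longrightarrow> \<exists>x\<in>H. f x = g"
  proof -
    have "carrier ?F \<subseteq> f ` H"
    proof
      fix g assume "g \<in> carrier ?F"
      then have "\<exists>x\<in>H. f x = g" by (intro s) (simp add: fun_space_def)
      then show "g \<in> f ` H" by blast
    qed
    then have "f ` H = carrier ?F" using submodule_subset[OF im] by (rule subset_antisym[rotated])
    then show ?thesis using eq by (simp only: F mod_length_fun_space[OF assms(3)])
  qed
qed

lemma fin_dim_image:
  assumes "right_module R M" and "right_module R N" and "f \<in> mod_hom R M N"
    and "f ` carrier M = carrier N" and "fin_dim M"
  shows "fin_dim N"
proof -
  interpret rsz_module R V E src trg vc ac M by (rule rsz_moduleI[OF assms(1)])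
  show ?thesis
    using kdim_hom[OF assms(1,2) subspace_if_submodule[OF submodule_carrier] assms(3)] assms(4,5)
    by (cases "kdim N (carrier N)") (auto simp: fin_dim_def)
qed

lemma fin_dim_submodule:
  assumes "right_module R M" and "fin_dim M" and "submodule H R M"
  shows "fin_dim (M\<lparr>carrier := H\<rparr>)"
proof -
  interpret rsz_module R V E src trg vc ac M by (rule rsz_moduleI[OF assms(1)])
  show ?thesis
    using kdim_finite[OF assms(2) subspace_if_submodule[OF assms(3)]] by (simp add: fin_dim_def)
qed

text \<open>A finite set generating a submodule of maximal dimension generates the whole module.\<close>

lemma fin_gen_if_fin_dim:
  assumes "right_module R M" and "fin_dim M"
  shows "fin_gen R M"
proof -
  interpret rsz_module R V E src trg vc ac M by (rule rsz_moduleI[OF assms(1)])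
  define gen where "gen S = \<Inter>{H. submodule H R M \<and> S \<subseteq> H}" for S
  have gen: "submodule (gen S) R M" "S \<subseteq> gen S" if "S \<subseteq> carrier M" for S
    unfolding gen_def using that submodule_carrier by (auto intro!: submodule_Inter)
  let ?P = "\<lambda>S. finite S \<and> S \<subseteq> carrier M"
  have bound: "nat (dm M (gen S)) < Suc (nat (dm M (carrier M)))" if "?P S" for S
    using that gen dm_mono[OF assms(2), of "gen S" "carrier M"] submodule_subset[of "gen S" R M]
    by (simp add: less_Suc_eq_le nat_mono subspace_if_submodule submodule_carrier)
  obtain S where S: "?P S" "\<And>T. ?P T \<Longrightarrow> nat (dm M (gen T)) \<le> nat (dm M (gen S))"
    using ex_has_greatest_nat[of ?P "{}" "\<lambda>S. nat (dm M (gen S))"] bound by (metis empty_subsetI finite.emptyI)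
  have "carrier M \<subseteq> gen S"
  proof
    fix x assume x: "x \<in> carrier M"
    show "x \<in> gen S"
    proof (rule ccontr)
      assume n: "x \<notin> gen S"
      have P: "?P (insert x S)" using x S(1) by simp
      have "x \<in> gen (insert x S)" using gen(2)[of "insert x S"] P by auto
      moreover have "gen S \<subseteq> gen (insert x S)" unfolding gen_def by auto
      ultimately have "gen S \<subset> gen (insert x S)" using n by auto
      then have "dm M (gen S) < dm M (gen (insert x S))"
        using gen(1) P S(1) by (intro dm_strict_mono assms subspace_if_submodule) auto
      then show False using S(2)[OF P] dm_nonneg[of "gen S"] by simp
    qed
  qed
  then show ?thesis unfolding fin_gen_def using S(1) submodule_subset[of _ R M]
    by (intro exI[of _ S]) (auto simp: gen_def)
qed

lemma hom_comp_subset: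
  "right_module R M \<Longrightarrow> f \<in> mod_hom R M N \<Longrightarrow> x \<in> comp M i \<Longrightarrow> f x \<in> comp N i"
  using mod_hom_smult[of f R M N "idem i" x] mod_hom_closed[of f R M N x] by (auto simp: comp_def)

text \<open>A preimage of an element of N e_i stays a preimage after multiplication by e_i, so a
  surjection is surjective on each component.\<close>

lemma hom_comp_image:
  assumes "right_module R M" and "f \<in> mod_hom R M N" and "f ` carrier M = carrier N"
  shows "f ` comp M i = comp N i"
proof
  show "f ` comp M i \<subseteq> comp N i" using hom_comp_subset[OF assms(1,2)] by auto
  interpret rsz_module R V E src trg vc ac M by (rule rsz_moduleI[OF assms(1)])
  show "comp N i \<subseteq> f ` comp M i"
  proof
    fix y assume y: "y \<in> comp N i"
    then have "y \<in> f ` carrier M" using assms(3) by (simp add: comp_def)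
    then obtain x where x: "x \<in> carrier M" "y = f x" by blast
    then have "f (idem i \<odot>\<^bsub>M\<^esub> x) = y" using y mod_hom_smult[OF assms(2)] by (simp add: comp_def)
    then show "y \<in> f ` comp M i" using idem_act_comp[OF x(1)] by blast
  qed
qed

lemma hom_rad_subset:
  assumes "right_module R M" and "right_module R N" and "f \<in> mod_hom R M N" and "x \<in> rad M"
  shows "f x \<in> rad N"
proof -
  interpret M: rsz_module R V E src trg vc ac M by (rule rsz_moduleI[OF assms(1)])
  interpret N: rsz_module R V E src trg vc ac N by (rule rsz_moduleI[OF assms(2)])
  interpret right_module_hom R M N f by unfold_locales (rule assms)
  obtain y where y: "y \<in> E \<rightarrow> carrier M" "x = finsum M (\<lambda>\<alpha>. arr \<alpha> \<odot>\<^bsub>M\<^esub> y \<alpha>) E"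
    using assms(4) by (auto simp: rad_def)
  have "f x = finsum N (\<lambda>\<alpha>. f (arr \<alpha> \<odot>\<^bsub>M\<^esub> y \<alpha>)) E"
    unfolding y(2) by (rule finsum[OF finite_E]) (use y in \<open>auto simp: M.smult_closed Pi_iff\<close>)
  also have "\<dots> = finsum N (\<lambda>\<alpha>. arr \<alpha> \<odot>\<^bsub>N\<^esub> f (y \<alpha>)) E"
    by (rule N.M.finsum_cong') (use y in \<open>auto simp: smult N.smult_closed closed Pi_iff\<close>)
  finally show ?thesis using N.radI[of "\<lambda>\<alpha>. f (y \<alpha>)"] y closed by (simp add: Pi_iff)
qed

lemma hom_rad_image:
  assumes "right_module R M" and "right_module R N" and "f \<in> mod_hom R M N"
    and "f ` carrier M = carrier N"
  shows "f ` rad M = rad N"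
proof
  show "f ` rad M \<subseteq> rad N" using hom_rad_subset[OF assms(1-3)] by auto
  interpret M: rsz_module R V E src trg vc ac M by (rule rsz_moduleI[OF assms(1)])
  interpret N: rsz_module R V E src trg vc ac N by (rule rsz_moduleI[OF assms(2)])
  interpret right_module_hom R M N f by unfold_locales (rule assms)
  show "rad N \<subseteq> f ` rad M"
  proof
    fix x assume "x \<in> rad N"
    then obtain y where y: "y \<in> E \<rightarrow> carrier N" "x = finsum N (\<lambda>\<alpha>. arr \<alpha> \<odot>\<^bsub>N\<^esub> y \<alpha>) E"
      by (auto simp: rad_def)
    have "\<exists>z. z \<in> carrier M \<and> f z = y \<alpha>" if "\<alpha> \<in> E" for \<alpha>
    proof -
      have "y \<alpha> \<in> f ` carrier M" using assms(4) y(1) that by (simp add: Pi_iff)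
      then obtain z where "y \<alpha> = f z" "z \<in> carrier M" by (rule imageE)
      then show ?thesis by (intro exI[of _ z]) simp
    qed
    then obtain z where z: "\<And>\<alpha>. \<alpha> \<in> E \<Longrightarrow> z \<alpha> \<in> carrier M \<and> f (z \<alpha>) = y \<alpha>" by metis
    have "f (finsum M (\<lambda>\<alpha>. arr \<alpha> \<odot>\<^bsub>M\<^esub> z \<alpha>) E) = finsum N (\<lambda>\<alpha>. f (arr \<alpha> \<odot>\<^bsub>M\<^esub> z \<alpha>)) E"
      by (rule finsum[OF finite_E]) (use z in \<open>auto simp: M.smult_closed\<close>)
    also have "\<dots> = x"
      unfolding y(2) by (rule N.M.finsum_cong') (use z y in \<open>auto simp: smult N.smult_closed Pi_iff\<close>)
    finally show "x \<in> f ` rad M" using M.radI[of z] z by blast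
  qed
qed

lemma hom_radc_image:
  assumes "right_module R M" and "right_module R N" and "f \<in> mod_hom R M N"
    and "f ` carrier M = carrier N"
  shows "f ` radc M i = radc N i"
proof
  interpret M: rsz_module R V E src trg vc ac M by (rule rsz_moduleI[OF assms(1)])
  show "f ` radc M i \<subseteq> radc N i"
    using hom_comp_subset[OF assms(1,3)] hom_rad_subset[OF assms(1-3)] by (auto simp: radc_def)
  show "radc N i \<subseteq> f ` radc M i"
  proof
    fix y assume y: "y \<in> radc N i"
    then have "y \<in> f ` rad M" unfolding hom_rad_image[OF assms] by (simp add: radc_def)
    then obtain x where x: "x \<in> rad M" "y = f x" by blast
    have xM: "x \<in> carrier M" using x(1) submodule_subset[OF M.submodule_rad] by blast
    have "f (idem i \<odot>\<^bsub>M\<^esub> x) = y"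
      using x(2) xM y mod_hom_smult[OF assms(3)] by (simp add: radc_def comp_def)
    moreover have "idem i \<odot>\<^bsub>M\<^esub> x \<in> radc M i"
      using M.idem_act_comp[OF xM] submodule_smult[OF M.submodule_rad _ x(1)] by (simp add: radc_def)
    ultimately show "y \<in> f ` radc M i" by blast
  qed
qed

text \<open>The dimension of (M/MJ) e_i, which is the number of summands e_i R in a projective cover
  of \<open>M\<close>.\<close>

definition tp :: "('r, 'm) module \<Rightarrow> 'v \<Rightarrow> int" where
  "tp M i = dm M (comp M i) - dm M (radc M i)"

text \<open>The multiplicity of \<open>S\<^sub>j\<close> in the syzygy of \<open>M\<close>, and the multiplicity of \<open>S\<^sub>j\<close> as a direct
  summand of \<open>M\<close>.\<close>

definition om :: "('r, 'm) module \<Rightarrow> 'v \<Rightarrow> int" where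
  "om M j = (\<Sum>\<alpha>\<in>{\<alpha>\<in>E. trg \<alpha> = j}. tp M (src \<alpha>)) - dm M (radc M j)"

definition mu :: "('r, 'm) module \<Rightarrow> 'v \<Rightarrow> int" where
  "mu M j = dm M (socc M j) - dm M (radc M j)"

lemma dm_iso:
  assumes "right_module R M" and "right_module R N" and "fin_dim M" and "subspace M H"
    and f: "f \<in> mod_hom R M N" and inj: "inj_on f (carrier M)"
  shows "dm N (f ` H) = dm M H"
proof -
  interpret rsz_module R V E src trg vc ac M by (rule rsz_moduleI[OF assms(1)])
  interpret right_module_hom R M N f
    using assms(2) f by (simp add: right_module_hom_def right_module_hom_axioms_def right_module_axioms)
  have "H \<subseteq> carrier M" using submodule_subset[OF assms(4)] by simp
  then have "{x \<in> H. f x = \<zero>\<^bsub>N\<^esub>} = {\<zero>\<^bsub>M\<^esub>}"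
    using inj inj_on_iff_kernel submodule_zero[OF assms(4)] zero by (auto simp: mod_kernel_def)
  then show ?thesis
    using dm_hom[OF assms(1-5)] dm_0_iff[OF assms(3), of "{\<zero>\<^bsub>M\<^esub>}"] K.submodule_0 by simp
qed

lemma iso_invariants:
  assumes "right_module R M" and "right_module R N" and "fin_dim M" and "mod_iso R M N"
  shows "dm N (comp N i) = dm M (comp M i)" and "dm N (radc N i) = dm M (radc M i)"
    and "dm N (socc N i) = dm M (socc M i)" and "fin_dim N"
proof -
  interpret M: rsz_module R V E src trg vc ac M by (rule rsz_moduleI[OF assms(1)])
  obtain f where f: "f \<in> mod_hom R M N" and b: "bij_betw f (carrier M) (carrier N)"
    using assms(4) by (auto simp: mod_iso_def)
  then have inj: "inj_on f (carrier M)" and surj: "f ` carrier M = carrier N" by (auto simp: bij_betw_def)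
  interpret right_module_hom R M N f
    using assms(2) f by (simp add: right_module_hom_def right_module_hom_axioms_def M.right_module_axioms)
  note d = dm_iso[OF assms(1-3) _ f inj]
  show "dm N (comp N i) = dm M (comp M i)"
    using d[OF M.subspace_comp] hom_comp_image[OF assms(1) f surj] by simp
  show "dm N (radc N i) = dm M (radc M i)"
    using d[OF M.subspace_radc] hom_radc_image[OF assms(1,2) f surj] by simp
  have "f ` socc M i = socc N i"
  proof
    show "f ` socc M i \<subseteq> socc N i"
    proof
      fix y assume "y \<in> f ` socc M i"
      then obtain x where x: "x \<in> socc M i" "y = f x" by blast
      then have "x \<in> carrier M" by (simp add: socc_def comp_def)
      moreover have "f x \<in> comp N i" using x(1) hom_comp_subset[OF assms(1) f] by (simp add: socc_def)
      ultimately show "y \<in> socc N i" using x smult[of "arr \<alpha>" x for \<alpha>] zero by (auto simp: socc_def smult[symmetric])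
    qed
    show "socc N i \<subseteq> f ` socc M i"
    proof
      fix y assume y: "y \<in> socc N i"
      then have "y \<in> f ` comp M i" using hom_comp_image[OF assms(1) f surj] by (simp add: socc_def)
      then obtain x where x: "x \<in> comp M i" "y = f x" by blast
      have xM: "x \<in> carrier M" using x(1) by (simp add: comp_def)
      have "arr \<alpha> \<odot>\<^bsub>M\<^esub> x = \<zero>\<^bsub>M\<^esub>" if "\<alpha> \<in> E" for \<alpha>
        using y x(2) that smult[of "arr \<alpha>" x] xM zero inj M.smult_closed[of "arr \<alpha>" x]
        by (auto simp: socc_def dest!: inj_onD[of f "carrier M" "arr \<alpha> \<odot>\<^bsub>M\<^esub> x" "\<zero>\<^bsub>M\<^esub>"])
      then show "y \<in> f ` socc M i" using x by (auto simp: socc_def)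
    qed
  qed
  then show "dm N (socc N i) = dm M (socc M i)" using d[OF M.subspace_socc, of i] by simp
  show "fin_dim N" by (rule fin_dim_image[OF assms(1,2) f surj assms(3)])
qed

lemma iso_om:
  assumes "right_module R M" and "right_module R N" and "fin_dim M" and "mod_iso R M N"
  shows "om N j = om M j" and "mu N j = mu M j"
  by (simp_all add: om_def mu_def tp_def iso_invariants[OF assms])

subsection \<open>Direct sums\<close>

lemma fst_hom: "fst \<in> mod_hom R (direct_sum2 M N) M" and snd_hom: "snd \<in> mod_hom R (direct_sum2 M N) N"
  by (auto simp: mod_hom_def direct_sum2_def)

lemma inl_hom: "right_module R N \<Longrightarrow> (\<lambda>x. (x, \<zero>\<^bsub>N\<^esub>)) \<in> mod_hom R M (direct_sum2 M N)"
proof -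
  assume "right_module R N"
  then interpret right_module R N .
  show ?thesis by (auto simp: mod_hom_def direct_sum2_def)
qed

lemma inr_hom: "right_module R M \<Longrightarrow> (\<lambda>x. (\<zero>\<^bsub>M\<^esub>, x)) \<in> mod_hom R N (direct_sum2 M N)"
proof -
  assume "right_module R M"
  then interpret right_module R M .
  show ?thesis by (auto simp: mod_hom_def direct_sum2_def)
qed

context
  fixes M :: "('r, 'm) module" and N :: "('r, 'n) module"
  assumes rM: "right_module R M" and rN: "right_module R N"
begin

lemma ds_simps:
  "carrier (direct_sum2 M N) = carrier M \<times> carrier N" "\<zero>\<^bsub>direct_sum2 M N\<^esub> = (\<zero>\<^bsub>M\<^esub>, \<zero>\<^bsub>N\<^esub>)"
  "(x, y) \<oplus>\<^bsub>direct_sum2 M N\<^esub> (x', y') = (x \<oplus>\<^bsub>M\<^esub> x', y \<oplus>\<^bsub>N\<^esub> y')"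
  "a \<odot>\<^bsub>direct_sum2 M N\<^esub> (x, y) = (a \<odot>\<^bsub>M\<^esub> x, a \<odot>\<^bsub>N\<^esub> y)"
  by (simp_all add: direct_sum2_def)

lemma comp_ds: "comp (direct_sum2 M N) i = comp M i \<times> comp N i"
  by (auto simp: comp_def ds_simps)

lemma socc_ds: "socc (direct_sum2 M N) i = socc M i \<times> socc N i"
  by (auto simp: socc_def comp_ds ds_simps)

lemma rad_ds: "rad (direct_sum2 M N) = rad M \<times> rad N"
proof
  interpret M: rsz_module R V E src trg vc ac M by (rule rsz_moduleI[OF rM])
  interpret N: rsz_module R V E src trg vc ac N by (rule rsz_moduleI[OF rN])
  note rD = right_module_direct_sum2[OF rM rN]
  interpret D: rsz_module R V E src trg vc ac "direct_sum2 M N" by (rule rsz_moduleI[OF rD])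
  show "rad (direct_sum2 M N) \<subseteq> rad M \<times> rad N"
    using hom_rad_subset[OF rD rM fst_hom] hom_rad_subset[OF rD rN snd_hom] by auto
  show "rad M \<times> rad N \<subseteq> rad (direct_sum2 M N)"
  proof (rule subrelI)
    fix x y assume "(x, y) \<in> rad M \<times> rad N"
    then have xy: "x \<in> rad M" "y \<in> rad N" by auto
    then have c: "x \<in> carrier M" "y \<in> carrier N"
      using submodule_subset[OF M.submodule_rad] submodule_subset[OF N.submodule_rad] by auto
    have "(x, \<zero>\<^bsub>N\<^esub>) \<oplus>\<^bsub>direct_sum2 M N\<^esub> (\<zero>\<^bsub>M\<^esub>, y) \<in> rad (direct_sum2 M N)"
      by (rule submodule_add[OF D.submodule_rad hom_rad_subset[OF rM rD inl_hom[OF rN] xy(1)]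
          hom_rad_subset[OF rN rD inr_hom[OF rM] xy(2)]])
    then show "(x, y) \<in> rad (direct_sum2 M N)" using c by (simp add: ds_simps)
  qed
qed

lemma radc_ds: "radc (direct_sum2 M N) i = radc M i \<times> radc N i"
  by (auto simp: radc_def rad_ds comp_ds)

lemma kdim_ds:
  assumes "subspace M H" and "subspace N H'"
  shows "kdim (direct_sum2 M N) (H \<times> H') = kdim M H + kdim N H'"
proof -
  interpret M: rsz_module R V E src trg vc ac M by (rule rsz_moduleI[OF rM])
  interpret N: rsz_module R V E src trg vc ac N by (rule rsz_moduleI[OF rN])
  note rD = right_module_direct_sum2[OF rM rN]
  interpret D: rsz_module R V E src trg vc ac "direct_sum2 M N" by (rule rsz_moduleI[OF rD])
  note HM = submodule_subset[OF assms(1), simplified] submodule_subset[OF assms(2), simplified]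
  note z = submodule_zero[OF assms(1), simplified] submodule_zero[OF assms(2), simplified]
  have sub: "subspace (direct_sum2 M N) (A \<times> B)" if "subspace M A" "subspace N B" for A B
    using submodule_subset[OF that(1)] submodule_subset[OF that(2)] submodule_zero[OF that(1)]
      submodule_zero[OF that(2)] submodule_add[OF that(1)] submodule_add[OF that(2)]
      submodule_smult[OF that(1)] submodule_smult[OF that(2)]
    by (intro D.subspaceI) (auto simp: ds_simps)
  have 1: "kdim (direct_sum2 M N) (H \<times> H') = kdim (direct_sum2 M N) (H \<times> {\<zero>\<^bsub>N\<^esub>}) + kdim N H'"
  proof -
    have "{w \<in> H \<times> H'. snd w = \<zero>\<^bsub>N\<^esub>} = H \<times> {\<zero>\<^bsub>N\<^esub>}" "snd ` (H \<times> H') = H'" using z by force+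
    then show ?thesis using kdim_hom[OF rD rN sub[OF assms] snd_hom] by simp
  qed
  have 2: "kdim (direct_sum2 M N) (H \<times> {\<zero>\<^bsub>N\<^esub>}) = kdim M H"
  proof -
    have "{w \<in> H \<times> {\<zero>\<^bsub>N\<^esub>}. fst w = \<zero>\<^bsub>M\<^esub>} = {\<zero>\<^bsub>direct_sum2 M N\<^esub>}" "fst ` (H \<times> {\<zero>\<^bsub>N\<^esub>}) = H"
      using z by (force simp: ds_simps)+
    moreover have "kdim (direct_sum2 M N) {\<zero>\<^bsub>direct_sum2 M N\<^esub>} = 0"
      using D.kdim_0_iff[of "{\<zero>\<^bsub>direct_sum2 M N\<^esub>}"] D.K.submodule_0 by simp
    ultimately show ?thesis
      using kdim_hom[OF rD rM sub[OF assms(1) N.K.submodule_0[simplified]] fst_hom] by simp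
  qed
  show ?thesis by (simp add: 1 2)
qed

lemma dm_ds:
  assumes "fin_dim M" and "fin_dim N" and "subspace M H" and "subspace N H'"
  shows "dm (direct_sum2 M N) (H \<times> H') = dm M H + dm N H'"
proof -
  interpret M: rsz_module R V E src trg vc ac M by (rule rsz_moduleI[OF rM])
  interpret N: rsz_module R V E src trg vc ac N by (rule rsz_moduleI[OF rN])
  show ?thesis
    using kdim_ds[OF assms(3,4)] M.kdim_finite[OF assms(1,3)] N.kdim_finite[OF assms(2,4)]
    by (cases "kdim M H"; cases "kdim N H'") (auto simp: dm_def)
qed

lemma om_ds:
  assumes "fin_dim M" and "fin_dim N"
  shows "om (direct_sum2 M N) j = om M j + om N j" and "mu (direct_sum2 M N) j = mu M j + mu N j"
    and "dm (direct_sum2 M N) (comp (direct_sum2 M N) j) = dm M (comp M j) + dm N (comp N j)"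
proof -
  interpret M: rsz_module R V E src trg vc ac M by (rule rsz_moduleI[OF rM])
  interpret N: rsz_module R V E src trg vc ac N by (rule rsz_moduleI[OF rN])
  note d = dm_ds[OF assms]
  show "dm (direct_sum2 M N) (comp (direct_sum2 M N) j) = dm M (comp M j) + dm N (comp N j)"
    by (simp add: comp_ds d M.subspace_comp N.subspace_comp)
  show "mu (direct_sum2 M N) j = mu M j + mu N j"
    by (simp add: mu_def socc_ds radc_ds d M.subspace_socc N.subspace_socc M.subspace_radc N.subspace_radc)
  show "om (direct_sum2 M N) j = om M j + om N j"
    by (simp add: om_def tp_def comp_ds radc_ds d M.subspace_comp N.subspace_comp M.subspace_radc
        N.subspace_radc sum_subtractf sum.distrib)
qed

end

text \<open>Along a surjection whose kernel lies in the radical, the top does not change.\<close>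

lemma om_cover:
  assumes "right_module R P" and "right_module R M" and "fin_dim P" and f: "f \<in> mod_hom R P M"
    and surj: "f ` carrier P = carrier M" and ker: "mod_kernel P M f \<subseteq> rad P"
  shows "om M j = om P j + dm P (mod_kernel P M f \<inter> comp P j)"
proof -
  interpret P: rsz_module R V E src trg vc ac P by (rule rsz_moduleI[OF assms(1)])
  have 1: "dm P (comp P i) = dm P (mod_kernel P M f \<inter> comp P i) + dm M (comp M i)" for i
  proof -
    have "{x \<in> comp P i. f x = \<zero>\<^bsub>M\<^esub>} = mod_kernel P M f \<inter> comp P i"
      by (auto simp: mod_kernel_def comp_def)
    then show ?thesis
      using dm_hom[OF assms(1-3) P.subspace_comp f] hom_comp_image[OF assms(1) f surj] by simp
  qed
  have 2: "dm P (radc P i) = dm P (mod_kernel P M f \<inter> comp P i) + dm M (radc M i)" for i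
  proof -
    have "{x \<in> radc P i. f x = \<zero>\<^bsub>M\<^esub>} = mod_kernel P M f \<inter> comp P i"
      using ker by (auto simp: mod_kernel_def comp_def radc_def)
    then show ?thesis
      using dm_hom[OF assms(1-3) P.subspace_radc f] hom_radc_image[OF assms(1,2) f surj] by simp
  qed
  \<comment> \<open>The kernel contributes the same dimension to P e_i and to (PJ) e_i, so it
    cancels in \<open>tp\<close> and survives only in the last term of \<open>om\<close>.\<close>
  show ?thesis unfolding om_def tp_def by (simp add: 1 2)
qed

end

section \<open>Projective covers and syzygies\<close>

context rad_sq_zero
begin

text \<open>Tuples whose l-th entry lies in the right ideal e_(w l) R. They are padded by 0 from
  \<open>n\<close> on, so that all lengths share one function type.\<close>

definition pcar :: "nat \<Rightarrow> (nat \<Rightarrow> 'v) \<Rightarrow> (nat \<Rightarrow> 'r) set" where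
  "pcar n w = {x. (\<forall>l<n. x l \<in> carrier R \<and> idem (w l) \<otimes>\<^bsub>R\<^esub> x l = x l) \<and> (\<forall>l\<ge>n. x l = \<zero>\<^bsub>R\<^esub>)}"

text \<open>The projective module \<open>e\<^bsub>w 0\<^esub>R \<oplus> \<dots> \<oplus> e\<^bsub>w (n-1)\<^esub>R\<close>. Its elements are wrapped into
  singletons in order to fit into the carrier type of \<^typ>\<open>'r umodule\<close>.\<close>

definition Pmod :: "nat \<Rightarrow> (nat \<Rightarrow> 'v) \<Rightarrow> 'r umodule" where
  "Pmod n w = \<lparr>carrier = (\<lambda>x. {x}) ` pcar n w, monoid.mult = undefined, one = undefined,
     ring.zero = {\<lambda>_. \<zero>\<^bsub>R\<^esub>},
     ring.add = (\<lambda>u v. {\<lambda>l. the_elem u l \<oplus>\<^bsub>R\<^esub> the_elem v l}),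
     smult = (\<lambda>a u. {\<lambda>l. the_elem u l \<otimes>\<^bsub>R\<^esub> a})\<rparr>"

lemma Pmod_simps [simp]:
  "carrier (Pmod n w) = (\<lambda>x. {x}) ` pcar n w" "\<zero>\<^bsub>Pmod n w\<^esub> = {\<lambda>_. \<zero>\<^bsub>R\<^esub>}"
  "{x} \<oplus>\<^bsub>Pmod n w\<^esub> {y} = {\<lambda>l. x l \<oplus>\<^bsub>R\<^esub> y l}" "a \<odot>\<^bsub>Pmod n w\<^esub> {x} = {\<lambda>l. x l \<otimes>\<^bsub>R\<^esub> a}"
  by (simp_all add: Pmod_def)

lemma pcarD: "x \<in> pcar n w \<Longrightarrow> x l \<in> carrier R"
  by (cases "l < n") (auto simp: pcar_def not_less)

lemma pcar_idem: "x \<in> pcar n w \<Longrightarrow> l < n \<Longrightarrow> idem (w l) \<otimes>\<^bsub>R\<^esub> x l = x l"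
  by (simp add: pcar_def)

lemma pcar_out: "x \<in> pcar n w \<Longrightarrow> n \<le> l \<Longrightarrow> x l = \<zero>\<^bsub>R\<^esub>"
  by (simp add: pcar_def)

lemma pcar_zero: "(\<lambda>_. \<zero>\<^bsub>R\<^esub>) \<in> pcar n w"
  by (simp add: pcar_def)

lemma pcar_add: "x \<in> pcar n w \<Longrightarrow> y \<in> pcar n w \<Longrightarrow> (\<lambda>l. x l \<oplus>\<^bsub>R\<^esub> y l) \<in> pcar n w"
  by (simp add: pcar_def R.r_distr)

lemma pcar_smult: "x \<in> pcar n w \<Longrightarrow> a \<in> carrier R \<Longrightarrow> (\<lambda>l. x l \<otimes>\<^bsub>R\<^esub> a) \<in> pcar n w"
  by (simp add: pcar_def R.m_assoc[symmetric])

lemma right_module_pmod: "right_module R (Pmod n w)"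
proof -
  have "abelian_group (Pmod n w)"
  proof (rule abelian_groupI)
    fix u assume "u \<in> carrier (Pmod n w)"
    then obtain x where x: "u = {x}" "x \<in> pcar n w" by auto
    have "(\<lambda>l. \<ominus>\<^bsub>R\<^esub> x l) \<in> pcar n w" using x(2) by (simp add: pcar_def R.r_minus)
    then show "\<exists>v\<in>carrier (Pmod n w). v \<oplus>\<^bsub>Pmod n w\<^esub> u = \<zero>\<^bsub>Pmod n w\<^esub>"
      using x by (intro bexI[of _ "{\<lambda>l. \<ominus>\<^bsub>R\<^esub> x l}"]) (auto simp: R.l_neg pcarD)
  qed (auto simp: pcar_zero pcar_add pcarD R.a_ac)
  then show ?thesis
    unfolding right_module_def right_module_axioms_def
    by (auto simp: R.ring_axioms pcar_smult pcarD R.r_distr R.l_distr R.m_assoc)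
qed

lemma pmod_finsum:
  assumes "finite I" and "\<And>k. k \<in> I \<Longrightarrow> x k \<in> pcar n w"
  shows "finsum (Pmod n w) (\<lambda>k. {x k}) I = {\<lambda>l. finsum R (\<lambda>k. x k l) I}"
  using assms
proof (induction I rule: finite_induct)
  case (insert k I)
  interpret P: right_module R "Pmod n w" by (rule right_module_pmod)
  have 1: "finsum (Pmod n w) (\<lambda>k. {x k}) (insert k I) = {x k} \<oplus>\<^bsub>Pmod n w\<^esub> finsum (Pmod n w) (\<lambda>k. {x k}) I"
    using insert by (intro P.M.finsum_insert) auto
  have 2: "finsum R (\<lambda>k. x k l) (insert k I) = x k l \<oplus>\<^bsub>R\<^esub> finsum R (\<lambda>k. x k l) I" for l
    using insert by (intro R.finsum_insert) (auto intro: pcarD)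
  show ?case using insert by (simp add: 1 2)
next
  case empty
  interpret P: right_module R "Pmod n w" by (rule right_module_pmod)
  show ?case using P.M.finsum_empty[of "\<lambda>k. {x k}"] by simp
qed

text \<open>Coordinates of the elements of e_i R: only the trivial path and the arrows starting at
  \<open>i\<close> may occur. The counterpart for R e_i is \<open>mult_idem_iff\<close>.\<close>

lemma idem_mult_iff:
  assumes "s \<in> carrier R"
  shows "idem i \<otimes>\<^bsub>R\<^esub> s = s \<longleftrightarrow> (\<forall>j\<in>V. j \<noteq> i \<longrightarrow> vc s j = 0) \<and> (\<forall>\<alpha>\<in>E. src \<alpha> \<noteq> i \<longrightarrow> ac s \<alpha> = 0)"
    (is "?l \<longleftrightarrow> ?r")
proof
  assume l: ?l
  show ?r
  proof (intro conjI ballI impI)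
    show "vc s j = 0" if "j \<in> V" "j \<noteq> i" for j
      using vc_mult[of "idem i" s j] l that assms by simp
    show "ac s \<alpha> = 0" if "\<alpha> \<in> E" "src \<alpha> \<noteq> i" for \<alpha>
      using ac_mult[of "idem i" s \<alpha>] l that assms by (simp add: src_in)
  qed
next
  assume r: ?r
  show ?l by (rule coord_eqI) (use r assms in \<open>auto simp: coords\<close>)
qed

lemma mult_idem_iff:
  assumes "s \<in> carrier R"
  shows "s \<otimes>\<^bsub>R\<^esub> idem i = s \<longleftrightarrow> (\<forall>j\<in>V. j \<noteq> i \<longrightarrow> vc s j = 0) \<and> (\<forall>\<alpha>\<in>E. trg \<alpha> \<noteq> i \<longrightarrow> ac s \<alpha> = 0)"
    (is "?l \<longleftrightarrow> ?r")
proof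
  assume l: ?l
  show ?r
  proof (intro conjI ballI impI)
    show "vc s j = 0" if "j \<in> V" "j \<noteq> i" for j
      using vc_mult[of s "idem i" j] l that assms by simp
    show "ac s \<alpha> = 0" if "\<alpha> \<in> E" "trg \<alpha> \<noteq> i" for \<alpha>
      using ac_mult[of s "idem i" \<alpha>] l that assms by (simp add: src_in trg_in)
  qed
next
  assume r: ?r
  show ?l by (rule coord_eqI) (use r assms in \<open>auto simp: coords\<close>)
qed

lemma pcarI:
  assumes "\<And>l. l < n \<Longrightarrow> x l \<in> carrier R" and "\<And>l. l \<ge> n \<Longrightarrow> x l = \<zero>\<^bsub>R\<^esub>"
    and "\<And>l j. l < n \<Longrightarrow> j \<in> V \<Longrightarrow> j \<noteq> w l \<Longrightarrow> vc (x l) j = 0"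
    and "\<And>l \<alpha>. l < n \<Longrightarrow> \<alpha> \<in> E \<Longrightarrow> src \<alpha> \<noteq> w l \<Longrightarrow> ac (x l) \<alpha> = 0"
  shows "x \<in> pcar n w"
  using assms by (simp add: pcar_def idem_mult_iff)

lemma pcar_coord:
  assumes "x \<in> pcar n w" and "l < n"
  shows "j \<in> V \<Longrightarrow> j \<noteq> w l \<Longrightarrow> vc (x l) j = 0" and "\<alpha> \<in> E \<Longrightarrow> src \<alpha> \<noteq> w l \<Longrightarrow> ac (x l) \<alpha> = 0"
  using pcar_idem[OF assms] pcarD[OF assms(1), of l] by (simp_all add: idem_mult_iff)

definition pgen :: "(nat \<Rightarrow> 'v) \<Rightarrow> nat \<Rightarrow> nat \<Rightarrow> 'r" where
  "pgen w l = (\<lambda>k. if k = l then idem (w l) else \<zero>\<^bsub>R\<^esub>)"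

lemma pgen_in: "l < n \<Longrightarrow> pgen w l \<in> pcar n w"
  by (simp add: pcar_def pgen_def idem_idem)

lemma pmod_expand:
  assumes "x \<in> pcar n w"
  shows "finsum (Pmod n w) (\<lambda>l. x l \<odot>\<^bsub>Pmod n w\<^esub> {pgen w l}) {..<n} = {x}"
proof -
  have "finsum (Pmod n w) (\<lambda>l. {\<lambda>k. pgen w l k \<otimes>\<^bsub>R\<^esub> x l}) {..<n} = {\<lambda>k. finsum R (\<lambda>l. pgen w l k \<otimes>\<^bsub>R\<^esub> x l) {..<n}}"
    by (rule pmod_finsum) (simp_all add: pcar_smult pgen_in pcarD[OF assms])
  also have "(\<lambda>k. finsum R (\<lambda>l. pgen w l k \<otimes>\<^bsub>R\<^esub> x l) {..<n}) = x"
  proof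
    fix k
    have *: "finsum R (\<lambda>l. pgen w l k \<otimes>\<^bsub>R\<^esub> x l) {..<n} = finsum R (\<lambda>l. if k = l then x l else \<zero>\<^bsub>R\<^esub>) {..<n}"
      by (rule R.finsum_cong') (auto simp: pgen_def pcar_idem[OF assms] pcarD[OF assms])
    show "finsum R (\<lambda>l. pgen w l k \<otimes>\<^bsub>R\<^esub> x l) {..<n} = x k"
    proof (cases "k < n")
      case True
      then show ?thesis unfolding *
        by (intro R.add.finprod_singleton) (auto simp: pcarD[OF assms])
    next
      case False
      have "finsum R (\<lambda>l. if k = l then x l else \<zero>\<^bsub>R\<^esub>) {..<n} = \<zero>\<^bsub>R\<^esub>"
        by (rule R.add.finprod_one_eqI) (use False in auto)
      then show ?thesis using False pcar_out[OF assms] * by simp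
    qed
  qed
  finally show ?thesis by simp
qed

text \<open>The map sending a tuple \<open>x\<close> to the sum of the y_l x_l. It is a homomorphism
  for arbitrary \<open>y\<close> in \<open>M\<close>, but it takes the l-th generator, an
  idempotent, to \<open>y l\<close> only if \<open>y l\<close> lies in M e_(w l).\<close>

definition lift :: "('r, 'm) module \<Rightarrow> nat \<Rightarrow> (nat \<Rightarrow> 'm) \<Rightarrow> (nat \<Rightarrow> 'r) set \<Rightarrow> 'm" where
  "lift M n y u = finsum M (\<lambda>l. the_elem u l \<odot>\<^bsub>M\<^esub> y l) {..<n}"

lemma lift_hom:
  assumes "right_module R M" and "\<And>l. l < n \<Longrightarrow> y l \<in> carrier M"
  shows "lift M n y \<in> mod_hom R (Pmod n w) M"
proof -
  interpret right_module R M by fact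
  have cl: "(\<lambda>l. x l \<odot>\<^bsub>M\<^esub> y l) \<in> {..<n} \<rightarrow> carrier M" if "x \<in> pcar n w" for x
    using assms(2) pcarD[OF that] by (simp add: smult_closed)
  show ?thesis
  proof (rule mod_homI)
    fix u assume "u \<in> carrier (Pmod n w)"
    then obtain x where x: "u = {x}" "x \<in> pcar n w" by auto
    then show "lift M n y u \<in> carrier M" using cl by (simp add: lift_def M.finsum_closed)
    fix v assume "v \<in> carrier (Pmod n w)"
    then obtain z where z: "v = {z}" "z \<in> pcar n w" by auto
    have "finsum M (\<lambda>l. (x l \<oplus>\<^bsub>R\<^esub> z l) \<odot>\<^bsub>M\<^esub> y l) {..<n} = finsum M (\<lambda>l. x l \<odot>\<^bsub>M\<^esub> y l \<oplus>\<^bsub>M\<^esub> z l \<odot>\<^bsub>M\<^esub> y l) {..<n}"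
      using cl[OF x(2)] cl[OF z(2)] assms(2) pcarD[OF x(2)] pcarD[OF z(2)]
      by (intro M.finsum_cong') (auto simp: smult_add_scalar)
    also have "\<dots> = finsum M (\<lambda>l. x l \<odot>\<^bsub>M\<^esub> y l) {..<n} \<oplus>\<^bsub>M\<^esub> finsum M (\<lambda>l. z l \<odot>\<^bsub>M\<^esub> y l) {..<n}"
      by (rule M.finsum_addf[OF cl[OF x(2)] cl[OF z(2)]])
    finally show "lift M n y (u \<oplus>\<^bsub>Pmod n w\<^esub> v) = lift M n y u \<oplus>\<^bsub>M\<^esub> lift M n y v"
      by (simp add: lift_def x z)
  next
    fix a u assume a: "a \<in> carrier R" "u \<in> carrier (Pmod n w)"
    then obtain x where x: "u = {x}" "x \<in> pcar n w" by auto
    have "a \<odot>\<^bsub>M\<^esub> lift M n y u = finsum M (\<lambda>l. a \<odot>\<^bsub>M\<^esub> (x l \<odot>\<^bsub>M\<^esub> y l)) {..<n}"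
      unfolding lift_def x(1) the_elem_eq by (rule smult_finsum[OF a(1) _ cl[OF x(2)]]) simp
    also have "\<dots> = finsum M (\<lambda>l. (x l \<otimes>\<^bsub>R\<^esub> a) \<odot>\<^bsub>M\<^esub> y l) {..<n}"
      using a(1) assms(2) pcarD[OF x(2)] by (intro M.finsum_cong') (auto simp: smult_assoc smult_closed)
    finally show "lift M n y (a \<odot>\<^bsub>Pmod n w\<^esub> u) = a \<odot>\<^bsub>M\<^esub> lift M n y u"
      by (simp add: lift_def x)
  qed
qed

lemma lift_gen:
  assumes "right_module R M" and "\<And>l. l < n \<Longrightarrow> y l \<in> comp M (w l)" and "k < n"
  shows "lift M n y {pgen w k} = y k"
proof -
  interpret right_module R M by fact
  have y: "y l \<in> carrier M" "idem (w l) \<odot>\<^bsub>M\<^esub> y l = y l" if "l < n" for l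
    using assms(2)[OF that] by (simp_all add: comp_def)
  have "lift M n y {pgen w k} = finsum M (\<lambda>l. if k = l then y l else \<zero>\<^bsub>M\<^esub>) {..<n}"
    unfolding lift_def using y by (intro M.finsum_cong') (auto simp: pgen_def)
  also have "\<dots> = y k" using assms(3) y by (intro M.add.finprod_singleton) auto
  finally show ?thesis .
qed

text \<open>Together with \<open>lift_gen\<close> this describes the homomorphisms out of e_i R by
  the elements of M e_i.\<close>

lemma hom_pmod_expand:
  assumes "right_module R M" and "h \<in> mod_hom R (Pmod n w) M" and "x \<in> pcar n w"
  shows "h {x} = finsum M (\<lambda>l. x l \<odot>\<^bsub>M\<^esub> h {pgen w l}) {..<n}"
proof -
  interpret right_module R M by fact
  interpret h: right_module_hom R "Pmod n w" M h
    using assms by (simp add: right_module_hom_def right_module_hom_axioms_def right_module_pmod)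
  have c: "{pgen w l} \<in> carrier (Pmod n w)" if "l < n" for l using pgen_in[OF that] by simp
  have "h {x} = h (finsum (Pmod n w) (\<lambda>l. x l \<odot>\<^bsub>Pmod n w\<^esub> {pgen w l}) {..<n})"
    by (simp only: pmod_expand[OF assms(3)])
  also have "\<dots> = finsum M (\<lambda>l. h (x l \<odot>\<^bsub>Pmod n w\<^esub> {pgen w l})) {..<n}"
    using c pcarD[OF assms(3)] by (intro h.finsum) (auto simp del: Pmod_simps intro!: h.M.smult_closed)
  also have "\<dots> = finsum M (\<lambda>l. x l \<odot>\<^bsub>M\<^esub> h {pgen w l}) {..<n}"
    using c pcarD[OF assms(3)] h.closed[OF c]
    by (intro M.finsum_cong') (auto simp del: Pmod_simps simp: h.smult smult_closed)
  finally show ?thesis .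
qed

text \<open>The l-th generator goes to an element of N e_(w l), which has a preimage in M e_(w l);
  these preimages define the lift.\<close>

lemma projective_pmod: "projective R (Pmod n w)"
  unfolding projective_def
proof (intro ballI impI)
  fix M N :: "'r umodule" and g h
  assume fg: "M \<in> fg_modules R" "N \<in> fg_modules R" and g: "g \<in> mod_hom R M N"
    and h: "h \<in> mod_hom R (Pmod n w) N" and surj: "g ` carrier M = carrier N"
  have rM: "right_module R M" and rN: "right_module R N" using fg by (auto simp: fg_modules_def)
  interpret g: right_module_hom R M N g
    using rM rN g by (simp add: right_module_hom_def right_module_hom_axioms_def)
  have gen: "{pgen w l} \<in> comp (Pmod n w) (w l)" if "l < n" for l
    using pgen_in[OF that] by (auto simp: comp_def pgen_def fun_eq_iff idem_idem)
  have "\<exists>m. m \<in> comp M (w l) \<and> g m = h {pgen w l}" if "l < n" for l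
  proof -
    have "h {pgen w l} \<in> g ` comp M (w l)"
      unfolding hom_comp_image[OF rM g surj]
      by (rule hom_comp_subset[OF right_module_pmod h gen[OF that]])
    then obtain m where "h {pgen w l} = g m" "m \<in> comp M (w l)" by (rule imageE)
    then show ?thesis by (intro exI[of _ m]) simp
  qed
  then obtain y where y: "\<And>l. l < n \<Longrightarrow> y l \<in> comp M (w l) \<and> g (y l) = h {pgen w l}" by metis
  have yM: "y l \<in> carrier M" if "l < n" for l using y[OF that] by (simp add: comp_def)
  show "\<exists>h'\<in>mod_hom R (Pmod n w) M. \<forall>x\<in>carrier (Pmod n w). g (h' x) = h x"
  proof (intro bexI[OF _ lift_hom[OF rM yM]] ballI)
    fix u assume "u \<in> carrier (Pmod n w)"
    then obtain x where x: "u = {x}" "x \<in> pcar n w" by auto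
    have "g (lift M n y u) = finsum N (\<lambda>l. g (x l \<odot>\<^bsub>M\<^esub> y l)) {..<n}"
      unfolding lift_def x(1) the_elem_eq
      using yM pcarD[OF x(2)] by (intro g.finsum) (auto simp: g.M.smult_closed)
    also have "\<dots> = finsum N (\<lambda>l. x l \<odot>\<^bsub>N\<^esub> h {pgen w l}) {..<n}"
      using y yM pcarD[OF x(2)] g.closed[OF yM]
      by (intro g.N.M.finsum_cong') (auto simp: g.smult g.N.smult_closed simp flip: y[THEN conjunct2])
    also have "\<dots> = h u" using hom_pmod_expand[OF rN h x(2)] x(1) by simp
    finally show "g (lift M n y u) = h u" .
  qed
qed

context
  fixes n :: nat and w :: "nat \<Rightarrow> 'v"
  assumes w: "\<And>l. l < n \<Longrightarrow> w l \<in> V"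
begin

interpretation P: rsz_module R V E src trg vc ac "Pmod n w"
  by (rule rsz_moduleI[OF right_module_pmod])

lemma rad_pmod: "rad (Pmod n w) = (\<lambda>x. {x}) ` {x \<in> pcar n w. \<forall>l<n. vc (x l) (w l) = 0}" (is "_ = ?H")
proof
  have H: "subspace (Pmod n w) ?H"
    by (rule P.subspaceI) (auto simp: pcar_zero pcar_add pcar_smult w coords pcarD)
  show "rad (Pmod n w) \<subseteq> ?H"
    unfolding rad_def
  proof clarify
    fix y assume y: "y \<in> E \<rightarrow> carrier (Pmod n w)"
    show "finsum (Pmod n w) (\<lambda>\<alpha>. arr \<alpha> \<odot>\<^bsub>Pmod n w\<^esub> y \<alpha>) E \<in> ?H"
    proof (rule P.subspace_finsum[OF H finite_E])
      fix \<alpha> assume "\<alpha> \<in> E"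
      then obtain x where "y \<alpha> = {x}" "x \<in> pcar n w" using y by fastforce
      then show "arr \<alpha> \<odot>\<^bsub>Pmod n w\<^esub> y \<alpha> \<in> ?H"
        by (auto simp: pcar_smult w coords pcarD)
    qed
  qed
  show "?H \<subseteq> rad (Pmod n w)"
  proof clarify
    fix x assume x: "x \<in> pcar n w" "\<forall>l<n. vc (x l) (w l) = 0"
    \<comment> \<open>x_l is the sum over the arrows of (c e_(w l)) \<alpha>, with c the coefficient
      of x_l at \<alpha>; \<open>z \<alpha>\<close> collects the left factors for all l. Arrows that
      do not start at w l have c = 0.\<close>
    define z where "z \<alpha> l = (if l < n \<and> src \<alpha> = w l then sc (ac (x l) \<alpha>) \<otimes>\<^bsub>R\<^esub> idem (w l) else \<zero>\<^bsub>R\<^esub>)" for \<alpha> l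
    have z: "z \<alpha> \<in> pcar n w" for \<alpha>
      by (rule pcarI) (auto simp: z_def coords)
    have fe: "finsum R (\<lambda>\<alpha>. z \<alpha> l \<otimes>\<^bsub>R\<^esub> arr \<alpha>) E = x l" for l
    proof (rule coord_eqI)
      have cl: "(\<lambda>\<alpha>. z \<alpha> l \<otimes>\<^bsub>R\<^esub> arr \<alpha>) \<in> E \<rightarrow> carrier R" using pcarD[OF z] by simp
      then show "finsum R (\<lambda>\<alpha>. z \<alpha> l \<otimes>\<^bsub>R\<^esub> arr \<alpha>) E \<in> carrier R" by (rule R.finsum_closed)
      show "x l \<in> carrier R" by (rule pcarD[OF x(1)])
      show "vc (finsum R (\<lambda>\<alpha>. z \<alpha> l \<otimes>\<^bsub>R\<^esub> arr \<alpha>) E) i = vc (x l) i" if i: "i \<in> V" for i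
      proof -
        have "vc (finsum R (\<lambda>\<alpha>. z \<alpha> l \<otimes>\<^bsub>R\<^esub> arr \<alpha>) E) i = 0"
          using cl i pcarD[OF z] by (simp add: vc_finsum finite_E coords)
        moreover have "vc (x l) i = 0"
          using x pcar_coord(1)[OF x(1) _ i] pcar_out[OF x(1), of l] i
          by (cases "l < n"; cases "i = w l") auto
        ultimately show ?thesis by simp
      qed
      show "ac (finsum R (\<lambda>\<alpha>. z \<alpha> l \<otimes>\<^bsub>R\<^esub> arr \<alpha>) E) \<beta> = ac (x l) \<beta>" if b: "\<beta> \<in> E" for \<beta>
      proof -
        have "ac (z \<alpha> l \<otimes>\<^bsub>R\<^esub> arr \<alpha>) \<beta> = (if \<alpha> = \<beta> then ac (x l) \<beta> else 0)" if "\<alpha> \<in> E" for \<alpha>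
        proof (cases "l < n \<and> src \<alpha> = w l")
          case True
          then show ?thesis using b that w by (auto simp: z_def coords)
        next
          case False
          then have "ac (x l) \<alpha> = 0"
            using pcar_coord(2)[OF x(1) _ that] pcar_out[OF x(1), of l] that by (cases "l < n") auto
          then show ?thesis using b that False by (auto simp: z_def coords)
        qed
        then have "ac (finsum R (\<lambda>\<alpha>. z \<alpha> l \<otimes>\<^bsub>R\<^esub> arr \<alpha>) E) \<beta> = (\<Sum>\<alpha>\<in>E. if \<alpha> = \<beta> then ac (x l) \<beta> else 0)"
          using cl b by (simp add: ac_finsum finite_E)
        then show ?thesis using b finite_E by simp
      qed
    qed
    have "finsum (Pmod n w) (\<lambda>\<alpha>. {\<lambda>l. z \<alpha> l \<otimes>\<^bsub>R\<^esub> arr \<alpha>}) E = {x}"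
      by (subst pmod_finsum) (auto simp: finite_E pcar_smult z fe)
    then show "{x} \<in> rad (Pmod n w)"
      using P.radI[of "\<lambda>\<alpha>. {z \<alpha>}"] z by simp
  qed
qed

lemma comp_pmod: "comp (Pmod n w) i = (\<lambda>x. {x}) ` {x \<in> pcar n w. \<forall>l<n. x l \<otimes>\<^bsub>R\<^esub> idem i = x l}"
proof -
  have "(\<lambda>l. x l \<otimes>\<^bsub>R\<^esub> idem i) = x \<longleftrightarrow> (\<forall>l<n. x l \<otimes>\<^bsub>R\<^esub> idem i = x l)" if "x \<in> pcar n w" for x
  proof
    assume r: "\<forall>l<n. x l \<otimes>\<^bsub>R\<^esub> idem i = x l"
    show "(\<lambda>l. x l \<otimes>\<^bsub>R\<^esub> idem i) = x"
    proof
      show "x l \<otimes>\<^bsub>R\<^esub> idem i = x l" for l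
        using r pcar_out[OF that, of l] by (cases "l < n") auto
    qed
  qed metis
  then have "{x \<in> pcar n w. (\<lambda>l. x l \<otimes>\<^bsub>R\<^esub> idem i) = x}
      = {x \<in> pcar n w. \<forall>l<n. x l \<otimes>\<^bsub>R\<^esub> idem i = x l}" by blast
  moreover have "comp (Pmod n w) i = (\<lambda>x. {x}) ` {x \<in> pcar n w. (\<lambda>l. x l \<otimes>\<^bsub>R\<^esub> idem i) = x}"
    by (auto simp: comp_def)
  ultimately show ?thesis by simp
qed

lemma fin_dim_pmod: "fin_dim (Pmod n w)"
proof -
  \<comment> \<open>One coordinate per place for the trivial path (\<open>None\<close>) and one for
    every arrow (\<open>Some \<alpha>\<close>). Arrows that do not start at \<open>w l\<close> are
    counted too, which is harmless for an upper bound.\<close>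
  define S where "S = {..<n} \<times> insert None (Some ` E)"
  define f where "f u s = (if s \<in> S then (case snd s of None \<Rightarrow> vc (the_elem u (fst s)) (w (fst s))
      | Some \<alpha> \<Rightarrow> ac (the_elem u (fst s)) \<alpha>) else 0)" for u :: "(nat \<Rightarrow> 'r) set" and s
  have sub: "subspace (Pmod n w) (carrier (Pmod n w))"
    by (rule P.subspace_if_submodule[OF P.submodule_carrier])
  have finS: "finite S" by (simp add: S_def finite_E)
  have "kdim (Pmod n w) (carrier (Pmod n w)) \<le>
      kdim (Pmod n w) {u \<in> carrier (Pmod n w). \<forall>s. f u s = 0} + enat (card S)"
    by (rule kdim_coord[OF right_module_pmod sub finS])
       (auto simp: f_def S_def fun_eq_iff coords w pcarD split: option.splits)
  moreover have "{u \<in> carrier (Pmod n w). \<forall>s. f u s = 0} = {\<zero>\<^bsub>Pmod n w\<^esub>}"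
  proof -
    have "x = (\<lambda>_. \<zero>\<^bsub>R\<^esub>)" if x: "x \<in> pcar n w" and f: "\<forall>s. f {x} s = 0" for x
    proof
      fix l
      show "x l = \<zero>\<^bsub>R\<^esub>"
      proof (cases "l < n")
        case True
        show ?thesis
        proof (rule coord_eqI)
          fix i assume i: "i \<in> V"
          then show "vc (x l) i = vc \<zero>\<^bsub>R\<^esub> i"
            using f[rule_format, of "(l, None)"] pcar_coord(1)[OF x True i] True
            by (cases "i = w l") (auto simp: f_def S_def)
        next
          fix \<alpha> assume a: "\<alpha> \<in> E"
          then show "ac (x l) \<alpha> = ac \<zero>\<^bsub>R\<^esub> \<alpha>"
            using f[rule_format, of "(l, Some \<alpha>)"] True by (auto simp: f_def S_def)
        qed (auto simp: pcarD[OF x])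
      next
        case False
        then show ?thesis using pcar_out[OF x] by simp
      qed
    qed
    moreover have "f {\<lambda>_. \<zero>\<^bsub>R\<^esub>} s = 0" for s
      by (auto simp: f_def S_def w split: option.splits)
    ultimately show ?thesis by (auto simp: pcar_zero)
  qed
  moreover have "kdim (Pmod n w) {\<zero>\<^bsub>Pmod n w\<^esub>} = 0"
    using P.kdim_0_iff[OF P.subspace_if_submodule[OF P.submodule_0]] by simp
  ultimately have "kdim (Pmod n w) (carrier (Pmod n w)) \<le> enat (card S)" by simp
  then show ?thesis unfolding fin_dim_def by (cases "kdim (Pmod n w) (carrier (Pmod n w))") auto
qed

lemma pmod_fg: "Pmod n w \<in> fg_modules R"
  by (simp add: fg_modules_def right_module_pmod fin_gen_if_fin_dim[OF right_module_pmod fin_dim_pmod])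

lemma dm_of_kdim_add:
  "kdim M H = kdim M H' + enat c \<Longrightarrow> kdim M H' \<noteq> \<infinity> \<Longrightarrow> dm M H = dm M H' + int c"
  by (cases "kdim M H'") (auto simp: dm_def)

text \<open>On P e_i the functionals reading the coefficient at the trivial path of
  \<open>i\<close>, one for each place with \<open>w l = i\<close>, are jointly onto and have common
  kernel (PJ) e_i.\<close>

lemma tp_pmod:
  assumes i: "i \<in> V"
  shows "tp (Pmod n w) i = int (card {l. l < n \<and> w l = i})"
proof -
  define S where "S = {l. l < n \<and> w l = i}"
  define f where "f u l = (if l \<in> S then vc (the_elem u l) i else 0)" for u :: "(nat \<Rightarrow> 'r) set" and l
  have finS: "finite S" by (simp add: S_def)
  have "kdim (Pmod n w) (comp (Pmod n w) i) =
      kdim (Pmod n w) {u \<in> comp (Pmod n w) i. \<forall>s. f u s = 0} + enat (card S)"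
  proof (rule kdim_coord(2)[OF right_module_pmod P.subspace_comp finS])
    show "f (u \<oplus>\<^bsub>Pmod n w\<^esub> v) = (\<lambda>s. f u s + f v s)" if "u \<in> comp (Pmod n w) i" "v \<in> comp (Pmod n w) i" for u v
      using that i by (auto simp: f_def fun_eq_iff coords pcarD comp_pmod)
    show "f (sc c \<odot>\<^bsub>Pmod n w\<^esub> u) = (\<lambda>s. c * f u s)" if "u \<in> comp (Pmod n w) i" for c u
      using that i by (auto simp: f_def fun_eq_iff coords pcarD comp_pmod)
    show "f u s = 0" if "s \<notin> S" for u s using that by (simp add: f_def)
    show "\<exists>u\<in>comp (Pmod n w) i. f u = g" if g: "\<And>s. s \<notin> S \<Longrightarrow> g s = 0" for g
    proof -
      let ?x = "\<lambda>l. if l \<in> S then sc (g l) \<otimes>\<^bsub>R\<^esub> idem i else \<zero>\<^bsub>R\<^esub>"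
      have "?x \<in> pcar n w" by (rule pcarI) (auto simp: S_def coords)
      then have "{?x} \<in> comp (Pmod n w) i"
        unfolding comp_pmod by (auto simp: R.m_assoc idem_idem)
      moreover have "f {?x} = g" using g i by (auto simp: f_def fun_eq_iff coords)
      ultimately show ?thesis by blast
    qed
  qed
  moreover have "{u \<in> comp (Pmod n w) i. \<forall>s. f u s = 0} = radc (Pmod n w) i"
  proof -
    have "(\<forall>s. f {x} s = 0) \<longleftrightarrow> (\<forall>l<n. vc (x l) (w l) = 0)"
      if x: "x \<in> pcar n w" "\<forall>l<n. x l \<otimes>\<^bsub>R\<^esub> idem i = x l" for x
    proof
      assume f: "\<forall>s. f {x} s = 0"
      show "\<forall>l<n. vc (x l) (w l) = 0"
      proof (intro allI impI)
        fix l assume l: "l < n"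
        then show "vc (x l) (w l) = 0"
          using f[rule_format, of l] x(2)[rule_format, OF l] w[OF l] pcarD[OF x(1), of l]
          by (cases "w l = i") (auto simp: f_def S_def mult_idem_iff)
      qed
    next
      assume "\<forall>l<n. vc (x l) (w l) = 0"
      then show "\<forall>s. f {x} s = 0" by (auto simp: f_def S_def)
    qed
    then show ?thesis by (auto simp: radc_def comp_pmod rad_pmod)
  qed
  ultimately show ?thesis
    using dm_of_kdim_add[of "Pmod n w" "comp (Pmod n w) i" "radc (Pmod n w) i" "card S"]
      P.kdim_finite[OF fin_dim_pmod P.subspace_radc[of i]] by (simp add: tp_def S_def)
qed

text \<open>Placing an arrow from \<open>w l\<close> to \<open>j\<close> in the l-th place, for all
  l and all such arrows, gives a basis of (PJ) e_j.\<close>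

lemma dm_radc_pmod:
  assumes j: "j \<in> V"
  shows "dm (Pmod n w) (radc (Pmod n w) j) = int (card {(l, \<alpha>). l < n \<and> \<alpha> \<in> E \<and> src \<alpha> = w l \<and> trg \<alpha> = j})"
proof -
  define S where "S = {(l, \<alpha>). l < n \<and> \<alpha> \<in> E \<and> src \<alpha> = w l \<and> trg \<alpha> = j}"
  define f where "f u s = (if s \<in> S then ac (the_elem u (fst s)) (snd s) else 0)"
    for u :: "(nat \<Rightarrow> 'r) set" and s
  have finS: "finite S"
    by (rule finite_subset[of _ "{..<n} \<times> E"]) (auto simp: S_def finite_E)
  have rc: "radc (Pmod n w) j =
      (\<lambda>x. {x}) ` {x \<in> pcar n w. (\<forall>l<n. vc (x l) (w l) = 0) \<and> (\<forall>l<n. x l \<otimes>\<^bsub>R\<^esub> idem j = x l)}"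
    by (auto simp: radc_def comp_pmod rad_pmod)
  have "kdim (Pmod n w) (radc (Pmod n w) j) =
      kdim (Pmod n w) {u \<in> radc (Pmod n w) j. \<forall>s. f u s = 0} + enat (card S)"
  proof (rule kdim_coord(2)[OF right_module_pmod P.subspace_radc finS])
    show "f (u \<oplus>\<^bsub>Pmod n w\<^esub> v) = (\<lambda>s. f u s + f v s)" if "u \<in> radc (Pmod n w) j" "v \<in> radc (Pmod n w) j" for u v
      using that by (auto simp: f_def fun_eq_iff coords pcarD rc S_def)
    show "f (sc c \<odot>\<^bsub>Pmod n w\<^esub> u) = (\<lambda>s. c * f u s)" if "u \<in> radc (Pmod n w) j" for c u
      using that by (auto simp: f_def fun_eq_iff coords pcarD rc S_def)
    show "f u s = 0" if "s \<notin> S" for u s using that by (simp add: f_def)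
    show "\<exists>u\<in>radc (Pmod n w) j. f u = g" if g: "\<And>s. s \<notin> S \<Longrightarrow> g s = 0" for g
    proof -
      let ?x = "\<lambda>l. if l < n then elt (\<lambda>_. 0) (\<lambda>\<alpha>. g (l, \<alpha>)) else \<zero>\<^bsub>R\<^esub>"
      have "?x \<in> pcar n w" by (rule pcarI) (auto simp: S_def elt g)
      moreover have "?x l \<otimes>\<^bsub>R\<^esub> idem j = ?x l" if "l < n" for l
        using that by (simp add: elt mult_idem_iff) (auto simp: elt g S_def)
      ultimately have "{?x} \<in> radc (Pmod n w) j" unfolding rc by (auto simp: elt w)
      moreover have "f {?x} = g" using g by (auto simp: f_def fun_eq_iff elt S_def)
      ultimately show ?thesis by blast
    qed
  qed
  moreover have "{u \<in> radc (Pmod n w) j. \<forall>s. f u s = 0} = {\<zero>\<^bsub>Pmod n w\<^esub>}"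
  proof -
    have "x = (\<lambda>_. \<zero>\<^bsub>R\<^esub>)" if x: "x \<in> pcar n w" and f: "\<forall>s. f {x} s = 0"
      and v: "\<forall>l<n. vc (x l) (w l) = 0" and xj: "\<forall>l<n. x l \<otimes>\<^bsub>R\<^esub> idem j = x l" for x
    proof
      fix l
      show "x l = \<zero>\<^bsub>R\<^esub>"
      proof (cases "l < n")
        case True
        show ?thesis
        proof (rule coord_eqI)
          fix i assume i: "i \<in> V"
          then show "vc (x l) i = vc \<zero>\<^bsub>R\<^esub> i"
            using pcar_coord(1)[OF x True i] v True by (cases "i = w l") auto
        next
          fix \<alpha> assume a: "\<alpha> \<in> E"
          have "ac (x l) \<alpha> = 0"
          proof (cases "(l, \<alpha>) \<in> S")
            case True
            then show ?thesis using f[rule_format, of "(l, \<alpha>)"] by (simp add: f_def)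
          next
            case False
            then have "src \<alpha> \<noteq> w l \<or> trg \<alpha> \<noteq> j" using a True by (simp add: S_def)
            then show ?thesis
              using pcar_coord(2)[OF x True a] xj[rule_format, OF True] pcarD[OF x, of l] a
              by (auto simp: mult_idem_iff)
          qed
          then show "ac (x l) \<alpha> = ac \<zero>\<^bsub>R\<^esub> \<alpha>" using a by simp
        qed (auto simp: pcarD[OF x])
      next
        case False
        then show ?thesis using pcar_out[OF x] by simp
      qed
    qed
    moreover have "f {\<lambda>_. \<zero>\<^bsub>R\<^esub>} s = 0" for s
      by (auto simp: f_def S_def)
    ultimately show ?thesis by (auto simp: pcar_zero rc w)
  qed
  moreover have "dm (Pmod n w) {\<zero>\<^bsub>Pmod n w\<^esub>} = 0" "kdim (Pmod n w) {\<zero>\<^bsub>Pmod n w\<^esub>} \<noteq> \<infinity>"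
    using P.dm_0_iff[OF fin_dim_pmod P.subspace_if_submodule[OF P.submodule_0]]
      P.kdim_finite[OF fin_dim_pmod P.subspace_if_submodule[OF P.submodule_0]] by simp_all
  ultimately show ?thesis
    using dm_of_kdim_add[of "Pmod n w" "radc (Pmod n w) j" "{\<zero>\<^bsub>Pmod n w\<^esub>}" "card S"] by (simp add: S_def)
qed

text \<open>The expected value, as a projective module has syzygy 0. The pairs of a place and an
  arrow counted by \<open>dm_radc_pmod\<close> are grouped by the arrow, which yields the sum of the
  \<open>tp\<close>.\<close>

lemma om_pmod:
  assumes j: "j \<in> V"
  shows "om (Pmod n w) j = 0"
proof -
  have "{(l, \<alpha>). l < n \<and> \<alpha> \<in> E \<and> src \<alpha> = w l \<and> trg \<alpha> = j}
      = prod.swap ` (SIGMA \<alpha>:{\<alpha>\<in>E. trg \<alpha> = j}. {l. l < n \<and> w l = src \<alpha>})"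
    by force
  then have "card {(l, \<alpha>). l < n \<and> \<alpha> \<in> E \<and> src \<alpha> = w l \<and> trg \<alpha> = j}
      = (\<Sum>\<alpha>\<in>{\<alpha>\<in>E. trg \<alpha> = j}. card {l. l < n \<and> w l = src \<alpha>})"
    by (simp add: card_image finite_E)
  then show ?thesis
    by (simp add: om_def dm_radc_pmod[OF j] tp_pmod src_in)
qed

text \<open>Multiplication by an arrow starting at \<open>j\<close> detects the coefficients at the
  trivial path of \<open>j\<close>, so the elements of P e_j in the socle have none and lie in the
  radical.\<close>

lemma mu_pmod:
  assumes "\<alpha> \<in> E" and "src \<alpha> = j"
  shows "mu (Pmod n w) j = 0"
proof -
  have "socc (Pmod n w) j = radc (Pmod n w) j"
  proof
    show "radc (Pmod n w) j \<subseteq> socc (Pmod n w) j"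
      using P.arr_kills_rad by (auto simp: socc_def radc_def)
    show "socc (Pmod n w) j \<subseteq> radc (Pmod n w) j"
    proof
      fix u assume u: "u \<in> socc (Pmod n w) j"
      then have uj: "u \<in> comp (Pmod n w) j" "arr \<alpha> \<odot>\<^bsub>Pmod n w\<^esub> u = \<zero>\<^bsub>Pmod n w\<^esub>"
        using assms by (auto simp: socc_def)
      then obtain x where x: "u = {x}" "x \<in> pcar n w" "\<forall>l<n. x l \<otimes>\<^bsub>R\<^esub> idem j = x l"
        by (auto simp: comp_pmod)
      have "vc (x l) (w l) = 0" if l: "l < n" for l
      proof (cases "w l = j")
        case True
        have "x l \<otimes>\<^bsub>R\<^esub> arr \<alpha> = \<zero>\<^bsub>R\<^esub>" using uj(2) x(1) by (simp add: fun_eq_iff)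
        then show ?thesis
          using ac_mult[of "x l" "arr \<alpha>" \<alpha>] assms pcarD[OF x(2)] True by (simp add: trg_in)
      next
        case False
        then show ?thesis using x(3) l w[OF l] pcarD[OF x(2), of l] by (auto simp: mult_idem_iff)
      qed
      then have "u \<in> rad (Pmod n w)" using x by (simp add: rad_pmod)
      then show "u \<in> radc (Pmod n w) j" using uj(1) by (simp add: radc_def)
    qed
  qed
  then show ?thesis by (simp add: mu_def)
qed

end

text \<open>A homogeneous generating set of minimal size yields a projective cover: an element of the
  kernel outside the radical would make one of the generators superfluous.\<close>

lemma cover_exists:
  fixes M :: "('r, 'm) module"
  assumes rM: "right_module R M" and fg: "fin_gen R M"
  shows "\<exists>n w f. (\<forall>l<n. w l \<in> V) \<and> f \<in> mod_hom R (Pmod n w) M \<and> f ` carrier (Pmod n w) = carrier M \<and>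
    mod_kernel (Pmod n w) M f \<subseteq> rad (Pmod n w)"
proof -
  interpret rsz_module R V E src trg vc ac M by (rule rsz_moduleI[OF rM])
  let ?Q = "\<lambda>G. finite G \<and> G \<subseteq> (\<Union>i\<in>V. comp M i) \<and> (\<forall>H. submodule H R M \<longrightarrow> G \<subseteq> H \<longrightarrow> H = carrier M)"
  obtain S where S: "finite S" "S \<subseteq> carrier M" "\<And>H. submodule H R M \<Longrightarrow> S \<subseteq> H \<Longrightarrow> H = carrier M"
    using fg unfolding fin_gen_def by blast
  \<comment> \<open>Homogeneous generators: \<open>s\<close> is recovered as the sum of its
    components s e_i.\<close>
  have "?Q ((\<lambda>(i, s). idem i \<odot>\<^bsub>M\<^esub> s) ` (V \<times> S))"
  proof (intro conjI allI impI)
    show "finite ((\<lambda>(i, s). idem i \<odot>\<^bsub>M\<^esub> s) ` (V \<times> S))" using finite_V S(1) by simp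
    show "(\<lambda>(i, s). idem i \<odot>\<^bsub>M\<^esub> s) ` (V \<times> S) \<subseteq> (\<Union>i\<in>V. comp M i)"
      using S(2) idem_act_comp by auto
    fix H assume H: "submodule H R M" "(\<lambda>(i, s). idem i \<odot>\<^bsub>M\<^esub> s) ` (V \<times> S) \<subseteq> H"
    have "s \<in> H" if s: "s \<in> S" for s
    proof -
      have "finsum M (\<lambda>i. idem i \<odot>\<^bsub>M\<^esub> s) V \<in> H"
        using H(2) s by (intro subspace_finsum[OF subspace_if_submodule[OF H(1)] finite_V]) auto
      then show ?thesis using sum_idem_act[of s] s S(2) by (simp add: subsetD)
    qed
    then show "H = carrier M" using S(3)[OF H(1)] by blast
  qed
  then obtain G where G: "?Q G" "\<And>G'. ?Q G' \<Longrightarrow> card G \<le> card G'"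
    using ex_has_least_nat[of ?Q _ card] by (metis (no_types, lifting))
  define n where "n = card G"
  obtain y where "bij_betw y {0..<n} G" using ex_bij_betw_nat_finite[of G] G(1) n_def by blast
  then have y: "inj_on y {..<n}" "y ` {..<n} = G" by (auto simp: bij_betw_def atLeast0LessThan)
  have "\<exists>i. i \<in> V \<and> y l \<in> comp M i" if "l < n" for l
  proof -
    have "y l \<in> G" using y(2) that by blast
    then show ?thesis using G(1) by blast
  qed
  then obtain w where w: "\<And>l. l < n \<Longrightarrow> w l \<in> V \<and> y l \<in> comp M (w l)" by metis
  then have wV: "\<And>l. l < n \<Longrightarrow> w l \<in> V" and yw: "\<And>l. l < n \<Longrightarrow> y l \<in> comp M (w l)" by blast+
  have yM: "y l \<in> carrier M" and yid: "idem (w l) \<odot>\<^bsub>M\<^esub> y l = y l" if "l < n" for l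
    using yw[OF that] by (simp_all add: comp_def)
  have f: "lift M n y \<in> mod_hom R (Pmod n w) M" by (rule lift_hom[OF rM yM])
  interpret P: rsz_module R V E src trg vc ac "Pmod n w" by (rule rsz_moduleI[OF right_module_pmod])
  interpret f: right_module_hom R "Pmod n w" M "lift M n y" by unfold_locales (rule f)
  have surj: "lift M n y ` carrier (Pmod n w) = carrier M"
  proof -
    have "y l \<in> lift M n y ` carrier (Pmod n w)" if l: "l < n" for l
      using lift_gen[OF rM yw l] pgen_in[OF l, of w] by (intro image_eqI[of _ _ "{pgen w l}"]) auto
    then have "G \<subseteq> lift M n y ` carrier (Pmod n w)" using y(2) by auto
    then show ?thesis using G(1) f.submodule_image[OF P.submodule_carrier] by blast
  qed
  have "mod_kernel (Pmod n w) M (lift M n y) \<subseteq> rad (Pmod n w)"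
  proof (rule subsetI, rule ccontr)
    fix u assume u: "u \<in> mod_kernel (Pmod n w) M (lift M n y)" and nr: "u \<notin> rad (Pmod n w)"
    obtain x where x: "u = {x}" "x \<in> pcar n w" using u by (auto simp: mod_kernel_def)
    obtain l0 where l0: "l0 < n" "vc (x l0) (w l0) \<noteq> 0"
      using nr x by (auto simp: rad_pmod[OF wV])
    let ?c = "vc (x l0) (w l0)"
    have xR: "x l \<in> carrier R" for l by (rule pcarD[OF x(2)])
    have sum0: "finsum M (\<lambda>l. x l \<odot>\<^bsub>M\<^esub> y l) {..<n} = \<zero>\<^bsub>M\<^esub>"
      using u x(1) by (simp add: mod_kernel_def lift_def)
    \<comment> \<open>\<open>x\<close> is a relation between the generators whose entry at
      \<open>l0\<close> has a nonzero coefficient at the trivial path. Hence y_l0 lies in H + MJ for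
      every submodule \<open>H\<close> containing the other generators, and Nakayama's lemma gives H
      = M.\<close>
    have Q: "?Q (G - {y l0})"
    proof (intro conjI allI impI)
      show "finite (G - {y l0})" "G - {y l0} \<subseteq> (\<Union>i\<in>V. comp M i)" using G(1) by blast+
      fix H assume H: "submodule H R M" "G - {y l0} \<subseteq> H"
      let ?H = "H <+>\<^bsub>M\<^esub> rad M"
      have sH: "submodule ?H R M" by (rule submodule_sum[OF H(1) submodule_rad])
      have HH: "H \<subseteq> ?H" "rad M \<subseteq> ?H"
        by (rule subset_sum_left[OF H(1) submodule_rad], rule subset_sum_right[OF H(1) submodule_rad])
      have yH: "y l \<in> H" if "l < n" "l \<noteq> l0" for l
      proof -
        have "y l \<noteq> y l0" using inj_onD[OF y(1), of l l0] that l0(1) by auto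
        then show ?thesis using H(2) y(2) that(1) by blast
      qed
      let ?rest = "finsum M (\<lambda>l. x l \<odot>\<^bsub>M\<^esub> y l) ({..<n} - {l0})"
      have rest: "?rest \<in> H"
        using yH xR submodule_smult[OF H(1)]
        by (intro subspace_finsum[OF subspace_if_submodule[OF H(1)]]) auto
      have "finsum M (\<lambda>l. x l \<odot>\<^bsub>M\<^esub> y l) (insert l0 ({..<n} - {l0})) = x l0 \<odot>\<^bsub>M\<^esub> y l0 \<oplus>\<^bsub>M\<^esub> ?rest"
        using l0(1) xR yM by (intro M.finsum_insert) (auto simp: smult_closed)
      then have "x l0 \<odot>\<^bsub>M\<^esub> y l0 \<oplus>\<^bsub>M\<^esub> ?rest = \<zero>\<^bsub>M\<^esub>"
        using sum0 l0(1) by (simp add: insert_absorb)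
      then have "x l0 \<odot>\<^bsub>M\<^esub> y l0 = \<ominus>\<^bsub>M\<^esub> ?rest"
        using rest submodule_subset[OF H(1)] xR yM[OF l0(1)]
        by (intro M.minus_equality[symmetric]) (auto simp: smult_closed)
      then have 1: "x l0 \<odot>\<^bsub>M\<^esub> y l0 \<in> ?H" using submodule_neg[OF H(1) rest] HH(1) by auto
      have "finsum M (\<lambda>\<alpha>. sc (ac (x l0) \<alpha>) \<odot>\<^bsub>M\<^esub> (arr \<alpha> \<odot>\<^bsub>M\<^esub> y l0)) E \<in> rad M" (is "?r \<in> _")
        using yM[OF l0(1)] arr_act_rad submodule_smult[OF submodule_rad]
        by (intro subspace_finsum[OF subspace_if_submodule[OF submodule_rad] finite_E]) auto
      then have r: "?r \<in> ?H" using HH(2) by blast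
      have "finsum M (\<lambda>i. sc (vc (x l0) i) \<odot>\<^bsub>M\<^esub> (idem i \<odot>\<^bsub>M\<^esub> y l0)) V
          = finsum M (\<lambda>i. if w l0 = i then sc ?c \<odot>\<^bsub>M\<^esub> y l0 else \<zero>\<^bsub>M\<^esub>) V"
      proof (rule M.finsum_cong')
        fix i assume "i \<in> V"
        have "idem i \<odot>\<^bsub>M\<^esub> y l0 = (if i = w l0 then y l0 else \<zero>\<^bsub>M\<^esub>)"
          using act_idem_idem[OF yM[OF l0(1)], of i "w l0"] yid[OF l0(1)] by (cases "i = w l0") auto
        then show "sc (vc (x l0) i) \<odot>\<^bsub>M\<^esub> (idem i \<odot>\<^bsub>M\<^esub> y l0) = (if w l0 = i then sc ?c \<odot>\<^bsub>M\<^esub> y l0 else \<zero>\<^bsub>M\<^esub>)"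
          by auto
      qed (use yM[OF l0(1)] in \<open>auto simp: smult_closed\<close>)
      also have "\<dots> = sc ?c \<odot>\<^bsub>M\<^esub> y l0"
        by (rule M.add.finprod_singleton) (use wV[OF l0(1)] finite_V yM[OF l0(1)] in \<open>auto simp: smult_closed\<close>)
      \<comment> \<open>Among the idempotents only the one at \<open>w l0\<close> acts on y_l0 with
        nonzero result, and the arrow terms lie in MJ.\<close>
      finally have 2: "x l0 \<odot>\<^bsub>M\<^esub> y l0 = sc ?c \<odot>\<^bsub>M\<^esub> y l0 \<oplus>\<^bsub>M\<^esub> ?r"
        using act_expand[OF xR yM[OF l0(1)], of l0] by simp
      have rc: "?r \<in> carrier M" using r submodule_subset[OF sH] by blast
      have "(x l0 \<odot>\<^bsub>M\<^esub> y l0) \<oplus>\<^bsub>M\<^esub> \<ominus>\<^bsub>M\<^esub> ?r \<in> ?H"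
        by (rule submodule_add[OF sH 1 submodule_neg[OF sH r]])
      then have "sc ?c \<odot>\<^bsub>M\<^esub> y l0 \<in> ?H"
        unfolding 2 using rc yM[OF l0(1)] by (simp add: M.a_assoc M.r_neg smult_closed)
      then have "sc (1 / ?c) \<odot>\<^bsub>M\<^esub> (sc ?c \<odot>\<^bsub>M\<^esub> y l0) \<in> ?H" by (rule submodule_smult[OF sH sc_closed])
      then have "y l0 \<in> ?H" using l0(2) yM[OF l0(1)] by (simp add: act_sc sc_1 smult_one)
      then have "G \<subseteq> ?H" using H(2) HH(1) by blast
      then have "?H = carrier M" using G(1) sH by blast
      then show "H = carrier M" by (rule nakayama[OF H(1)])
    qed
    have "y l0 \<in> G" using y(2) l0(1) by blast
    then have "card (G - {y l0}) < card G" using G(1) by (meson card_Diff1_less)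
    then show False using G(2)[OF Q] by linarith
  qed
  then show ?thesis using wV f surj by blast
qed

section \<open>Uniqueness of projective covers and the structure of syzygies\<close>

lemma kernel_superfluous:
  assumes "right_module R P" and "mod_kernel P M f \<subseteq> rad P"
    and H: "submodule H R P" and "H <+>\<^bsub>P\<^esub> mod_kernel P M f = carrier P"
  shows "H = carrier P"
proof -
  interpret rsz_module R V E src trg vc ac P by (rule rsz_moduleI[OF assms(1)])
  have "H <+>\<^bsub>P\<^esub> mod_kernel P M f \<subseteq> H <+>\<^bsub>P\<^esub> rad P" using assms(2) by (auto simp: set_add_def')
  then have "H <+>\<^bsub>P\<^esub> rad P = carrier P"
    using assms(4) submodule_subset[OF submodule_sum[OF H submodule_rad]] by blast
  then show ?thesis by (rule nakayama[OF H])
qed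

lemma fg_right_module: "M \<in> fg_modules R \<Longrightarrow> right_module R M"
  by (simp add: fg_modules_def)

lemma fg_fin_dim:
  fixes M :: "('r, 'm) module"
  assumes "right_module R M" and "fin_gen R M" shows "fin_dim M"
proof -
  obtain n w f where f: "\<forall>l<n. w l \<in> V" "f \<in> mod_hom R (Pmod n w) M" "f ` carrier (Pmod n w) = carrier M"
    using cover_exists[OF assms] by blast
  have "fin_dim (Pmod n w)" using f(1) by (intro fin_dim_pmod) blast
  then show ?thesis by (rule fin_dim_image[OF right_module_pmod assms(1) f(2,3)])
qed

text \<open>As \<open>R\<close> is finite-dimensional, being finitely generated is a dimension
  condition; in this form it passes to submodules, in particular to kernels of covers.\<close>

lemma fg_iff_fin_dim: "M \<in> fg_modules R \<longleftrightarrow> right_module R M \<and> fin_dim M"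
  using fg_fin_dim[of M] fin_gen_if_fin_dim[of M] by (auto simp: fg_modules_def)

lemma fg_submodule: "M \<in> fg_modules R \<Longrightarrow> submodule H R M \<Longrightarrow> M\<lparr>carrier := H\<rparr> \<in> fg_modules R"
  using right_module.right_module_submodule[of R M H] fin_dim_submodule[of M H]
  by (simp add: fg_iff_fin_dim)

lemma fg_cover:
  assumes "M \<in> fg_modules R"
  obtains n w f where "\<And>l. l < n \<Longrightarrow> w l \<in> V" and "projective_cover R (Pmod n w) f M"
    and "mod_kernel (Pmod n w) M f \<subseteq> rad (Pmod n w)"
proof -
  have rM: "right_module R M" "fin_gen R M" using assms by (simp_all add: fg_modules_def)
  from cover_exists[OF rM] obtain n w f where w: "\<forall>l<n. w l \<in> V" and f: "f \<in> mod_hom R (Pmod n w) M"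
    "f ` carrier (Pmod n w) = carrier M" and k: "mod_kernel (Pmod n w) M f \<subseteq> rad (Pmod n w)"
    by (elim exE conjE)
  have "Pmod n w \<in> fg_modules R" using w by (intro pmod_fg) blast
  then have "projective_cover R (Pmod n w) f M"
    unfolding projective_cover_def
    using projective_pmod f kernel_superfluous[OF right_module_pmod k] by (intro conjI allI impI) assumption+
  then show thesis using w k by (intro that[of n w f]) simp_all
qed

lemma projective_coverD:
  assumes "projective_cover R P f M"
  shows "P \<in> fg_modules R" and "projective R P" and "f \<in> mod_hom R P M" and "f ` carrier P = carrier M"
    and "submodule H R P \<Longrightarrow> H <+>\<^bsub>P\<^esub> mod_kernel P M f = carrier P \<Longrightarrow> H = carrier P"
proof -
  note a = assms[unfolded projective_cover_def]
  show "P \<in> fg_modules R" by (rule a[THEN conjunct1])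
  show "projective R P" by (rule a[THEN conjunct2, THEN conjunct1])
  show "f \<in> mod_hom R P M" by (rule a[THEN conjunct2, THEN conjunct2, THEN conjunct1])
  show "f ` carrier P = carrier M" by (rule a[THEN conjunct2, THEN conjunct2, THEN conjunct2, THEN conjunct1])
  show "submodule H R P \<Longrightarrow> H <+>\<^bsub>P\<^esub> mod_kernel P M f = carrier P \<Longrightarrow> H = carrier P"
    by (rule a[THEN conjunct2, THEN conjunct2, THEN conjunct2, THEN conjunct2, rule_format])
qed

lemma right_module_homI:
  "right_module R M \<Longrightarrow> right_module R N \<Longrightarrow> f \<in> mod_hom R M N \<Longrightarrow> right_module_hom R M N f"
  by (simp add: right_module_hom_def right_module_hom_axioms_def)

lemma diff_in_kernel:
  assumes "right_module_hom R M N f" and "x \<in> carrier M" and "y \<in> carrier M" and "f x = f y"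
  shows "x \<oplus>\<^bsub>M\<^esub> \<ominus>\<^bsub>M\<^esub> y \<in> mod_kernel M N f"
proof -
  interpret right_module_hom R M N f by fact
  show ?thesis using assms(2-4) by (simp add: mod_kernel_def add neg closed N.M.r_neg)
qed

text \<open>Lifting \<open>f\<close> along \<open>f0\<close> gives g: P -> P0. Its image and the
  kernel of \<open>f0\<close> span \<open>P0\<close>, so \<open>g\<close> is onto, and it splits by
  some \<open>s\<close> because \<open>P0\<close> is projective. The image of \<open>s\<close>
  together with the kernel of \<open>f\<close> spans \<open>P\<close>, so \<open>s\<close> is onto
  as well and \<open>g\<close> is bijective.\<close>

lemma cover_unique:
  assumes M: "M \<in> fg_modules R" and P: "projective_cover R P f M" and P0: "projective_cover R P0 f0 M"
    and ker: "mod_kernel P0 M f0 \<subseteq> rad P0"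
  obtains g where "g \<in> mod_hom R P P0" and "bij_betw g (carrier P) (carrier P0)"
    and "\<And>x. x \<in> carrier P \<Longrightarrow> f0 (g x) = f x"
proof -
  note fg = projective_coverD(1)[OF P] projective_coverD(1)[OF P0]
  note pr = projective_coverD(2)[OF P] projective_coverD(2)[OF P0]
  note f = projective_coverD(3,4)[OF P] and f0 = projective_coverD(3,4)[OF P0]
  note rm = fg_right_module[OF fg(1)] fg_right_module[OF fg(2)] fg_right_module[OF M]
  obtain g where g: "g \<in> mod_hom R P P0" "\<And>x. x \<in> carrier P \<Longrightarrow> f0 (g x) = f x"
    using pr(1)[unfolded projective_def, rule_format, OF fg(2) M f0(1) f(1) f0(2)] by (elim bexE) simp
  interpret g: right_module_hom R P P0 g by (rule right_module_homI[OF rm(1,2) g(1)])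
  interpret F: right_module_hom R P M f by (rule right_module_homI[OF rm(1,3) f(1)])
  interpret F0: right_module_hom R P0 M f0 by (rule right_module_homI[OF rm(2,3) f0(1)])
  have sumI: "z \<in> H <+>\<^bsub>L\<^esub> K"
    if "right_module R L" "h \<in> H" "h \<in> carrier L" "z \<in> carrier L" "z \<oplus>\<^bsub>L\<^esub> \<ominus>\<^bsub>L\<^esub> h \<in> K"
    for z h H K and L :: "'r umodule"
  proof -
    interpret L: right_module R L by fact
    have "z = h \<oplus>\<^bsub>L\<^esub> (z \<oplus>\<^bsub>L\<^esub> \<ominus>\<^bsub>L\<^esub> h)" using that(3,4) L.M.a_lcomm[of h z "\<ominus>\<^bsub>L\<^esub> h"] by (simp add: L.M.r_neg)
    then show ?thesis unfolding set_add_def' using that(2,5) by blast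
  qed
  have gsurj: "g ` carrier P = carrier P0"
  proof (rule kernel_superfluous[OF rm(2) ker])
    show sub: "submodule (g ` carrier P) R P0" by (rule g.submodule_image[OF g.M.submodule_carrier])
    show "g ` carrier P <+>\<^bsub>P0\<^esub> mod_kernel P0 M f0 = carrier P0"
    proof
      show "g ` carrier P <+>\<^bsub>P0\<^esub> mod_kernel P0 M f0 \<subseteq> carrier P0"
        by (rule submodule_subset[OF g.N.submodule_sum[OF sub F0.submodule_kernel]])
      show "carrier P0 \<subseteq> g ` carrier P <+>\<^bsub>P0\<^esub> mod_kernel P0 M f0"
      proof
        fix z assume z: "z \<in> carrier P0"
        have "f0 z \<in> f ` carrier P" using F0.closed[OF z] f(2) by simp
        then obtain p where p: "f0 z = f p" "p \<in> carrier P" by (rule imageE)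
        have "f0 z = f0 (g p)" using p g(2) by simp
        from diff_in_kernel[OF F0.right_module_hom_axioms z g.closed[OF p(2)] this]
        show "z \<in> g ` carrier P <+>\<^bsub>P0\<^esub> mod_kernel P0 M f0"
          using p(2) by (intro sumI[OF rm(2) _ g.closed[OF p(2)] z]) auto
      qed
    qed
  qed
  obtain s where s: "s \<in> mod_hom R P0 P" "\<And>z. z \<in> carrier P0 \<Longrightarrow> g (s z) = z"
    using pr(2)[unfolded projective_def, rule_format, OF fg g(1) mod_hom_id gsurj] by (elim bexE) simp
  interpret s: right_module_hom R P0 P s by (rule right_module_homI[OF rm(2,1) s(1)])
  have ssurj: "s ` carrier P0 = carrier P"
  proof -
    have sub: "submodule (s ` carrier P0) R P" by (rule s.submodule_image[OF g.N.submodule_carrier])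
    have "s ` carrier P0 <+>\<^bsub>P\<^esub> mod_kernel P M f = carrier P"
    proof
      show "s ` carrier P0 <+>\<^bsub>P\<^esub> mod_kernel P M f \<subseteq> carrier P"
        by (rule submodule_subset[OF g.M.submodule_sum[OF sub F.submodule_kernel]])
      show "carrier P \<subseteq> s ` carrier P0 <+>\<^bsub>P\<^esub> mod_kernel P M f"
      proof
        fix p assume p: "p \<in> carrier P"
        note c = s.closed[OF g.closed[OF p]]
        have "f p = f (s (g p))" using g(2)[OF c] g(2)[OF p] s(2)[OF g.closed[OF p]] by simp
        from diff_in_kernel[OF F.right_module_hom_axioms p c this]
        show "p \<in> s ` carrier P0 <+>\<^bsub>P\<^esub> mod_kernel P M f"
          using g.closed[OF p] by (intro sumI[OF rm(1) _ c p]) auto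
      qed
    qed
    then show ?thesis by (rule projective_coverD(5)[OF P sub])
  qed
  have "inj_on g (carrier P)"
  proof (rule inj_onI)
    fix p p' assume pp: "p \<in> carrier P" "p' \<in> carrier P" and eq: "g p = g p'"
    have "p \<in> s ` carrier P0" "p' \<in> s ` carrier P0" using pp ssurj by simp_all
    then obtain z z' where z: "z \<in> carrier P0" "p = s z" "z' \<in> carrier P0" "p' = s z'" by blast
    then show "p = p'" using eq s(2) by simp
  qed
  then show thesis using that g gsurj by (simp add: bij_betw_def)
qed

text \<open>Whatever cover a syzygy was computed from, it is the kernel of the given cover up to
  isomorphism; this makes the choice inside \<open>syzygy\<close> harmless.\<close>

lemma short_exact_kernel:
  assumes M: "M \<in> fg_modules R" and N: "N \<in> fg_modules R" and P: "projective_cover R P f M"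
    and ex: "short_exact R N i P f M"
    and P0: "projective_cover R P0 f0 M" and ker: "mod_kernel P0 M f0 \<subseteq> rad P0"
  shows "mod_iso R N (P0\<lparr>carrier := mod_kernel P0 M f0\<rparr>)"
proof -
  obtain g where g: "g \<in> mod_hom R P P0" "bij_betw g (carrier P) (carrier P0)"
    "\<And>x. x \<in> carrier P \<Longrightarrow> f0 (g x) = f x"
    using cover_unique[OF M P P0 ker] by blast
  have ii: "i \<in> mod_hom R N P" "inj_on i (carrier N)" "i ` carrier N = mod_kernel P M f"
    using ex unfolding short_exact_def by blast+
  have img: "(\<lambda>x. g (i x)) ` carrier N = mod_kernel P0 M f0"
  proof -
    have "g ` mod_kernel P M f = mod_kernel P0 M f0"
    proof
      show "g ` mod_kernel P M f \<subseteq> mod_kernel P0 M f0"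
        using g(3) mod_hom_closed[OF g(1)] by (auto simp: mod_kernel_def)
      show "mod_kernel P0 M f0 \<subseteq> g ` mod_kernel P M f"
      proof
        fix z assume z: "z \<in> mod_kernel P0 M f0"
        then have "z \<in> g ` carrier P" using g(2) by (simp add: mod_kernel_def bij_betw_def)
        then obtain p where "z = g p" "p \<in> carrier P" by (rule imageE)
        then show "z \<in> g ` mod_kernel P M f" using z g(3) by (auto simp: mod_kernel_def)
      qed
    qed
    then show ?thesis using ii(3) by (simp add: image_image[symmetric, of g i])
  qed
  have iP: "i ` carrier N \<subseteq> carrier P" using ii(3) by (auto simp: mod_kernel_def)
  have "inj_on (g \<circ> i) (carrier N)"
    using ii(2) g(2) iP by (intro comp_inj_on) (auto simp: bij_betw_def intro: inj_on_subset)
  then have "bij_betw (\<lambda>x. g (i x)) (carrier N) (mod_kernel P0 M f0)"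
    using img by (simp add: bij_betw_def o_def)
  moreover have "(\<lambda>x. g (i x)) \<in> mod_hom R N (P0\<lparr>carrier := mod_kernel P0 M f0\<rparr>)"
    using mod_hom_comp[OF ii(1) g(1)] img by (auto simp: mod_hom_def)
  ultimately show ?thesis unfolding mod_iso_def by (intro bexI) auto
qed

text \<open>This is MJ = 0. Since J is the radical of \<open>R\<close>, it is semisimplicity in the
  usual sense.\<close>

definition semisimple :: "('r, 'm) module \<Rightarrow> bool" where
  "semisimple M \<longleftrightarrow> (\<forall>\<alpha>\<in>E. \<forall>x\<in>carrier M. arr \<alpha> \<odot>\<^bsub>M\<^esub> x = \<zero>\<^bsub>M\<^esub>)"

lemma semisimple_iso:
  assumes "right_module R M" and "right_module R N" and "mod_iso R M N" and "semisimple N"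
  shows "semisimple M"
proof -
  obtain f where f: "f \<in> mod_hom R M N" "bij_betw f (carrier M) (carrier N)"
    using assms(3) by (auto simp: mod_iso_def)
  interpret right_module_hom R M N f by (rule right_module_homI[OF assms(1,2) f(1)])
  have "arr \<alpha> \<odot>\<^bsub>M\<^esub> x = \<zero>\<^bsub>M\<^esub>" if "\<alpha> \<in> E" "x \<in> carrier M" for \<alpha> x
  proof -
    have "f (arr \<alpha> \<odot>\<^bsub>M\<^esub> x) = f \<zero>\<^bsub>M\<^esub>"
      using assms(4) that by (simp add: smult zero semisimple_def closed)
    then show ?thesis
      using f(2) that by (auto simp: bij_betw_def M.smult_closed dest: inj_onD)
  qed
  then show ?thesis by (simp add: semisimple_def)
qed

text \<open>The kernel lies in the radical of the projective module and is killed by J because J^2 =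
  0. Its dimension vector is what \<open>om_cover\<close> leaves when \<open>om\<close> of the
  projective module is 0.\<close>

lemma kernel_of_cover:
  assumes M: "M \<in> fg_modules R" and w: "\<And>l. l < n \<Longrightarrow> w l \<in> V"
    and P: "projective_cover R (Pmod n w) f M" and ker: "mod_kernel (Pmod n w) M f \<subseteq> rad (Pmod n w)"
  defines "N \<equiv> (Pmod n w)\<lparr>carrier := mod_kernel (Pmod n w) M f\<rparr>"
  shows "N \<in> fg_modules R" and "semisimple N" and "j \<in> V \<Longrightarrow> dm N (comp N j) = om M j"
    and "short_exact R N (\<lambda>x. x) (Pmod n w) f M"
proof -
  note rm = right_module_pmod[of n w] fg_right_module[OF M]
  note f = projective_coverD(3,4)[OF P]
  interpret f: right_module_hom R "Pmod n w" M f by (rule right_module_homI[OF rm f(1)])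
  interpret P: rsz_module R V E src trg vc ac "Pmod n w" by (rule rsz_moduleI[OF right_module_pmod])
  show "N \<in> fg_modules R" unfolding N_def by (rule fg_submodule[OF pmod_fg[OF w] f.submodule_kernel])
  show "semisimple N" using P.arr_kills_rad ker by (auto simp: semisimple_def N_def)
  show "short_exact R N (\<lambda>x. x) (Pmod n w) f M"
    unfolding short_exact_def N_def
    by (intro conjI f mod_hom_incl submodule_subset[OF f.submodule_kernel]) simp_all
  have sub: "mod_kernel (Pmod n w) M f \<subseteq> carrier (Pmod n w)" by (auto simp: mod_kernel_def)
  show "dm N (comp N j) = om M j" if "j \<in> V"
    using om_cover[OF rm fin_dim_pmod[OF w] f ker, of j] om_pmod[OF w that] sub
    by (simp add: N_def comp_sub)
qed

text \<open>The kernel of the concrete cover shows that the choice in \<open>syzygy\<close> can be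
  made, and the chosen module inherits the properties of this kernel by isomorphism.\<close>

theorem syzygy_properties:
  assumes M: "M \<in> fg_modules R"
  shows "syzygy R M \<in> fg_modules R" and "semisimple (syzygy R M)"
    and "j \<in> V \<Longrightarrow> dm (syzygy R M) (comp (syzygy R M) j) = om M j"
proof -
  obtain n w f where w: "\<And>l. l < n \<Longrightarrow> w l \<in> V" and P: "projective_cover R (Pmod n w) f M"
    and ker: "mod_kernel (Pmod n w) M f \<subseteq> rad (Pmod n w)"
    by (rule fg_cover[OF M]) blast
  let ?N = "(Pmod n w)\<lparr>carrier := mod_kernel (Pmod n w) M f\<rparr>"
  have k: "?N \<in> fg_modules R" "semisimple ?N" "j \<in> V \<Longrightarrow> dm ?N (comp ?N j) = om M j"
    "short_exact R ?N (\<lambda>x. x) (Pmod n w) f M" for j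
    by (rule kernel_of_cover[OF M w P ker]; assumption)+
  have "\<exists>N. N \<in> fg_modules R \<and> (\<exists>P f i. projective_cover R P f M \<and> short_exact R N i P f M)"
    using k(1,4) P by blast
  from someI_ex[OF this]
  obtain P' f' i where N: "syzygy R M \<in> fg_modules R" "projective_cover R P' f' M"
    "short_exact R (syzygy R M) i P' f' M"
    unfolding syzygy_def by blast
  have iso: "mod_iso R (syzygy R M) ((Pmod n w)\<lparr>carrier := mod_kernel (Pmod n w) M f\<rparr>)"
    by (rule short_exact_kernel[OF M N(1,2,3) P ker])
  show "syzygy R M \<in> fg_modules R" by (rule N(1))
  have rN: "right_module R (syzygy R M)" "fin_dim (syzygy R M)" using N(1) by (simp_all add: fg_iff_fin_dim)
  note rK = fg_right_module[OF k(1)]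
  show "semisimple (syzygy R M)" by (rule semisimple_iso[OF rN(1) rK iso k(2)])
  show "dm (syzygy R M) (comp (syzygy R M) j) = om M j" if "j \<in> V"
    using iso_invariants(1)[OF rN(1) rK rN(2) iso, of j] k(3)[OF that] by simp
qed

text \<open>The identity of a projective module is a projective cover, so uniqueness of covers
  identifies the module with the source of its cover by some \<open>Pmod\<close>.\<close>

lemma projective_iso_pmod:
  assumes P: "P \<in> fg_modules R" "projective R P"
  obtains n w where "\<And>l. l < n \<Longrightarrow> w l \<in> V" and "mod_iso R (Pmod n w) P"
proof -
  obtain n w f where w: "\<And>l. l < n \<Longrightarrow> w l \<in> V" and P0: "projective_cover R (Pmod n w) f P"
    and ker: "mod_kernel (Pmod n w) P f \<subseteq> rad (Pmod n w)"
    by (rule fg_cover[OF P(1)]) blast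
  interpret P: right_module R P by (rule fg_right_module[OF P(1)])
  have "mod_kernel P P (\<lambda>x. x) = {\<zero>\<^bsub>P\<^esub>}" by (auto simp: mod_kernel_def)
  moreover have "H <+>\<^bsub>P\<^esub> {\<zero>\<^bsub>P\<^esub>} = H" if "submodule H R P" for H
    using submodule_subset[OF that] by (force simp: set_add_def')
  ultimately have sup: "H = carrier P"
    if "submodule H R P" "H <+>\<^bsub>P\<^esub> mod_kernel P P (\<lambda>x. x) = carrier P" for H
    using that by simp
  have "projective_cover R P (\<lambda>x. x) P"
    unfolding projective_cover_def
  proof (intro conjI allI impI)
    show "(\<lambda>x. x) ` carrier P = carrier P" by simp
    show "H = carrier P" if "submodule H R P" "H <+>\<^bsub>P\<^esub> mod_kernel P P (\<lambda>x. x) = carrier P" for H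
      by (rule sup[OF that])
  qed (rule P mod_hom_id)+
  from cover_unique[OF P(1) this P0 ker] obtain g where "g \<in> mod_hom R P (Pmod n w)"
    "bij_betw g (carrier P) (carrier (Pmod n w))" by (metis (no_types))
  then have "mod_iso R P (Pmod n w)" unfolding mod_iso_def by blast
  then have "mod_iso R (Pmod n w) P" by (rule mod_iso_sym[OF P.right_module_axioms right_module_pmod])
  then show thesis using that w by blast
qed

lemma projective_invariants:
  assumes P: "P \<in> fg_modules R" "projective R P"
  shows "j \<in> V \<Longrightarrow> om P j = 0" and "\<alpha> \<in> E \<Longrightarrow> mu P (src \<alpha>) = 0"
proof -
  obtain n w where w: "\<And>l. l < n \<Longrightarrow> w l \<in> V" and iso: "mod_iso R (Pmod n w) P"
    by (rule projective_iso_pmod[OF P]) blast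
  note i = iso_om[OF right_module_pmod fg_right_module[OF P(1)] fin_dim_pmod[OF w] iso]
  show "j \<in> V \<Longrightarrow> om P j = 0" using i(1) om_pmod[OF w] by simp
  show "\<alpha> \<in> E \<Longrightarrow> mu P (src \<alpha>) = 0" using i(2) mu_pmod[OF w] by simp
qed

end

section \<open>The group \<open>K\<^sub>0\<close>\<close>

lemma iso_class_eq:
  assumes "M \<in> fg_modules R" and "N \<in> fg_modules R" and "mod_iso R M N"
  shows "iso_class R M = iso_class R N"
proof -
  have r: "right_module R M" "right_module R N" using assms by (simp_all add: fg_modules_def)
  show ?thesis
    unfolding iso_class_def
    using mod_iso_trans[OF assms(3)] mod_iso_trans[OF mod_iso_sym[OF r assms(3)]] by blast
qed

lemma iso_class_eqD:
  assumes "N \<in> fg_modules R" and "iso_class R M = iso_class R N"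
  shows "mod_iso R M N"
proof -
  have "N \<in> iso_class R N" using assms(1) by (simp add: iso_class_def mod_iso_refl)
  then have "N \<in> iso_class R M" by (simp only: assms(2))
  then show ?thesis by (simp add: iso_class_def)
qed

context
  fixes R :: "'r ring"
begin

abbreviation K0r :: "('r umodule set \<Rightarrow>\<^sub>0 int) set" where
  "K0r \<equiv> generate (K0_free R) (K0_rels R)"

lemma comm_group_K0_free: "comm_group (K0_free R)"
  by (simp add: K0_free_def abelian_free_Abelian_group)

lemma carrier_K0_free: "c \<in> carrier (K0_free R) \<longleftrightarrow> Poly_Mapping.keys c \<subseteq> iso_class R ` fg_modules R"
  by (simp add: K0_free_def)

lemma frag_in_K0_free: "M \<in> fg_modules R \<Longrightarrow> frag_of (iso_class R M) \<in> carrier (K0_free R)"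
  by (simp add: K0_free_def)

lemma K0_free_minus:
  assumes "a \<in> carrier (K0_free R)" and "b \<in> carrier (K0_free R)"
  shows "a - b \<in> carrier (K0_free R)" and "a \<otimes>\<^bsub>K0_free R\<^esub> inv\<^bsub>K0_free R\<^esub> b = a - b"
proof -
  show "a - b \<in> carrier (K0_free R)"
    using assms keys_diff[of a b] unfolding carrier_K0_free by blast
  have "inv\<^bsub>K0_free R\<^esub> b = - b" using assms(2) by (simp add: K0_free_def)
  then show "a \<otimes>\<^bsub>K0_free R\<^esub> inv\<^bsub>K0_free R\<^esub> b = a - b" by (simp add: K0_free_def)
qed

lemma K0_rels_subset: "K0_rels R \<subseteq> carrier (K0_free R)"
proof
  fix c assume "c \<in> K0_rels R"
  then consider M M' M'' where "M \<in> fg_modules R" "M' \<in> fg_modules R" "M'' \<in> fg_modules R"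
      "c = frag_of (iso_class R M) - frag_of (iso_class R M') - frag_of (iso_class R M'')"
    | P where "P \<in> fg_modules R" "c = frag_of (iso_class R P)"
    unfolding K0_rels_def by blast
  then show "c \<in> carrier (K0_free R)"
    by cases (simp_all add: K0_free_minus(1) frag_in_K0_free)
qed

lemma subgroup_K0r: "subgroup K0r (K0_free R)"
  by (rule group.generate_is_subgroup[OF comm_group.axioms(2)[OF comm_group_K0_free] K0_rels_subset])

lemma normal_K0r: "K0r \<lhd> K0_free R"
  using comm_group.normal_iff_subgroup[OF comm_group_K0_free] subgroup_K0r by simp

lemma comm_group_K0: "comm_group (K0 R)"
  unfolding K0_def by (rule comm_group.abelian_FactGroup[OF comm_group_K0_free subgroup_K0r])

definition K0_proj :: "('r umodule set \<Rightarrow>\<^sub>0 int) \<Rightarrow> ('r umodule set \<Rightarrow>\<^sub>0 int) set" where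
  "K0_proj c = K0r #>\<^bsub>K0_free R\<^esub> c"

lemma K0_proj_hom: "K0_proj \<in> hom (K0_free R) (K0 R)"
  using normal.r_coset_hom_Mod[OF normal_K0r] by (simp add: K0_def K0_proj_def[abs_def])

lemma group_hom_K0_proj: "group_hom (K0_free R) (K0 R) K0_proj"
  by (simp add: group_hom_def group_hom_axioms_def K0_proj_hom comm_group.axioms(2)
      comm_group_K0_free comm_group_K0)

lemma K0_class_proj: "K0_class R M = K0_proj (frag_of (iso_class R M))"
  by (simp add: K0_class_def K0_proj_def)

lemma K0_class_closed: "M \<in> fg_modules R \<Longrightarrow> K0_class R M \<in> carrier (K0 R)"
  unfolding K0_class_proj by (rule hom_in_carrier[OF K0_proj_hom frag_in_K0_free])

lemma K0_carrier: "carrier (K0 R) = K0_proj ` carrier (K0_free R)"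
  by (auto simp: K0_def FactGroup_def RCOSETS_def K0_proj_def)

lemma K0_proj_rel: "c \<in> K0_rels R \<Longrightarrow> K0_proj c = \<one>\<^bsub>K0 R\<^esub>"
proof -
  assume c: "c \<in> K0_rels R"
  then have "c \<in> K0r" by (rule generate.incl)
  then have "K0r #>\<^bsub>K0_free R\<^esub> c = K0r"
    using group.coset_join2[OF comm_group.axioms(2)[OF comm_group_K0_free] _ subgroup_K0r] c K0_rels_subset by blast
  then show ?thesis by (simp add: K0_proj_def K0_def FactGroup_def)
qed

lemma K0_class_projective: "P \<in> fg_modules R \<Longrightarrow> projective R P \<Longrightarrow> K0_class R P = \<one>\<^bsub>K0 R\<^esub>"
  unfolding K0_class_proj by (rule K0_proj_rel) (auto simp: K0_rels_def)

lemma K0_class_sum: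
  assumes fg: "M \<in> fg_modules R" "M' \<in> fg_modules R" "M'' \<in> fg_modules R"
    and iso: "mod_iso R M (direct_sum2 M' M'')"
  shows "K0_class R M = K0_class R M' \<otimes>\<^bsub>K0 R\<^esub> K0_class R M''"
proof -
  interpret F: comm_group "K0_free R" by (rule comm_group_K0_free)
  interpret K: comm_group "K0 R" by (rule comm_group_K0)
  interpret p: group_hom "K0_free R" "K0 R" K0_proj by (rule group_hom_K0_proj)
  let ?m = "frag_of (iso_class R M)" and ?m' = "frag_of (iso_class R M')" and ?m'' = "frag_of (iso_class R M'')"
  have rel: "?m - ?m' - ?m'' \<in> K0_rels R" unfolding K0_rels_def using fg iso by blast
  have c: "?m \<in> carrier (K0_free R)" "?m' \<in> carrier (K0_free R)" "?m'' \<in> carrier (K0_free R)"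
    using fg by (simp_all add: frag_in_K0_free)
  have "?m = ?m' \<otimes>\<^bsub>K0_free R\<^esub> ?m'' \<otimes>\<^bsub>K0_free R\<^esub> (?m - ?m' - ?m'')" by (simp add: K0_free_def)
  moreover have "?m - ?m' - ?m'' \<in> carrier (K0_free R)" using rel K0_rels_subset by blast
  ultimately have "K0_proj ?m = K0_proj ?m' \<otimes>\<^bsub>K0 R\<^esub> K0_proj ?m'' \<otimes>\<^bsub>K0 R\<^esub> K0_proj (?m - ?m' - ?m'')"
    using c by (metis F.m_closed p.hom_mult)
  then show ?thesis
    using c by (simp add: K0_class_proj K0_proj_rel[OF rel])
qed

text \<open>The free abelian group arises from its generators by repeated differences, so the case
  \<open>diff\<close> covers both sums and inverses.\<close>

lemma K0_induct [consumes 1, case_names one diff generator]: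
  assumes "x \<in> carrier (K0 R)" and "Q \<one>\<^bsub>K0 R\<^esub>"
    and "\<And>x y. x \<in> carrier (K0 R) \<Longrightarrow> y \<in> carrier (K0 R) \<Longrightarrow> Q x \<Longrightarrow> Q y \<Longrightarrow> Q (x \<otimes>\<^bsub>K0 R\<^esub> inv\<^bsub>K0 R\<^esub> y)"
    and "\<And>M. M \<in> fg_modules R \<Longrightarrow> Q (K0_class R M)"
  shows "Q x"
proof -
  interpret p: group_hom "K0_free R" "K0 R" K0_proj by (rule group_hom_K0_proj)
  obtain c where c: "x = K0_proj c" "c \<in> carrier (K0_free R)"
    using assms(1) unfolding K0_carrier by (rule imageE)
  have "Poly_Mapping.keys c \<subseteq> iso_class R ` fg_modules R" using c(2) by (simp add: carrier_K0_free)
  then have "Q (K0_proj c)"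
  proof (rule free_Abelian_group_induct[where P = "\<lambda>c. Q (K0_proj c)"])
    have "K0_proj 0 = \<one>\<^bsub>K0 R\<^esub>" using p.hom_one by (simp add: K0_free_def)
    then show "Q (K0_proj 0)" using assms(2) by simp
  next
    fix a b assume k: "Poly_Mapping.keys a \<subseteq> iso_class R ` fg_modules R"
      "Poly_Mapping.keys b \<subseteq> iso_class R ` fg_modules R" and Q: "Q (K0_proj a)" "Q (K0_proj b)"
    then have ab: "a \<in> carrier (K0_free R)" "b \<in> carrier (K0_free R)" by (simp_all add: carrier_K0_free)
    have "K0_proj (a - b) = K0_proj a \<otimes>\<^bsub>K0 R\<^esub> inv\<^bsub>K0 R\<^esub> K0_proj b"
      using ab by (simp add: K0_free_minus(2)[OF ab, symmetric])
    then show "Q (K0_proj (a - b))" using assms(3) Q ab by simp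
  next
    fix a assume "a \<in> iso_class R ` fg_modules R"
    then obtain M where "a = iso_class R M" "M \<in> fg_modules R" by (rule imageE)
    then show "Q (K0_proj (frag_of a))" using assms(4)[of M] by (simp add: K0_class_proj)
  qed
  then show ?thesis by (simp add: c(1))
qed

text \<open>The universal property of K_0. The invariants \<open>om\<close> and \<open>mu\<close>
  are turned into homomorphisms by means of it.\<close>

lemma K0_universal:
  assumes G: "comm_group G" and closed: "\<And>M. M \<in> fg_modules R \<Longrightarrow> \<psi> M \<in> carrier G"
    and iso: "\<And>M N. M \<in> fg_modules R \<Longrightarrow> N \<in> fg_modules R \<Longrightarrow> mod_iso R M N \<Longrightarrow> \<psi> M = \<psi> N"
    and sum: "\<And>M M' M''. M \<in> fg_modules R \<Longrightarrow> M' \<in> fg_modules R \<Longrightarrow> M'' \<in> fg_modules R \<Longrightarrow>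
      mod_iso R M (direct_sum2 M' M'') \<Longrightarrow> \<psi> M = \<psi> M' \<otimes>\<^bsub>G\<^esub> \<psi> M''"
    and proj: "\<And>P. P \<in> fg_modules R \<Longrightarrow> projective R P \<Longrightarrow> \<psi> P = \<one>\<^bsub>G\<^esub>"
  obtains h where "h \<in> hom (K0 R) G" and "\<And>M. M \<in> fg_modules R \<Longrightarrow> h (K0_class R M) = \<psi> M"
proof -
  interpret G: comm_group G by (rule G)
  interpret F: comm_group "K0_free R" by (rule comm_group_K0_free)
  \<comment> \<open>The free group is built on isomorphism classes, so \<open>\<psi>\<close> is
    evaluated at a chosen member; \<open>iso\<close> makes the choice irrelevant.\<close>
  define rep where "rep c = (SOME M. M \<in> fg_modules R \<and> iso_class R M = c)" for c
  have rep: "\<psi> (rep (iso_class R M)) = \<psi> M" if M: "M \<in> fg_modules R" for M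
  proof -
    have "rep (iso_class R M) \<in> fg_modules R \<and> iso_class R (rep (iso_class R M)) = iso_class R M"
      unfolding rep_def by (rule someI[of _ M]) (simp add: M)
    then show ?thesis using iso M iso_class_eqD[OF M] by metis
  qed
  have "(\<lambda>c. \<psi> (rep c)) ` (iso_class R ` fg_modules R) \<subseteq> carrier G" using rep closed by auto
  from G.free_Abelian_group_universal[OF this]
  obtain h where h: "h \<in> hom (K0_free R) G"
    and hf: "\<And>c. c \<in> iso_class R ` fg_modules R \<Longrightarrow> h (frag_of c) = \<psi> (rep c)"
    unfolding K0_free_def by metis
  have hM: "h (frag_of (iso_class R M)) = \<psi> M" if "M \<in> fg_modules R" for M
    using hf[of "iso_class R M"] rep[OF that] that by simp
  interpret h: group_hom "K0_free R" G h by unfold_locales (rule h)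
  have "K0_rels R \<subseteq> kernel (K0_free R) G h"
  proof
    fix c assume c: "c \<in> K0_rels R"
    then have cc: "c \<in> carrier (K0_free R)" using K0_rels_subset by blast
    from c consider M M' M'' where "M \<in> fg_modules R" "M' \<in> fg_modules R" "M'' \<in> fg_modules R"
        "mod_iso R M (direct_sum2 M' M'')"
        "c = frag_of (iso_class R M) - frag_of (iso_class R M') - frag_of (iso_class R M'')"
      | P where "P \<in> fg_modules R" "projective R P" "c = frag_of (iso_class R P)"
      unfolding K0_rels_def by blast
    then have "h c = \<one>\<^bsub>G\<^esub>"
    proof cases
      case 1
      note f = frag_in_K0_free[OF 1(1)] frag_in_K0_free[OF 1(2)] frag_in_K0_free[OF 1(3)]
      have "h c = (\<psi> M \<otimes>\<^bsub>G\<^esub> inv\<^bsub>G\<^esub> \<psi> M') \<otimes>\<^bsub>G\<^esub> inv\<^bsub>G\<^esub> \<psi> M''"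
        unfolding 1(5) using f K0_free_minus[OF f(1,2)] K0_free_minus[OF K0_free_minus(1)[OF f(1,2)] f(3)]
        by (metis 1(1-3) F.inv_closed h.hom_inv h.hom_mult hM)
      then show ?thesis
        using closed[OF 1(2)] closed[OF 1(3)] sum[OF 1(1-4)]
        by (simp add: G.m_ac G.r_inv)
    qed (simp add: hM proj)
    then show "c \<in> kernel (K0_free R) G h" using cc by (simp add: kernel_def)
  qed
  then have "K0r \<subseteq> kernel (K0_free R) G h" by (rule F.generate_subgroup_incl[OF _ h.subgroup_kernel])
  from h.FactGroup_universal_kernel[OF normal_K0r this]
  obtain g where "g \<in> hom (K0 R) G" "\<And>x. x \<in> carrier (K0_free R) \<Longrightarrow> g (K0_proj x) = h x"
    unfolding K0_def K0_proj_def by metis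
  then show thesis using that hM frag_in_K0_free by (simp add: K0_class_proj)
qed

lemma hom_K0_eqI:
  assumes G: "group G" and h: "h \<in> hom (K0 R) G" and h': "h' \<in> hom (K0 R) G"
    and eq: "\<And>M. M \<in> fg_modules R \<Longrightarrow> h (K0_class R M) = h' (K0_class R M)" and x: "x \<in> carrier (K0 R)"
  shows "h x = h' x"
proof -
  interpret K: comm_group "K0 R" by (rule comm_group_K0)
  interpret h: group_hom "K0 R" G h using G h by (simp add: group_hom_def group_hom_axioms_def K.is_group)
  interpret h': group_hom "K0 R" G h' using G h' by (simp add: group_hom_def group_hom_axioms_def K.is_group)
  from x show ?thesis
    by (induction rule: K0_induct) (simp_all add: eq)
qed

text \<open>The definition of \<^const>\<open>omega_bar\<close> is meaningful as soon as one endomorphism induced by the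
  syzygy is found.\<close>

lemma omega_bar_eq:
  assumes h: "h \<in> hom (K0 R) (K0 R)"
    and hM: "\<And>M. M \<in> fg_modules R \<Longrightarrow> h (K0_class R M) = K0_class R (syzygy R M)"
    and x: "x \<in> carrier (K0 R)"
  shows "omega_bar R x = h x"
proof -
  interpret K: comm_group "K0 R" by (rule comm_group_K0)
  let ?h = "restrict h (carrier (K0 R))"
  have rh: "?h \<in> hom (K0 R) (K0 R)" using h by (auto simp: hom_def)
  have "omega_bar R = ?h"
    unfolding omega_bar_def
  proof (rule the_equality)
    show "?h \<in> hom (K0 R) (K0 R) \<and> ?h \<in> extensional (carrier (K0 R)) \<and>
        (\<forall>M\<in>fg_modules R. ?h (K0_class R M) = K0_class R (syzygy R M))"
      using rh hM K0_class_closed by simp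
    fix g assume "g \<in> hom (K0 R) (K0 R) \<and> g \<in> extensional (carrier (K0 R)) \<and>
        (\<forall>M\<in>fg_modules R. g (K0_class R M) = K0_class R (syzygy R M))"
    then have g: "g \<in> hom (K0 R) (K0 R)" "g \<in> extensional (carrier (K0 R))"
      "\<And>M. M \<in> fg_modules R \<Longrightarrow> g (K0_class R M) = K0_class R (syzygy R M)" by simp_all
    have eq: "g (K0_class R M) = ?h (K0_class R M)" if "M \<in> fg_modules R" for M
      using g(3)[OF that] hM[OF that] K0_class_closed[OF that] by simp
    show "g = ?h"
      by (rule extensionalityI[OF g(2)]) (rule restrict_extensional, rule hom_K0_eqI[OF K.is_group g(1) rh eq])
  qed
  then show ?thesis using x by simp
qed

end

section \<open>Simple modules\<close>

context rad_sq_zero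
begin

text \<open>The simple module S_i on the carrier type of \<open>'r umodule\<close>: the scalar
  \<open>c\<close> is encoded as the singleton of the constant function with value
  \<open>sc c\<close>.\<close>

definition Sm :: "'v \<Rightarrow> 'r umodule" where
  "Sm i = \<lparr>carrier = range (\<lambda>c. {\<lambda>_. sc c}), monoid.mult = undefined, one = undefined,
     ring.zero = {\<lambda>_. \<zero>\<^bsub>R\<^esub>}, ring.add = (\<lambda>u v. {\<lambda>l. the_elem u l \<oplus>\<^bsub>R\<^esub> the_elem v l}),
     smult = (\<lambda>a u. {\<lambda>l. sc (vc a i) \<otimes>\<^bsub>R\<^esub> the_elem u l})\<rparr>"

lemma Sm_simps [simp]:
  "carrier (Sm i) = range (\<lambda>c. {\<lambda>_. sc c})" "\<zero>\<^bsub>Sm i\<^esub> = {\<lambda>_. \<zero>\<^bsub>R\<^esub>}"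
  "{\<lambda>_. sc c} \<oplus>\<^bsub>Sm i\<^esub> {\<lambda>_. sc d} = {\<lambda>_. sc (c + d)}" "a \<odot>\<^bsub>Sm i\<^esub> {\<lambda>_. sc c} = {\<lambda>_. sc (vc a i * c)}"
  by (simp_all add: Sm_def sc_add sc_mult)

lemma sc_eq_iff: "i \<in> V \<Longrightarrow> sc c = sc d \<longleftrightarrow> c = d"
  by (metis coord_simps(5))

lemma Sm_rangeI: "{\<lambda>_. sc c} \<in> range (\<lambda>c. {\<lambda>_. sc c})"
  by (rule rangeI)

context
  fixes i :: 'v
  assumes i: "i \<in> V"
begin

lemma right_module_Sm: "right_module R (Sm i)"
proof -
  have "abelian_group (Sm i)"
  proof (rule abelian_groupI)
    fix u assume "u \<in> carrier (Sm i)"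
    then obtain c where "u = {\<lambda>_. sc c}" by auto
    then show "\<exists>v\<in>carrier (Sm i). v \<oplus>\<^bsub>Sm i\<^esub> u = \<zero>\<^bsub>Sm i\<^esub>"
      by (intro bexI[of _ "{\<lambda>_. sc (- c)}"]) (auto simp: sc_0)
  next
    show "\<zero>\<^bsub>Sm i\<^esub> \<in> carrier (Sm i)" using Sm_rangeI[of 0] by (simp add: sc_0)
  next
    fix u assume "u \<in> carrier (Sm i)"
    then obtain c where "u = {\<lambda>_. sc c}" by auto
    then show "\<zero>\<^bsub>Sm i\<^esub> \<oplus>\<^bsub>Sm i\<^esub> u = u" using Sm_simps(3)[where c = 0 and d = c] by (simp add: sc_0 del: Sm_simps(3))
  qed (auto simp: ac_simps)
  then show ?thesis
    unfolding right_module_def right_module_axioms_def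
    by (auto simp: R.ring_axioms coords i algebra_simps)
qed

interpretation S: rsz_module R V E src trg vc ac "Sm i"
  by (rule rsz_moduleI[OF right_module_Sm])

lemma Sm_subspace_trivial:
  assumes "subspace (Sm i) H"
  shows "H = {\<zero>\<^bsub>Sm i\<^esub>} \<or> H = carrier (Sm i)"
proof (cases "H \<subseteq> {\<zero>\<^bsub>Sm i\<^esub>}")
  case True
  then show ?thesis using submodule_zero[OF assms] by (simp add: subset_singleton_iff) blast
next
  case False
  then obtain u where u: "u \<in> H" "u \<noteq> \<zero>\<^bsub>Sm i\<^esub>" by blast
  have Hc: "H \<subseteq> carrier (Sm i)" using submodule_subset[OF assms] by simp
  obtain c where c: "u = {\<lambda>_. sc c}" using u(1) Hc by auto
  have c0: "c \<noteq> 0" using u(2) c by (auto simp: sc_0)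
  have "{\<lambda>_. sc d} \<in> H" for d
    using submodule_smult[OF assms _ u(1), of "d / c"] c c0 i by simp
  then have "carrier (Sm i) \<subseteq> H" by auto
  then show ?thesis using Hc by blast
qed

lemma Sm_nonzero: "\<not> zero_module (Sm i)"
proof
  assume "zero_module (Sm i)"
  then have "{\<lambda>_::nat. sc 1} \<in> {{\<lambda>_. \<zero>\<^bsub>R\<^esub>}}"
    using Sm_rangeI[of 1] unfolding zero_module_def Sm_simps(1,2) by (rule subst[where P = "\<lambda>A. _ \<in> A"])
  then have "(\<lambda>_::nat. sc 1) = (\<lambda>_. sc 0)" by (simp add: sc_0)
  then have "sc 1 = sc 0" by (rule fun_cong)
  then show False using sc_eq_iff[OF i] by simp
qed

lemma simple_Sm: "simple_module R (Sm i)"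
  unfolding simple_module_def using Sm_nonzero Sm_subspace_trivial S.subspace_if_submodule by blast

lemma kdim_Sm: "kdim (Sm i) (carrier (Sm i)) = 1"
proof -
  have "simple_module kring (ks (Sm i))"
    unfolding simple_module_def using Sm_nonzero Sm_subspace_trivial by (simp add: zero_module_def)
  from S.K.mod_length_simple[OF this] show ?thesis
    by (simp add: kdim_def ks_def)
qed

lemma fin_dim_Sm: "fin_dim (Sm i)"
  unfolding fin_dim_def kdim_Sm by (simp add: one_enat_def)

lemma Sm_fg: "Sm i \<in> fg_modules R"
  by (simp add: fg_iff_fin_dim right_module_Sm fin_dim_Sm)

lemma comp_Sm: "j \<in> V \<Longrightarrow> comp (Sm i) j = (if j = i then carrier (Sm i) else {\<zero>\<^bsub>Sm i\<^esub>})"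
proof -
  assume j: "j \<in> V"
  have "idem j \<odot>\<^bsub>Sm i\<^esub> {\<lambda>_. sc c} = {\<lambda>_. sc c} \<longleftrightarrow> j = i \<or> c = 0" for c
    using i sc_eq_iff[OF i] by (auto simp: fun_eq_iff)
  then have "comp (Sm i) j = (\<lambda>c. {\<lambda>_. sc c}) ` {c. j = i \<or> c = 0}"
    unfolding comp_def Sm_simps(1) by blast
  then show ?thesis by (auto simp: sc_0)
qed

lemma semisimple_Sm: "semisimple (Sm i)"
  unfolding semisimple_def using i by (auto simp: sc_0)

lemma dm_comp_Sm: "j \<in> V \<Longrightarrow> dm (Sm i) (comp (Sm i) j) = (if j = i then 1 else 0)"
  using S.dm_0_iff[OF fin_dim_Sm S.subspace_if_submodule[OF S.submodule_0]]
  by (simp add: comp_Sm del: Sm_simps(1)) (simp add: dm_def kdim_Sm one_enat_def del: Sm_simps(1))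


text \<open>The line spanned by \<open>x\<close> is a copy of S_i: every other idempotent and all
  arrows kill \<open>x\<close>, so \<open>r\<close> acts on it by the scalar \<open>vc r i\<close>.
  The argument 0 in \<open>the_elem u 0\<close> is arbitrary, as the functions encoding scalars are
  constant.\<close>

lemma Sm_embed:
  fixes M :: "('r, 'm) module"
  assumes M: "right_module R M" and x: "x \<in> comp M i" "x \<noteq> \<zero>\<^bsub>M\<^esub>"
    and kill: "\<And>\<alpha>. \<alpha> \<in> E \<Longrightarrow> arr \<alpha> \<odot>\<^bsub>M\<^esub> x = \<zero>\<^bsub>M\<^esub>"
  shows "(\<lambda>u. the_elem u 0 \<odot>\<^bsub>M\<^esub> x) \<in> mod_hom R (Sm i) M"
    and "inj_on (\<lambda>u. the_elem u 0 \<odot>\<^bsub>M\<^esub> x) (carrier (Sm i))"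
proof -
  interpret rsz_module R V E src trg vc ac M by (rule rsz_moduleI[OF M])
  have xM: "x \<in> carrier M" and xi: "idem i \<odot>\<^bsub>M\<^esub> x = x" using x(1) by (simp_all add: comp_def)
  have act: "r \<odot>\<^bsub>M\<^esub> x = sc (vc r i) \<odot>\<^bsub>M\<^esub> x" if r: "r \<in> carrier R" for r
  proof -
    have 1: "finsum M (\<lambda>\<alpha>. sc (ac r \<alpha>) \<odot>\<^bsub>M\<^esub> (arr \<alpha> \<odot>\<^bsub>M\<^esub> x)) E = \<zero>\<^bsub>M\<^esub>"
      by (rule M.add.finprod_one_eqI) (simp add: kill)
    have "finsum M (\<lambda>j. sc (vc r j) \<odot>\<^bsub>M\<^esub> (idem j \<odot>\<^bsub>M\<^esub> x)) V
        = finsum M (\<lambda>j. if i = j then sc (vc r i) \<odot>\<^bsub>M\<^esub> x else \<zero>\<^bsub>M\<^esub>) V"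
    proof (rule M.finsum_cong')
      fix j assume "j \<in> V"
      have "idem j \<odot>\<^bsub>M\<^esub> x = (if j = i then x else \<zero>\<^bsub>M\<^esub>)"
        using act_idem_idem[OF xM, of j i] xi by (cases "j = i") auto
      then show "sc (vc r j) \<odot>\<^bsub>M\<^esub> (idem j \<odot>\<^bsub>M\<^esub> x) = (if i = j then sc (vc r i) \<odot>\<^bsub>M\<^esub> x else \<zero>\<^bsub>M\<^esub>)"
        by auto
    qed (use xM in \<open>auto simp: smult_closed\<close>)
    also have "\<dots> = sc (vc r i) \<odot>\<^bsub>M\<^esub> x"
      by (rule M.add.finprod_singleton) (use i finite_V xM in \<open>auto simp: smult_closed\<close>)
    finally show ?thesis using act_expand[OF r xM] 1 xM by (simp add: smult_closed)
  qed
  show "(\<lambda>u. the_elem u 0 \<odot>\<^bsub>M\<^esub> x) \<in> mod_hom R (Sm i) M"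
  proof (rule mod_homI)
    fix u assume "u \<in> carrier (Sm i)"
    then obtain c where c: "u = {\<lambda>_. sc c}" by auto
    show "the_elem u 0 \<odot>\<^bsub>M\<^esub> x \<in> carrier M" using c xM by (simp add: smult_closed)
    show "the_elem (a \<odot>\<^bsub>Sm i\<^esub> u) 0 \<odot>\<^bsub>M\<^esub> x = a \<odot>\<^bsub>M\<^esub> (the_elem u 0 \<odot>\<^bsub>M\<^esub> x)" if a: "a \<in> carrier R" for a
    proof -
      have "a \<odot>\<^bsub>M\<^esub> (sc c \<odot>\<^bsub>M\<^esub> x) = sc c \<odot>\<^bsub>M\<^esub> (a \<odot>\<^bsub>M\<^esub> x)" by (rule smult_commute[OF a xM])
      also have "\<dots> = sc c \<odot>\<^bsub>M\<^esub> (sc (vc a i) \<odot>\<^bsub>M\<^esub> x)" by (simp only: act[OF a])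
      also have "\<dots> = sc (vc a i * c) \<odot>\<^bsub>M\<^esub> x" by (simp add: act_sc[OF xM] mult.commute)
      finally show ?thesis by (simp add: c)
    qed
    fix v assume "v \<in> carrier (Sm i)"
    then obtain d where "v = {\<lambda>_. sc d}" by auto
    then show "the_elem (u \<oplus>\<^bsub>Sm i\<^esub> v) 0 \<odot>\<^bsub>M\<^esub> x = the_elem u 0 \<odot>\<^bsub>M\<^esub> x \<oplus>\<^bsub>M\<^esub> the_elem v 0 \<odot>\<^bsub>M\<^esub> x"
      using c xM by (simp add: sc_add smult_add_scalar)
  qed
  show "inj_on (\<lambda>u. the_elem u 0 \<odot>\<^bsub>M\<^esub> x) (carrier (Sm i))"
  proof (rule inj_onI)
    fix u v assume uv: "u \<in> carrier (Sm i)" "v \<in> carrier (Sm i)"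
      and eq: "the_elem u 0 \<odot>\<^bsub>M\<^esub> x = the_elem v 0 \<odot>\<^bsub>M\<^esub> x"
    obtain c d where cd: "u = {\<lambda>_. sc c}" "v = {\<lambda>_. sc d}" using uv by auto
    have "sc (c - d) \<odot>\<^bsub>M\<^esub> x \<oplus>\<^bsub>M\<^esub> sc d \<odot>\<^bsub>M\<^esub> x = sc c \<odot>\<^bsub>M\<^esub> x"
      using xM by (simp add: smult_add_scalar[symmetric] sc_add[symmetric])
    also have "\<dots> = sc d \<odot>\<^bsub>M\<^esub> x" using eq cd by simp
    finally have z: "sc (c - d) \<odot>\<^bsub>M\<^esub> x = \<zero>\<^bsub>M\<^esub>" using xM by (simp add: smult_closed)
    have "c = d"
    proof (rule ccontr)
      assume "c \<noteq> d"
      then have "x = sc (1 / (c - d)) \<odot>\<^bsub>M\<^esub> (sc (c - d) \<odot>\<^bsub>M\<^esub> x)"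
        using xM by (simp add: act_sc sc_1 smult_one)
      then show False using z x(2) by simp
    qed
    then show "u = v" using cd by simp
  qed
qed

end

text \<open>By Nakayama's lemma a simple module has radical 0, so any nonzero component y e_i spans
  a copy of S_i, which is everything.\<close>

lemma simple_iso_Sm:
  fixes M :: "('r, 'm) module"
  assumes M: "right_module R M" and simple: "simple_module R M"
  obtains i where "i \<in> V" and "mod_iso R (Sm i) M"
proof -
  interpret rsz_module R V E src trg vc ac M by (rule rsz_moduleI[OF M])
  have nz: "carrier M \<noteq> {\<zero>\<^bsub>M\<^esub>}" using simple by (simp add: simple_module_def zero_module_def)
  have "rad M = {\<zero>\<^bsub>M\<^esub>}"
    using simple submodule_rad zero_if_all_rad nz unfolding simple_module_def by blast
  then have kill: "\<And>\<alpha> x. \<alpha> \<in> E \<Longrightarrow> x \<in> carrier M \<Longrightarrow> arr \<alpha> \<odot>\<^bsub>M\<^esub> x = \<zero>\<^bsub>M\<^esub>"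
    using rad_0_iff by blast
  obtain y where y: "y \<in> carrier M" "y \<noteq> \<zero>\<^bsub>M\<^esub>" using nz M.zero_closed by blast
  have "\<exists>i\<in>V. idem i \<odot>\<^bsub>M\<^esub> y \<noteq> \<zero>\<^bsub>M\<^esub>"
  proof (rule ccontr)
    assume "\<not> ?thesis"
    then have "finsum M (\<lambda>i. idem i \<odot>\<^bsub>M\<^esub> y) V = \<zero>\<^bsub>M\<^esub>" by (intro M.add.finprod_one_eqI) auto
    then show False using sum_idem_act[OF y(1)] y(2) by simp
  qed
  then obtain i where i: "i \<in> V" "idem i \<odot>\<^bsub>M\<^esub> y \<noteq> \<zero>\<^bsub>M\<^esub>" by blast
  let ?x = "idem i \<odot>\<^bsub>M\<^esub> y"
  have x: "?x \<in> comp M i" "?x \<in> carrier M" using idem_act_comp[OF y(1)] y(1) by (simp_all add: smult_closed)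
  note e = Sm_embed[OF i(1) M x(1) i(2) kill[OF _ x(2)]]
  interpret S: right_module R "Sm i" by (rule right_module_Sm[OF i(1)])
  interpret e: right_module_hom R "Sm i" M "\<lambda>u. the_elem u 0 \<odot>\<^bsub>M\<^esub> ?x"
    by unfold_locales (rule e(1))
  let ?I = "(\<lambda>u. the_elem u 0 \<odot>\<^bsub>M\<^esub> ?x) ` carrier (Sm i)"
  have "submodule ?I R M" by (rule e.submodule_image[OF S.submodule_carrier])
  moreover have "?x \<in> ?I"
    using Sm_rangeI[of 1] x(2) by (intro image_eqI[of _ _ "{\<lambda>_. sc 1}"]) (simp_all add: sc_1 smult_one)
  ultimately have "?I = carrier M" using simple i(2) unfolding simple_module_def by blast
  then have "mod_iso R (Sm i) M"
    unfolding mod_iso_def using e by (intro bexI[OF _ e(1)]) (simp only: bij_betw_def simp_thms)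
  then show thesis using that i(1) by blast
qed

text \<open>A submodule of maximal dimension avoiding \<open>x\<close> is a complement of the line through \<open>x\<close>.\<close>

lemma semisimple_split:
  fixes N :: "'r umodule"
  assumes N: "N \<in> fg_modules R" and ss: "semisimple N" and i: "i \<in> V"
    and x: "x \<in> comp N i" "x \<noteq> \<zero>\<^bsub>N\<^esub>"
  obtains H where "submodule H R N" and "mod_iso R (direct_sum2 (Sm i) (N\<lparr>carrier := H\<rparr>)) N"
proof -
  have rN: "right_module R N" and fd: "fin_dim N" using N by (simp_all add: fg_iff_fin_dim)
  interpret rsz_module R V E src trg vc ac N by (rule rsz_moduleI[OF rN])
  have kill: "\<And>\<alpha> y. \<alpha> \<in> E \<Longrightarrow> y \<in> carrier N \<Longrightarrow> arr \<alpha> \<odot>\<^bsub>N\<^esub> y = \<zero>\<^bsub>N\<^esub>"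
    using ss by (simp add: semisimple_def)
  have xN: "x \<in> carrier N" using x(1) by (simp add: comp_def)
  let ?Q = "\<lambda>H. submodule H R N \<and> x \<notin> H"
  have b: "nat (dm N H) < Suc (nat (dm N (carrier N)))" if "?Q H" for H
    using dm_mono[OF fd subspace_if_submodule subspace_if_submodule[OF submodule_carrier]]
      that submodule_subset[of H R N] by (simp add: less_Suc_eq_le nat_mono)
  have "?Q {\<zero>\<^bsub>N\<^esub>}" using submodule_0 x(2) by simp
  then obtain H where H: "?Q H" "\<And>H'. ?Q H' \<Longrightarrow> nat (dm N H') \<le> nat (dm N H)"
    using ex_has_greatest_nat[of ?Q _ "\<lambda>H. nat (dm N H)"] b by metis
  note e = Sm_embed[OF i rN x kill[OF _ xN]]
  interpret S: right_module R "Sm i" by (rule right_module_Sm[OF i])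
  let ?e = "\<lambda>u. the_elem u 0 \<odot>\<^bsub>N\<^esub> x"
  interpret e: right_module_hom R "Sm i" N ?e by unfold_locales (rule e(1))
  have rH: "right_module R (N\<lparr>carrier := H\<rparr>)" by (rule right_module_submodule) (use H in blast)
  have HN: "H \<subseteq> carrier N" using H(1) submodule_subset by blast
  have sH: "submodule H R N" and xH: "x \<notin> H" using H(1) by blast+
  have line: "submodule (?e ` carrier (Sm i)) R N" by (rule e.submodule_image[OF S.submodule_carrier])
  have lineH: "c = 0" if "sc c \<odot>\<^bsub>N\<^esub> x \<in> H" for c
  proof (rule ccontr)
    assume "c \<noteq> 0"
    then have "sc (1 / c) \<odot>\<^bsub>N\<^esub> (sc c \<odot>\<^bsub>N\<^esub> x) = x" using xN by (simp add: act_sc sc_1 smult_one)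
    then show False using submodule_smult[OF sH sc_closed that, of "1 / c"] xH by simp
  qed
  let ?f = "\<lambda>w. ?e (fst w) \<oplus>\<^bsub>N\<^esub> snd w"
  let ?D = "direct_sum2 (Sm i) (N\<lparr>carrier := H\<rparr>)"
  note rD = right_module_direct_sum2[OF S.right_module_axioms rH]
  have f: "?f \<in> mod_hom R ?D N"
  proof (rule mod_homI)
    fix w assume "w \<in> carrier ?D"
    then have w: "fst w \<in> carrier (Sm i)" "snd w \<in> carrier N" using HN by (auto simp: direct_sum2_def)
    note ew = e.closed[OF w(1)]
    show "?f w \<in> carrier N" using ew w by simp
    show "?f (a \<odot>\<^bsub>?D\<^esub> w) = a \<odot>\<^bsub>N\<^esub> ?f w" if a: "a \<in> carrier R" for a
      using e.smult[OF a w(1)] ew w a by (cases w) (simp add: direct_sum2_def smult_add del: Sm_simps)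
    fix v assume "v \<in> carrier ?D"
    then have v: "fst v \<in> carrier (Sm i)" "snd v \<in> carrier N" using HN by (auto simp: direct_sum2_def)
    note ev = e.closed[OF v(1)]
    show "?f (w \<oplus>\<^bsub>?D\<^esub> v) = ?f w \<oplus>\<^bsub>N\<^esub> ?f v"
      using e.add[OF w(1) v(1)] ew ev w v
      by (cases w; cases v) (simp add: direct_sum2_def M.a_ac del: Sm_simps)
  qed
  interpret D: right_module R ?D by (rule rD)
  interpret f: right_module_hom R ?D N ?f by unfold_locales (rule f)
  have "mod_kernel ?D N ?f \<subseteq> {\<zero>\<^bsub>?D\<^esub>}"
  proof
    fix w assume "w \<in> mod_kernel ?D N ?f"
    then obtain c h where w: "w = ({\<lambda>_. sc c}, h)" "h \<in> H" "sc c \<odot>\<^bsub>N\<^esub> x \<oplus>\<^bsub>N\<^esub> h = \<zero>\<^bsub>N\<^esub>"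
      by (auto simp: mod_kernel_def direct_sum2_def)
    then have "sc c \<odot>\<^bsub>N\<^esub> x = \<ominus>\<^bsub>N\<^esub> h"
      using HN xN by (intro M.minus_equality[symmetric]) (auto simp: smult_closed)
    then have "c = 0" using lineH submodule_neg[OF sH w(2)] by simp
    moreover have "h = \<zero>\<^bsub>N\<^esub>" using w(2,3) HN xN \<open>c = 0\<close> by (simp add: sc_0 subsetD)
    ultimately show "w \<in> {\<zero>\<^bsub>?D\<^esub>}" using w(1) by (simp add: direct_sum2_def sc_0)
  qed
  then have "mod_kernel ?D N ?f = {\<zero>\<^bsub>?D\<^esub>}" using submodule_zero[OF f.submodule_kernel] by (simp add: subset_singleton_iff) blast
  then have inj: "inj_on ?f (carrier ?D)" using f.inj_on_iff_kernel by simp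
  have im: "submodule (?f ` carrier ?D) R N" by (rule f.submodule_image[OF D.submodule_carrier])
  have Him: "H \<subseteq> ?f ` carrier ?D"
  proof
    fix h assume h: "h \<in> H"
    then show "h \<in> ?f ` carrier ?D"
      using HN xN Sm_rangeI[of 0] by (intro image_eqI[of _ _ "({\<lambda>_. sc 0}, h)"]) (auto simp: direct_sum2_def sc_0)
  qed
  have xim: "x \<in> ?f ` carrier ?D"
    using xN Sm_rangeI[of 1] submodule_zero[OF sH]
    by (intro image_eqI[of _ _ "({\<lambda>_. sc 1}, \<zero>\<^bsub>N\<^esub>)"]) (auto simp: direct_sum2_def sc_1 smult_one)
  \<comment> \<open>A homogeneous \<open>y\<close> outside the image would allow \<open>H\<close> to
    be enlarged by the line through \<open>y\<close> without capturing \<open>x\<close>, against the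
    maximality of \<open>H\<close>.\<close>
  have homog: "y \<in> ?f ` carrier ?D" if j: "j \<in> V" and y: "y \<in> comp N j" for y j
  proof (rule ccontr)
    assume ny: "y \<notin> ?f ` carrier ?D"
    have yN: "y \<in> carrier N" and "y \<noteq> \<zero>\<^bsub>N\<^esub>" using y ny submodule_zero[OF im] by (auto simp: comp_def)
    note g = Sm_embed[OF j rN y \<open>y \<noteq> \<zero>\<^bsub>N\<^esub>\<close> kill[OF _ yN]]
    let ?g = "\<lambda>u. the_elem u 0 \<odot>\<^bsub>N\<^esub> y"
    interpret g: right_module_hom R "Sm j" N ?g by (rule right_module_homI[OF right_module_Sm[OF j] rN g(1)])
    have gl: "submodule (?g ` carrier (Sm j)) R N" by (rule g.submodule_image[OF g.M.submodule_carrier])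
    let ?H = "H <+>\<^bsub>N\<^esub> ?g ` carrier (Sm j)"
    have sH': "submodule ?H R N" by (rule submodule_sum[OF sH gl])
    have "y \<in> ?g ` carrier (Sm j)"
      using yN Sm_rangeI[of 1] by (intro image_eqI[of _ _ "{\<lambda>_. sc 1}"]) (simp_all add: sc_1 smult_one)
    then have yH: "y \<in> ?H" using subset_sum_right[OF sH gl] by blast
    have HH: "H \<subseteq> ?H" by (rule subset_sum_left[OF sH gl])
    have "x \<notin> ?H"
    proof
      assume "x \<in> ?H"
      then obtain h c where hc: "h \<in> H" "x = h \<oplus>\<^bsub>N\<^esub> sc c \<odot>\<^bsub>N\<^esub> y" by (auto simp: set_add_def')
      have c0: "c \<noteq> 0" using hc xH HN yN by (auto simp: sc_0 subsetD)
      have hN: "h \<in> carrier N" using hc(1) HN by blast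
      have "\<ominus>\<^bsub>N\<^esub> h \<oplus>\<^bsub>N\<^esub> x = sc c \<odot>\<^bsub>N\<^esub> y" unfolding hc(2) using hN yN by (simp add: M.a_assoc[symmetric] M.l_neg smult_closed)
      moreover have "\<ominus>\<^bsub>N\<^esub> h \<oplus>\<^bsub>N\<^esub> x \<in> ?f ` carrier ?D"
        using submodule_add[OF im _ xim] Him submodule_neg[OF sH hc(1)] by blast
      ultimately have "sc c \<odot>\<^bsub>N\<^esub> y \<in> ?f ` carrier ?D" by simp
      then have "sc (1 / c) \<odot>\<^bsub>N\<^esub> (sc c \<odot>\<^bsub>N\<^esub> y) \<in> ?f ` carrier ?D" by (rule submodule_smult[OF im sc_closed])
      moreover have "sc (1 / c) \<odot>\<^bsub>N\<^esub> (sc c \<odot>\<^bsub>N\<^esub> y) = y" using yN c0 by (simp add: act_sc sc_1 smult_one)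
      ultimately show False using ny by simp
    qed
    then have "nat (dm N ?H) \<le> nat (dm N H)" using H(2) sH' by blast
    moreover have "H \<subset> ?H" using HH yH ny Him by blast
    then have "dm N H < dm N ?H"
      by (intro dm_strict_mono[OF fd] subspace_if_submodule sH sH')
    ultimately show False using dm_nonneg[of H] by simp
  qed
  have "carrier N \<subseteq> ?f ` carrier ?D"
  proof
    fix y assume y: "y \<in> carrier N"
    have "finsum N (\<lambda>j. idem j \<odot>\<^bsub>N\<^esub> y) V \<in> ?f ` carrier ?D"
      using homog idem_act_comp[OF y] by (intro subspace_finsum[OF subspace_if_submodule[OF im] finite_V]) blast
    then show "y \<in> ?f ` carrier ?D" using sum_idem_act[OF y] by simp
  qed
  then have "?f ` carrier ?D = carrier N" using submodule_subset[OF im] by blast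
  then have "mod_iso R ?D N"
    unfolding mod_iso_def using inj by (intro bexI[OF _ f]) (simp only: bij_betw_def simp_thms)
  then show thesis using that sH by blast
qed

end

section \<open>Nilpotent matrices\<close>

text \<open>Row vectors times the matrix, because the coefficient of S_j in the syzygy is the sum of
  the v_i a_ij. Values outside \<open>D\<close> are reset to 0, so all powers from the first on take
  values in the functions supported on \<open>D\<close>.\<close>

definition mat_act :: "'v set \<Rightarrow> ('v \<Rightarrow> 'v \<Rightarrow> 'k::comm_ring_1) \<Rightarrow> ('v \<Rightarrow> 'k) \<Rightarrow> 'v \<Rightarrow> 'k" where
  "mat_act D a v = (\<lambda>j. if j \<in> D then \<Sum>i\<in>D. v i * a i j else 0)"

lemma mat_act_supp: "\<forall>j. j \<notin> D \<longrightarrow> mat_act D a v j = 0"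
  by (simp add: mat_act_def)

lemma mat_act_pow_supp: "\<forall>j. j \<notin> D \<longrightarrow> v j = 0 \<Longrightarrow> \<forall>j. j \<notin> D \<longrightarrow> (mat_act D a ^^ m) v j = 0"
  by (cases m) (simp_all add: mat_act_supp)

lemma mat_act_pow_diff:
  fixes a :: "'v \<Rightarrow> 'v \<Rightarrow> 'k::comm_ring_1"
  shows "(mat_act D a ^^ m) (\<lambda>j. u j - v j) = (\<lambda>j. (mat_act D a ^^ m) u j - (mat_act D a ^^ m) v j)"
  by (induction m) (auto simp: mat_act_def fun_eq_iff left_diff_distrib sum_subtractf)

text \<open>Passage from integer vectors to a field, where dimensions are available; it is used with
  the rationals.\<close>

lemma mat_act_pow_of_int:
  "(mat_act D (\<lambda>i j. of_int (a i j)) ^^ m) (\<lambda>j. of_int (v j)) =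
    (\<lambda>j. (of_int ((mat_act D a ^^ m) v j) :: 'k::comm_ring_1))"
  by (induction m) (auto simp: mat_act_def fun_eq_iff)

text \<open>The kernels of the powers of an operator on a space of dimension \<open>d\<close> grow strictly until they
  stabilise. If they still grow in the \<open>d\<close>-th step, then they have filled the whole space.\<close>

lemma nilpotent_if_kernel_grows:
  fixes a :: "'v \<Rightarrow> 'v \<Rightarrow> int"
  assumes D: "finite D" and d: "card D = Suc d"
    and u: "\<forall>j. j \<notin> D \<longrightarrow> u j = 0" "(mat_act D a ^^ Suc d) u = (\<lambda>_. 0)" "(mat_act D a ^^ d) u \<noteq> (\<lambda>_. 0)"
    and w: "\<forall>j. j \<notin> D \<longrightarrow> w j = 0"
  shows "(mat_act D a ^^ Suc d) w = (\<lambda>_. 0)"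
proof -
  define T :: "('v \<Rightarrow> rat) \<Rightarrow> 'v \<Rightarrow> rat" where "T = mat_act D (\<lambda>i j. of_int (a i j))"
  let ?F = "fun_space D :: (rat, 'v \<Rightarrow> rat) module"
  interpret F: right_module kring ?F by (rule right_module_fun_space)
  have T0: "T (\<lambda>_. 0) = (\<lambda>_. 0)" by (simp add: T_def mat_act_def fun_eq_iff)
  have Tadd: "(T ^^ m) (\<lambda>s. f s + g s) = (\<lambda>s. (T ^^ m) f s + (T ^^ m) g s)" for m f g
    by (induction m) (auto simp: T_def mat_act_def fun_eq_iff distrib_right sum.distrib)
  have Tsc: "(T ^^ m) (\<lambda>s. c * f s) = (\<lambda>s. c * (T ^^ m) f s)" for m f c
    by (induction m) (auto simp: T_def mat_act_def fun_eq_iff sum_distrib_left mult_ac)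
  have Tz: "(T ^^ m) (\<lambda>_. 0) = (\<lambda>_. 0)" for m by (induction m) (simp_all add: T0)
  define K where "K m = {f \<in> carrier ?F. (T ^^ m) f = (\<lambda>_. 0)}" for m
  have subK: "submodule (K m) kring ?F" for m
    unfolding K_def by (rule F.submoduleI) (auto simp: fun_space_def Tadd Tsc Tz)
  have monoK: "K m \<subseteq> K m'" if "m \<le> m'" for m m'
  proof
    fix f assume f: "f \<in> K m"
    have "(T ^^ m') f = (T ^^ (m' - m)) ((T ^^ m) f)"
      using that by (metis le_add_diff_inverse2 funpow_add o_apply)
    then show "f \<in> K m'" using f by (simp add: K_def Tz)
  qed
  define x :: "'v \<Rightarrow> rat" where "x = (\<lambda>j. of_int (u j))"
  have xF: "(T ^^ m) x \<in> carrier ?F" for m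
    unfolding x_def T_def using mat_act_pow_supp[where D = D and v = "\<lambda>j. of_int (u j)" and a = "\<lambda>i j. of_int (a i j)" and m = m] u(1)
    by (simp add: fun_space_def)
  have x1: "(T ^^ Suc d) x = (\<lambda>_. 0)"
    using u(2) by (simp only: x_def T_def mat_act_pow_of_int) simp
  have x2: "(T ^^ d) x \<noteq> (\<lambda>_. 0)"
    using u(3) by (simp only: x_def T_def mat_act_pow_of_int) (simp add: fun_eq_iff)
  \<comment> \<open>\<open>x\<close> is killed by T^(d+1) but not by T^d, so T^(d-m) x lies in the
    kernel of T^(m+1) and not in that of T^m.\<close>
  have strict: "K m \<noteq> K (Suc m)" if "m \<le> d" for m
  proof -
    let ?y = "(T ^^ (d - m)) x"
    have "(T ^^ Suc m) ?y = (T ^^ (Suc m + (d - m))) x" by (simp only: funpow_add o_apply)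
    then have "?y \<in> K (Suc m)" using that x1 xF by (simp add: K_def)
    moreover have "(T ^^ m) ?y = (T ^^ (m + (d - m))) x" by (simp only: funpow_add o_apply)
    then have "?y \<notin> K m" using that x2 by (simp add: K_def)
    ultimately show ?thesis by blast
  qed
  have injK: "inj_on K {..Suc d}"
  proof -
    have "K m \<noteq> K m'" if "m < m'" "m' \<le> Suc d" for m m'
      using strict[of m] monoK[of m "Suc m"] monoK[of "Suc m" m'] that by auto
    then show ?thesis by (intro inj_onI) (metis atMost_iff linorder_neqE_nat)
  qed
  have "carrier ?F \<subseteq> K (Suc d)"
  proof (rule ccontr)
    assume n: "\<not> carrier ?F \<subseteq> K (Suc d)"
    \<comment> \<open>The nonzero kernels of T, ..., T^(d+1) together with the whole space would
      form a chain with d+2 members, while the dimension is d+1.\<close>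
    let ?C = "insert (carrier ?F) (K ` {1..Suc d})"
    have sub: "L \<subseteq> K (Suc d)" if "L \<in> K ` {1..Suc d}" for L
    proof -
      from that obtain m where "L = K m" "m \<le> Suc d" by auto
      then show ?thesis using monoK by simp
    qed
    have notin: "carrier ?F \<notin> K ` {1..Suc d}" using sub n by blast
    have K0: "K 0 = {\<zero>\<^bsub>?F\<^esub>}" by (auto simp: K_def fun_space_def)
    have "submodule_chain kring ?F ?C"
      unfolding submodule_chain_def
    proof (intro conjI ballI)
      show "finite ?C" by simp
      fix L assume L: "L \<in> ?C"
      show "submodule L kring ?F" using L subK F.submodule_carrier by auto
      have nz: "K m \<noteq> {\<zero>\<^bsub>?F\<^esub>}" if "m \<in> {1..Suc d}" for m
        using inj_onD[OF injK, of 0 m] that K0 by auto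
      have "carrier ?F \<noteq> {\<zero>\<^bsub>?F\<^esub>}" using n submodule_zero[OF subK[of "Suc d"]]
        by (metis empty_subsetI insert_subset)
      then show "L \<noteq> {\<zero>\<^bsub>?F\<^esub>}" using L nz by blast
      fix L' assume L': "L' \<in> ?C"
      have KF: "K m \<subseteq> carrier ?F" for m by (rule submodule_subset[OF subK])
      have KK: "K m \<subseteq> K m' \<or> K m' \<subseteq> K m" for m m' using monoK by (meson nle_le)
      from L L' show "L \<subseteq> L' \<or> L' \<subseteq> L" using KF KK by fastforce
    qed
    then have "enat (card ?C) \<le> mod_length kring ?F" by (rule card_le_mod_length)
    moreover have "card (K ` {1..Suc d}) = Suc d"
      using card_image[OF inj_on_subset[OF injK, of "{1..Suc d}"]] by auto
    ultimately show False using notin by (simp add: mod_length_fun_space[OF D] d)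
  qed
  moreover have "(\<lambda>j. of_int (w j)) \<in> carrier ?F" using w by (simp add: fun_space_def)
  ultimately have "(T ^^ Suc d) (\<lambda>j. of_int (w j)) = (\<lambda>_. 0)" by (auto simp: K_def)
  then have "(\<lambda>j. (of_int ((mat_act D a ^^ Suc d) w j) :: rat)) = (\<lambda>_. 0)"
    by (simp only: T_def mat_act_pow_of_int)
  then show ?thesis by (simp only: fun_eq_iff of_int_eq_0_iff) simp
qed

section \<open>The operator \<open>\<Omega>\<close> on \<open>K\<^sub>0\<close>\<close>

text \<open>The target of the invariants on K_0. It carries no support condition; vanishing outside
  the interior vertices is a property of the individual vectors.\<close>

definition vec_group :: "('v \<Rightarrow> int) monoid" where
  "vec_group = \<lparr>carrier = UNIV, monoid.mult = (\<lambda>f g j. f j + g j), one = (\<lambda>_. 0)\<rparr>"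

lemma vec_group_simps [simp]:
  "carrier vec_group = UNIV" "f \<otimes>\<^bsub>vec_group\<^esub> g = (\<lambda>j. f j + g j)" "\<one>\<^bsub>vec_group\<^esub> = (\<lambda>_. 0)"
  by (simp_all add: vec_group_def)

lemma comm_group_vec_group: "comm_group vec_group"
proof (rule comm_groupI)
  fix f :: "'v \<Rightarrow> int"
  show "\<exists>g\<in>carrier vec_group. g \<otimes>\<^bsub>vec_group\<^esub> f = \<one>\<^bsub>vec_group\<^esub>"
    by (intro bexI[of _ "\<lambda>j. - f j"]) auto
qed (auto simp: algebra_simps)

lemmas group_vec_group = comm_group.axioms(2)[OF comm_group_vec_group]

lemma vec_group_inv: "inv\<^bsub>vec_group\<^esub> f = (\<lambda>j. - f j)"
  by (rule group.inv_equality[OF comm_group.axioms(2)[OF comm_group_vec_group]]) auto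

lemma hom_vec_pow:
  assumes G: "comm_group G" and h: "h \<in> hom G vec_group" and x: "x \<in> carrier G"
  shows "h (x [^]\<^bsub>G\<^esub> (n::int)) = (\<lambda>j. n * h x j)"
proof -
  interpret G: comm_group G by (rule G)
  interpret h: group_hom G vec_group h
    using h group_vec_group by (simp add: group_hom_def group_hom_axioms_def G.is_group)
  have nat: "h (x [^]\<^bsub>G\<^esub> (k::nat)) = (\<lambda>j. int k * h x j)" for k
    using x by (induction k) (auto simp: h.hom_one algebra_simps)
  show ?thesis
  proof (cases "n \<ge> 0")
    case True
    then obtain k where "n = int k" using nonneg_int_cases by blast
    then show ?thesis using nat by (simp add: int_pow_int)
  next
    case False
    then obtain k where "n = - int k" using nonpos_int_cases[of n] by auto
    then show ?thesis using nat x by (simp add: G.int_pow_neg int_pow_int vec_group_inv)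
  qed
qed

lemma hom_vec_finprod:
  assumes G: "comm_group G" and h: "h \<in> hom G vec_group" and "finite I" and "f \<in> I \<rightarrow> carrier G"
  shows "h (finprod G f I) = (\<lambda>j. \<Sum>i\<in>I. h (f i) j)"
proof -
  interpret G: comm_group G by (rule G)
  interpret h: group_hom G vec_group h
    using h group_vec_group by (simp add: group_hom_def group_hom_axioms_def G.is_group)
  show ?thesis using assms(3,4)
  proof (induction I rule: finite_induct)
    case empty
    then show ?case using h.hom_one by simp
  next
    case (insert i I)
    have "finprod G f (insert i I) = f i \<otimes>\<^bsub>G\<^esub> finprod G f I" using insert by (intro G.finprod_insert) auto
    then show ?case using insert by (simp add: Pi_iff)
  qed
qed

context rad_sq_zero
begin

definition Dv :: "'v set" where
  "Dv = {j \<in> V. (\<exists>\<alpha>\<in>E. src \<alpha> = j) \<and> (\<exists>\<alpha>\<in>E. trg \<alpha> = j)}"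

definition adj :: "'v \<Rightarrow> 'v \<Rightarrow> int" where
  "adj i j = int (card {\<alpha>\<in>E. src \<alpha> = i \<and> trg \<alpha> = j})"

lemma finite_Dv: "finite Dv" and Dv_V: "j \<in> Dv \<Longrightarrow> j \<in> V"
  using finite_V by (auto simp: Dv_def)

lemma semisimple_rad: "right_module R M \<Longrightarrow> semisimple M \<Longrightarrow> rad M = {\<zero>\<^bsub>M\<^esub>}"
  unfolding semisimple_def by (rule rsz_module.rad_0_iff[OF rsz_moduleI, THEN iffD2])

lemma semisimple_radc:
  assumes M: "right_module R M" and "fin_dim M" and "semisimple M"
  shows "dm M (radc M j) = 0"
proof -
  interpret rsz_module R V E src trg vc ac M by (rule rsz_moduleI[OF M])
  have "radc M j = {\<zero>\<^bsub>M\<^esub>}"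
    using semisimple_rad[OF M assms(3)] submodule_zero[OF subspace_radc[of j]] by (auto simp: radc_def)
  then show ?thesis using dm_0_iff[OF assms(2) subspace_radc[of j]] by simp
qed

lemma semisimple_om:
  assumes M: "right_module R M" and "fin_dim M" and "semisimple M"
  shows "om M j = (\<Sum>\<alpha>\<in>{\<alpha>\<in>E. trg \<alpha> = j}. dm M (comp M (src \<alpha>)))"
    and "mu M j = dm M (comp M j)"
proof -
  show "om M j = (\<Sum>\<alpha>\<in>{\<alpha>\<in>E. trg \<alpha> = j}. dm M (comp M (src \<alpha>)))"
    by (simp add: om_def tp_def semisimple_radc[OF assms])
  have "socc M j = comp M j" using assms(3) by (auto simp: socc_def semisimple_def comp_def)
  then show "mu M j = dm M (comp M j)" by (simp add: mu_def semisimple_radc[OF assms])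
qed

text \<open>Each arrow from \<open>i\<close> to \<open>j\<close> contributes one copy of S_j to the
  syzygy of S_i; this is where the adjacency matrix enters.\<close>

lemma om_Sm: "i \<in> V \<Longrightarrow> om (Sm i) j = adj i j"
proof -
  assume i: "i \<in> V"
  have "om (Sm i) j = (\<Sum>\<alpha>\<in>{\<alpha>\<in>E. trg \<alpha> = j}. if src \<alpha> = i then 1 else 0)"
    unfolding semisimple_om(1)[OF right_module_Sm[OF i] fin_dim_Sm[OF i] semisimple_Sm[OF i]]
    by (rule sum.cong) (auto simp: dm_comp_Sm[OF i] src_in)
  also have "\<dots> = int (card ({\<alpha>\<in>E. trg \<alpha> = j} \<inter> {\<alpha>. src \<alpha> = i}))"
    using finite_E by (simp add: sum.If_cases)
  also have "{\<alpha>\<in>E. trg \<alpha> = j} \<inter> {\<alpha>. src \<alpha> = i} = {\<alpha>\<in>E. src \<alpha> = i \<and> trg \<alpha> = j}" by blast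
  finally show ?thesis by (simp add: adj_def)
qed

lemma mu_Sm: "i \<in> V \<Longrightarrow> j \<in> V \<Longrightarrow> mu (Sm i) j = (if j = i then 1 else 0)"
  by (simp add: semisimple_om(2)[OF right_module_Sm fin_dim_Sm semisimple_Sm] dm_comp_Sm)

text \<open>An element of (MJ) e_j is a sum of terms m \<alpha> e_j, and these vanish unless
  \<alpha> ends at \<open>j\<close>; the sum over the arrows ending at \<open>j\<close> is empty as
  well.\<close>

lemma om_no_incoming:
  assumes M: "right_module R M" and "fin_dim M" and "\<not> (\<exists>\<alpha>\<in>E. trg \<alpha> = j)"
  shows "om M j = 0"
proof -
  interpret rsz_module R V E src trg vc ac M by (rule rsz_moduleI[OF M])
  have none: "{\<alpha>\<in>E. trg \<alpha> = j} = {}" using assms(3) by blast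
  have "x = \<zero>\<^bsub>M\<^esub>" if x: "x \<in> radc M j" for x
  proof -
    obtain y where y: "y \<in> E \<rightarrow> carrier M" "x = finsum M (\<lambda>\<alpha>. arr \<alpha> \<odot>\<^bsub>M\<^esub> y \<alpha>) E"
      using x by (auto simp: radc_def rad_def)
    have "x = idem j \<odot>\<^bsub>M\<^esub> x" using x by (simp add: radc_def comp_def)
    also have "\<dots> = finsum M (\<lambda>\<alpha>. idem j \<odot>\<^bsub>M\<^esub> (arr \<alpha> \<odot>\<^bsub>M\<^esub> y \<alpha>)) E"
      unfolding y(2) by (rule smult_finsum[OF idem_closed finite_E]) (use y in \<open>auto simp: smult_closed Pi_iff\<close>)
    also have "\<dots> = \<zero>\<^bsub>M\<^esub>"
    proof (rule M.add.finprod_one_eqI)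
      fix \<alpha> assume a: "\<alpha> \<in> E"
      then have "j \<noteq> trg \<alpha>" using assms(3) by blast
      then show "idem j \<odot>\<^bsub>M\<^esub> (arr \<alpha> \<odot>\<^bsub>M\<^esub> y \<alpha>) = \<zero>\<^bsub>M\<^esub>" using a y(1) by (simp add: act_idem_arr Pi_iff)
    qed
    finally show ?thesis .
  qed
  then have "radc M j \<subseteq> {\<zero>\<^bsub>M\<^esub>}" by (intro subsetI) simp
  moreover have "{\<zero>\<^bsub>M\<^esub>} \<subseteq> radc M j" using submodule_zero[OF subspace_radc[of j]] by simp
  ultimately have "radc M j = {\<zero>\<^bsub>M\<^esub>}" by (rule subset_antisym)
  then have "dm M (radc M j) = 0" using dm_0_iff[OF assms(2) subspace_radc[of j]] by simp
  then show ?thesis by (simp add: om_def none)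
qed

lemma comp_zero_module:
  assumes M: "right_module R M" and "fin_dim M" and "\<And>j. j \<in> V \<Longrightarrow> dm M (comp M j) = 0"
  shows "carrier M = {\<zero>\<^bsub>M\<^esub>}"
proof -
  interpret rsz_module R V E src trg vc ac M by (rule rsz_moduleI[OF M])
  have z: "comp M j = {\<zero>\<^bsub>M\<^esub>}" if "j \<in> V" for j
    using dm_0_iff[OF assms(2) subspace_comp[of j]] assms(3)[OF that] by simp
  have "x = \<zero>\<^bsub>M\<^esub>" if x: "x \<in> carrier M" for x
  proof -
    have "idem j \<odot>\<^bsub>M\<^esub> x = \<zero>\<^bsub>M\<^esub>" if "j \<in> V" for j using idem_act_comp[OF x, of j] z[OF that] by simp
    then have "finsum M (\<lambda>j. idem j \<odot>\<^bsub>M\<^esub> x) V = \<zero>\<^bsub>M\<^esub>" by (intro M.add.finprod_one_eqI)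
    then show ?thesis using sum_idem_act[OF x] by simp
  qed
  then have "carrier M \<subseteq> {\<zero>\<^bsub>M\<^esub>}" by (intro subsetI) simp
  then show ?thesis by (rule subset_antisym) simp
qed

text \<open>Here S_i = e_i R. Directly: the image of 1 has a preimage \<open>m\<close> in M e_i, and
  no arrow starts at \<open>i\<close>, so \<open>m\<close> is killed by all arrows and 1 can be sent
  to \<open>m\<close>.\<close>

lemma projective_Sm_sink:
  assumes i: "i \<in> V" and sink: "\<And>\<alpha>. \<alpha> \<in> E \<Longrightarrow> src \<alpha> \<noteq> i"
  shows "projective R (Sm i)"
  unfolding projective_def
proof (intro ballI impI)
  fix M N :: "'r umodule" and g h
  assume fg: "M \<in> fg_modules R" "N \<in> fg_modules R" and g: "g \<in> mod_hom R M N"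
    and h: "h \<in> mod_hom R (Sm i) N" and surj: "g ` carrier M = carrier N"
  note rM = fg_right_module[OF fg(1)] and rN = fg_right_module[OF fg(2)]
  interpret M: rsz_module R V E src trg vc ac M by (rule rsz_moduleI[OF rM])
  interpret N: rsz_module R V E src trg vc ac N by (rule rsz_moduleI[OF rN])
  let ?one = "{\<lambda>_::nat. sc 1}"
  have one: "?one \<in> comp (Sm i) i" using Sm_rangeI[of 1] i comp_Sm[OF i i] by simp
  have "h ?one \<in> g ` comp M i"
    unfolding hom_comp_image[OF rM g surj] by (rule hom_comp_subset[OF right_module_Sm[OF i] h one])
  then obtain m where m: "h ?one = g m" "m \<in> comp M i" by (rule imageE)
  have mM: "m \<in> carrier M" "idem i \<odot>\<^bsub>M\<^esub> m = m" using m(2) by (simp_all add: comp_def)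
  have hu: "h u = the_elem u 0 \<odot>\<^bsub>N\<^esub> h ?one" if "u \<in> carrier (Sm i)" for u
  proof -
    obtain c where c: "u = {\<lambda>_. sc c}" using \<open>u \<in> carrier (Sm i)\<close> by auto
    have "u = sc c \<odot>\<^bsub>Sm i\<^esub> ?one" using i c by simp
    then have "h u = h (sc c \<odot>\<^bsub>Sm i\<^esub> ?one)" by (rule arg_cong)
    also have "\<dots> = sc c \<odot>\<^bsub>N\<^esub> h ?one"
      by (rule mod_hom_smult[OF h sc_closed]) (simp only: Sm_simps(1) Sm_rangeI)
    finally show ?thesis by (simp only: c the_elem_eq)
  qed
  show "\<exists>h'\<in>mod_hom R (Sm i) M. \<forall>x\<in>carrier (Sm i). g (h' x) = h x"
  \<comment> \<open>The case m = 0 is separate because \<open>Sm_embed\<close> is about nonzero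
    elements.\<close>
  proof (cases "m = \<zero>\<^bsub>M\<^esub>")
    case True
    interpret g: right_module_hom R M N g by (rule right_module_homI[OF rM rN g])
    have "(\<lambda>_. \<zero>\<^bsub>M\<^esub>) \<in> mod_hom R (Sm i) M" by (rule mod_homI) auto
    moreover have "g \<zero>\<^bsub>M\<^esub> = h u" if u: "u \<in> carrier (Sm i)" for u
    proof -
      obtain c where c: "u = {\<lambda>_. sc c}" using u by auto
      have "h u = sc c \<odot>\<^bsub>N\<^esub> \<zero>\<^bsub>N\<^esub>" using hu[OF u] m(1) True c by (simp add: g.zero)
      then show ?thesis by (simp add: g.zero)
    qed
    ultimately show ?thesis by (intro bexI[of _ "\<lambda>_. \<zero>\<^bsub>M\<^esub>"]) simp_all
  next
    case False
    have kill: "arr \<alpha> \<odot>\<^bsub>M\<^esub> m = \<zero>\<^bsub>M\<^esub>" if a: "\<alpha> \<in> E" for \<alpha>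
      using M.act_arr_idem[OF a mM(1), of i] mM(2) sink[OF a] by auto
    have "g (the_elem u 0 \<odot>\<^bsub>M\<^esub> m) = h u" if u: "u \<in> carrier (Sm i)" for u
    proof -
      obtain c where c: "u = {\<lambda>_. sc c}" using u by auto
      show ?thesis
        by (simp only: hu[OF u] m(1)) (simp only: c the_elem_eq mod_hom_smult[OF g sc_closed mM(1)])
    qed
    then show ?thesis using Sm_embed(1)[OF i rM m(2) False kill] by (intro bexI[of _ "\<lambda>u. the_elem u 0 \<odot>\<^bsub>M\<^esub> m"]) auto
  qed
qed

lemma projective_iso:
  assumes fg: "P \<in> fg_modules R" "P' \<in> fg_modules R" and iso: "mod_iso R P P'" and P: "projective R P"
  shows "projective R P'"
  unfolding projective_def
proof (intro ballI impI)
  fix M N :: "'r umodule" and g h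
  assume MN: "M \<in> fg_modules R" "N \<in> fg_modules R" and g: "g \<in> mod_hom R M N"
    and h: "h \<in> mod_hom R P' N" and surj: "g ` carrier M = carrier N"
  obtain f where f: "f \<in> mod_hom R P P'" "bij_betw f (carrier P) (carrier P')" using iso by (auto simp: mod_iso_def)
  let ?k = "the_inv_into (carrier P) f"
  note k = mod_iso_inverse[OF fg_right_module[OF fg(1)] fg_right_module[OF fg(2)] f]
  obtain h' where h': "h' \<in> mod_hom R P M" "\<And>x. x \<in> carrier P \<Longrightarrow> g (h' x) = h (f x)"
    using P[unfolded projective_def, rule_format, OF MN g mod_hom_comp[OF f(1) h] surj] by (elim bexE) simp
  have "g (h' (?k y)) = h y" if y: "y \<in> carrier P'" for y
    using h'(2)[OF mod_hom_closed[OF k(1) y]] f_the_inv_into_f_bij_betw[OF f(2)] y by simp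
  then show "\<exists>h'\<in>mod_hom R P' M. \<forall>x\<in>carrier P'. g (h' x) = h x"
    using mod_hom_comp[OF k(1) h'(1)] by (intro bexI[of _ "\<lambda>y. h' (?k y)"]) auto
qed

lemma injective_iso:
  assumes fg: "I \<in> fg_modules R" "I' \<in> fg_modules R" and iso: "mod_iso R I I'" and I: "injective R I"
  shows "injective R I'"
  unfolding injective_def
proof (intro ballI impI)
  fix M N :: "'r umodule" and g h
  assume MN: "M \<in> fg_modules R" "N \<in> fg_modules R" and g: "g \<in> mod_hom R M N"
    and h: "h \<in> mod_hom R M I'" and inj: "inj_on g (carrier M)"
  obtain f where f: "f \<in> mod_hom R I I'" "bij_betw f (carrier I) (carrier I')" using iso by (auto simp: mod_iso_def)
  let ?k = "the_inv_into (carrier I) f"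
  note k = mod_iso_inverse[OF fg_right_module[OF fg(1)] fg_right_module[OF fg(2)] f]
  obtain h' where h': "h' \<in> mod_hom R N I" "\<And>x. x \<in> carrier M \<Longrightarrow> h' (g x) = ?k (h x)"
    using I[unfolded injective_def, rule_format, OF MN g mod_hom_comp[OF h k(1)] inj] by (elim bexE) simp
  have "f (h' (g x)) = h x" if x: "x \<in> carrier M" for x
    using h'(2)[OF x] f_the_inv_into_f_bij_betw[OF f(2)] mod_hom_closed[OF h x] by simp
  then show "\<exists>h'\<in>mod_hom R N I'. \<forall>x\<in>carrier M. h' (g x) = h x"
    using mod_hom_comp[OF h'(1) f(1)] by (intro bexI[of _ "\<lambda>y. f (h' y)"]) auto
qed

lemma K0_zero_module:
  assumes N: "N \<in> fg_modules R" and z: "carrier N = {\<zero>\<^bsub>N\<^esub>}"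
  shows "K0_class R N = \<one>\<^bsub>K0 R\<^esub>"
proof (rule K0_class_projective[OF N])
  interpret N: right_module R N by (rule fg_right_module[OF N])
  show "projective R N"
    unfolding projective_def
  proof (intro ballI impI)
    fix M L :: "'r umodule" and g h
    assume fg: "M \<in> fg_modules R" "L \<in> fg_modules R" and g: "g \<in> mod_hom R M L" and h: "h \<in> mod_hom R N L"
    interpret g: right_module_hom R M L g by (rule right_module_homI[OF fg_right_module fg_right_module g]) fact+
    interpret h: right_module_hom R N L h by (rule right_module_homI[OF N.right_module_axioms fg_right_module h]) fact
    have "(\<lambda>_. \<zero>\<^bsub>M\<^esub>) \<in> mod_hom R N M" by (rule mod_homI) auto
    then show "\<exists>h'\<in>mod_hom R N M. \<forall>x\<in>carrier N. g (h' x) = h x"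
      using z g.zero h.zero by (intro bexI[of _ "\<lambda>_. \<zero>\<^bsub>M\<^esub>"]) simp_all
  qed
qed

text \<open>Induction on the total dimension: a nonzero component N e_i yields a line isomorphic to
  S_i, which \<open>semisimple_split\<close> removes as a direct summand.\<close>

theorem K0_semisimple:
  assumes "N \<in> fg_modules R" and "semisimple N"
  shows "K0_class R N = finprod (K0 R) (\<lambda>j. K0_class R (Sm j) [^]\<^bsub>K0 R\<^esub> dm N (comp N j)) V"
  using assms
proof (induction "nat (\<Sum>j\<in>V. dm N (comp N j))" arbitrary: N rule: less_induct)
  case less
  interpret K: comm_group "K0 R" by (rule comm_group_K0)
  have rN: "right_module R N" and fd: "fin_dim N" using less.prems(1) by (simp_all add: fg_iff_fin_dim)
  have clS: "K0_class R (Sm j) \<in> carrier (K0 R)" if "j \<in> V" for j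
    by (rule K0_class_closed[OF Sm_fg[OF that]])
  then have cl: "K0_class R (Sm j) [^]\<^bsub>K0 R\<^esub> (m::int) \<in> carrier (K0 R)" if "j \<in> V" for j m
    using that by simp
  show ?case
  proof (cases "\<forall>j\<in>V. dm N (comp N j) = 0")
    case True
    then have "carrier N = {\<zero>\<^bsub>N\<^esub>}" by (intro comp_zero_module[OF rN fd]) blast
    then have "K0_class R N = \<one>\<^bsub>K0 R\<^esub>" by (rule K0_zero_module[OF less.prems(1)])
    moreover have "finprod (K0 R) (\<lambda>j. K0_class R (Sm j) [^]\<^bsub>K0 R\<^esub> dm N (comp N j)) V = \<one>\<^bsub>K0 R\<^esub>"
      by (rule K.finprod_one_eqI) (use True in simp)
    ultimately show ?thesis by simp
  next
    case False
    then obtain i where i: "i \<in> V" "dm N (comp N i) \<noteq> 0" by blast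
    interpret N: rsz_module R V E src trg vc ac N by (rule rsz_moduleI[OF rN])
    have "comp N i \<noteq> {\<zero>\<^bsub>N\<^esub>}" using N.dm_0_iff[OF fd N.subspace_comp] i(2) by blast
    then obtain x where x: "x \<in> comp N i" "x \<noteq> \<zero>\<^bsub>N\<^esub>" using submodule_zero[OF N.subspace_comp[of i]] by auto
    obtain H where H: "submodule H R N" "mod_iso R (direct_sum2 (Sm i) (N\<lparr>carrier := H\<rparr>)) N"
      by (rule semisimple_split[OF less.prems i(1) x])
    let ?H = "N\<lparr>carrier := H\<rparr>"
    have fgH: "?H \<in> fg_modules R" by (rule fg_submodule[OF less.prems(1) H(1)])
    then have rH: "right_module R ?H" and fH: "fin_dim ?H" by (simp_all add: fg_iff_fin_dim)
    have ssH: "semisimple ?H" using less.prems(2) submodule_subset[OF H(1)] by (auto simp: semisimple_def)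
    note rS = right_module_Sm[OF i(1)] and fS = fin_dim_Sm[OF i(1)]
    note rD = right_module_direct_sum2[OF rS rH]
    have fD: "fin_dim (direct_sum2 (Sm i) ?H)"
    proof -
      have "mod_iso R N (direct_sum2 (Sm i) ?H)" by (rule mod_iso_sym[OF rD rN H(2)])
      then show ?thesis by (rule iso_invariants(4)[OF rN rD fd])
    qed
    have dims: "dm N (comp N j) = (if j = i then 1 else 0) + dm ?H (comp ?H j)" if j: "j \<in> V" for j
      using iso_invariants(1)[OF rD rN fD H(2), of j] om_ds(3)[OF rS rH fS fH, of j] dm_comp_Sm[OF i(1) j]
      by simp
    have dH: "dm ?H (comp ?H j) \<ge> 0" for j by (simp add: dm_def)
    have "(\<Sum>j\<in>V. dm N (comp N j)) = (\<Sum>j\<in>V. if j = i then 1 else 0) + (\<Sum>j\<in>V. dm ?H (comp ?H j))"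
      using dims by (simp add: sum.distrib)
    also have "(\<Sum>j\<in>V. if j = i then 1 else 0 :: int) = 1" using i(1) finite_V by simp
    finally have "nat (\<Sum>j\<in>V. dm ?H (comp ?H j)) < nat (\<Sum>j\<in>V. dm N (comp N j))"
      using sum_nonneg[of V "\<lambda>j. dm ?H (comp ?H j)"] dH by simp
    then have IH: "K0_class R ?H = finprod (K0 R) (\<lambda>j. K0_class R (Sm j) [^]\<^bsub>K0 R\<^esub> dm ?H (comp ?H j)) V"
      by (rule less.hyps[OF _ fgH ssH])
    \<comment> \<open>[S_i] written as a product over all vertices with a single nontrivial factor,
      so that it can be merged factorwise with the product for the complement.\<close>
    have S1: "finprod (K0 R) (\<lambda>j. if i = j then K0_class R (Sm j) else \<one>\<^bsub>K0 R\<^esub>) V = K0_class R (Sm i)"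
      by (rule K.finprod_singleton[OF i(1) finite_V]) (use clS in auto)
    have "K0_class R N = K0_class R (Sm i) \<otimes>\<^bsub>K0 R\<^esub> K0_class R ?H"
      by (rule K0_class_sum[OF less.prems(1) Sm_fg[OF i(1)] fgH mod_iso_sym[OF rD rN H(2)]])
    also have "\<dots> = finprod (K0 R) (\<lambda>j. (if i = j then K0_class R (Sm j) else \<one>\<^bsub>K0 R\<^esub>) \<otimes>\<^bsub>K0 R\<^esub>
        K0_class R (Sm j) [^]\<^bsub>K0 R\<^esub> dm ?H (comp ?H j)) V"
      unfolding IH S1[symmetric]
      by (rule K.finprod_multf[symmetric]) (use clS cl in auto)
    also have "\<dots> = finprod (K0 R) (\<lambda>j. K0_class R (Sm j) [^]\<^bsub>K0 R\<^esub> dm N (comp N j)) V"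
    proof (rule K.finprod_cong'[OF refl])
      fix j assume j: "j \<in> V"
      note c = K0_class_closed[OF Sm_fg[OF j]]
      show "(if i = j then K0_class R (Sm j) else \<one>\<^bsub>K0 R\<^esub>) \<otimes>\<^bsub>K0 R\<^esub> K0_class R (Sm j) [^]\<^bsub>K0 R\<^esub> dm ?H (comp ?H j)
          = K0_class R (Sm j) [^]\<^bsub>K0 R\<^esub> dm N (comp N j)"
        using c dims[OF j] K.int_pow_mult[OF c, of 1 "dm ?H (comp ?H j)"] by auto
    qed (use cl in auto)
    finally show ?thesis .
  qed
qed

text \<open>Parametrises the subgroup L. Entries of \<open>v\<close> outside \<open>Dv\<close> are
  ignored, so injectivity is claimed only for vectors supported there.\<close>

definition K0_vec :: "('v \<Rightarrow> int) \<Rightarrow> ('r umodule set \<Rightarrow>\<^sub>0 int) set" where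
  "K0_vec v = finprod (K0 R) (\<lambda>j. K0_class R (Sm j) [^]\<^bsub>K0 R\<^esub> v j) Dv"

lemma K0_Sm_closed: "j \<in> Dv \<Longrightarrow> K0_class R (Sm j) \<in> carrier (K0 R)"
  by (rule K0_class_closed[OF Sm_fg[OF Dv_V]])

lemma K0_vec_closed: "K0_vec v \<in> carrier (K0 R)"
proof -
  interpret K: comm_group "K0 R" by (rule comm_group_K0)
  show ?thesis unfolding K0_vec_def using K0_Sm_closed by (intro K.finprod_closed) auto
qed

lemma K0_vec_hom: "K0_vec \<in> hom vec_group (K0 R)"
proof (rule homI)
  interpret K: comm_group "K0 R" by (rule comm_group_K0)
  fix v w :: "'v \<Rightarrow> int"
  show "K0_vec v \<in> carrier (K0 R)" by (rule K0_vec_closed)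
  have "K0_vec (\<lambda>j. v j + w j) = finprod (K0 R) (\<lambda>j. K0_class R (Sm j) [^]\<^bsub>K0 R\<^esub> v j \<otimes>\<^bsub>K0 R\<^esub>
      K0_class R (Sm j) [^]\<^bsub>K0 R\<^esub> w j) Dv"
    unfolding K0_vec_def using K0_Sm_closed by (intro K.finprod_cong') (auto simp: K.int_pow_mult)
  also have "\<dots> = K0_vec v \<otimes>\<^bsub>K0 R\<^esub> K0_vec w"
    unfolding K0_vec_def using K0_Sm_closed by (intro K.finprod_multf) auto
  finally show "K0_vec (v \<otimes>\<^bsub>vec_group\<^esub> w) = K0_vec v \<otimes>\<^bsub>K0 R\<^esub> K0_vec w" by simp
qed

definition om_vec :: "'r umodule \<Rightarrow> 'v \<Rightarrow> int" where
  "om_vec M = (\<lambda>j. if j \<in> Dv then om M j else 0)"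

text \<open>Of the composition factors S_j of the syzygy only the interior ones count: without an
  incoming arrow the multiplicity is 0, and with incoming but no outgoing arrows S_j is projective
  and its class trivial.\<close>

lemma K0_syzygy:
  assumes M: "M \<in> fg_modules R"
  shows "K0_class R (syzygy R M) = K0_vec (om_vec M)"
proof -
  interpret K: comm_group "K0 R" by (rule comm_group_K0)
  note s = syzygy_properties[OF M]
  have rM: "right_module R M" and fM: "fin_dim M" using M by (simp_all add: fg_iff_fin_dim)
  have cl: "K0_class R (Sm j) \<in> carrier (K0 R)" if "j \<in> V" for j by (rule K0_class_closed[OF Sm_fg[OF that]])
  have "K0_class R (syzygy R M) = finprod (K0 R) (\<lambda>j. K0_class R (Sm j) [^]\<^bsub>K0 R\<^esub> om M j) V"
    unfolding K0_semisimple[OF s(1,2)] by (rule K.finprod_cong') (use s(3) cl in auto)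
  also have "\<dots> = K0_vec (om_vec M)"
    unfolding K0_vec_def
  proof (rule K.finprod_mono_neutral_cong_right[OF finite_V])
    show "Dv \<subseteq> V" using Dv_V by blast
    show "K0_class R (Sm j) [^]\<^bsub>K0 R\<^esub> om M j = \<one>\<^bsub>K0 R\<^esub>" if j: "j \<in> V - Dv" for j
    proof (cases "\<exists>\<alpha>\<in>E. trg \<alpha> = j")
      case True
      then have "\<And>\<alpha>. \<alpha> \<in> E \<Longrightarrow> src \<alpha> \<noteq> j" using j by (auto simp: Dv_def)
      then have "K0_class R (Sm j) = \<one>\<^bsub>K0 R\<^esub>"
        using j by (intro K0_class_projective Sm_fg projective_Sm_sink) auto
      then show ?thesis by simp
    next
      case False
      then show ?thesis using om_no_incoming[OF rM fM False] by simp
    qed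
    show "K0_class R (Sm j) [^]\<^bsub>K0 R\<^esub> om M j = K0_class R (Sm j) [^]\<^bsub>K0 R\<^esub> om_vec M j" if "j \<in> Dv" for j
      using that by (simp add: om_vec_def)
  qed (use cl in auto)
  finally show ?thesis .
qed

lemma fgD: "M \<in> fg_modules R \<Longrightarrow> right_module R M" "M \<in> fg_modules R \<Longrightarrow> fin_dim M"
  by (simp_all add: fg_iff_fin_dim)

lemma additive_on_iso:
  assumes "M \<in> fg_modules R" and "M' \<in> fg_modules R" and "M'' \<in> fg_modules R"
    and "mod_iso R M (direct_sum2 M' M'')"
  shows "om M j = om M' j + om M'' j" and "mu M j = mu M' j + mu M'' j"
proof -
  note rD = right_module_direct_sum2[OF fgD(1)[OF assms(2)] fgD(1)[OF assms(3)]]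
  note i = iso_om[OF fgD(1)[OF assms(1)] rD fgD(2)[OF assms(1)] assms(4), of j]
  note d = om_ds[OF fgD(1)[OF assms(2)] fgD(1)[OF assms(3)] fgD(2)[OF assms(2)] fgD(2)[OF assms(3)], of j]
  show "om M j = om M' j + om M'' j" "mu M j = mu M' j + mu M'' j" using i d by simp_all
qed

text \<open>The syzygy multiplicities factor through K_0. Composed with \<open>K0_vec\<close>, this
  homomorphism is the endomorphism that \<open>omega_bar\<close> denotes.\<close>

lemma om_hom_exists:
  obtains Om where "Om \<in> hom (K0 R) vec_group" and "\<And>M. M \<in> fg_modules R \<Longrightarrow> Om (K0_class R M) = om_vec M"
proof (rule K0_universal[OF comm_group_vec_group, of R om_vec])
  show "om_vec M = om_vec N" if "M \<in> fg_modules R" "N \<in> fg_modules R" "mod_iso R M N" for M N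
    using iso_om(1)[OF fgD(1)[OF that(1)] fgD(1)[OF that(2)] fgD(2)[OF that(1)] that(3)]
    by (auto simp: om_vec_def fun_eq_iff)
  show "om_vec M = om_vec M' \<otimes>\<^bsub>vec_group\<^esub> om_vec M''"
    if "M \<in> fg_modules R" "M' \<in> fg_modules R" "M'' \<in> fg_modules R" "mod_iso R M (direct_sum2 M' M'')" for M M' M''
    by (simp add: om_vec_def fun_eq_iff additive_on_iso(1)[OF that])
  show "om_vec P = \<one>\<^bsub>vec_group\<^esub>" if "P \<in> fg_modules R" "projective R P" for P
    using projective_invariants(1)[OF that] Dv_V by (auto simp: om_vec_def)
qed (use that in auto)

text \<open>The coordinate functions that separate the interior simple modules. The restriction to
  \<open>Dv\<close> is essential: if \<open>j\<close> is a sink, \<open>mu\<close> at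
  \<open>j\<close> is 1 on the projective module S_j.\<close>

lemma mu_hom_exists:
  obtains Mu where "Mu \<in> hom (K0 R) vec_group"
    and "\<And>M j. M \<in> fg_modules R \<Longrightarrow> j \<in> Dv \<Longrightarrow> Mu (K0_class R M) j = mu M j"
    and "\<And>M j. M \<in> fg_modules R \<Longrightarrow> j \<notin> Dv \<Longrightarrow> Mu (K0_class R M) j = 0"
proof (rule K0_universal[OF comm_group_vec_group, of R "\<lambda>M j. if j \<in> Dv then mu M j else 0"])
  show "(\<lambda>j. if j \<in> Dv then mu M j else 0) = (\<lambda>j. if j \<in> Dv then mu N j else 0)"
    if "M \<in> fg_modules R" "N \<in> fg_modules R" "mod_iso R M N" for M N
    using iso_om(2)[OF fgD(1)[OF that(1)] fgD(1)[OF that(2)] fgD(2)[OF that(1)] that(3)] by (auto simp: fun_eq_iff)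
  show "(\<lambda>j. if j \<in> Dv then mu M j else 0) =
      (\<lambda>j. if j \<in> Dv then mu M' j else 0) \<otimes>\<^bsub>vec_group\<^esub> (\<lambda>j. if j \<in> Dv then mu M'' j else 0)"
    if "M \<in> fg_modules R" "M' \<in> fg_modules R" "M'' \<in> fg_modules R" "mod_iso R M (direct_sum2 M' M'')" for M M' M''
    by (simp add: fun_eq_iff additive_on_iso(2)[OF that])
  show "(\<lambda>j. if j \<in> Dv then mu P j else 0) = \<one>\<^bsub>vec_group\<^esub>" if "P \<in> fg_modules R" "projective R P" for P
    using projective_invariants(2)[OF that] by (auto simp: Dv_def fun_eq_iff)
qed (use that in auto)


text \<open>\<open>mu\<close> of S_i at \<open>j\<close> is 1 for i = j and 0 otherwise, so the
  homomorphism given by \<open>mu\<close> recovers the coefficients.\<close>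

lemma K0_vec_inj:
  assumes v: "\<forall>j. j \<notin> Dv \<longrightarrow> v j = 0" and w: "\<forall>j. j \<notin> Dv \<longrightarrow> w j = 0" and eq: "K0_vec v = K0_vec w"
  shows "v = w"
proof -
  obtain Mu where Mu: "Mu \<in> hom (K0 R) vec_group"
    "\<And>M j. M \<in> fg_modules R \<Longrightarrow> j \<in> Dv \<Longrightarrow> Mu (K0_class R M) j = mu M j"
    "\<And>M j. M \<in> fg_modules R \<Longrightarrow> j \<notin> Dv \<Longrightarrow> Mu (K0_class R M) j = 0"
    by (rule mu_hom_exists) blast
  interpret K: comm_group "K0 R" by (rule comm_group_K0)
  have "Mu (K0_vec v) j = v j" if j: "j \<in> Dv" for j and v :: "'v \<Rightarrow> int"
  proof -
    have "Mu (K0_vec v) j = (\<Sum>i\<in>Dv. Mu (K0_class R (Sm i) [^]\<^bsub>K0 R\<^esub> v i) j)"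
      unfolding K0_vec_def
      using K0_Sm_closed by (subst hom_vec_finprod[OF comm_group_K0 Mu(1) finite_Dv]) auto
    also have "\<dots> = (\<Sum>i\<in>Dv. if j = i then v j else 0)"
    proof (rule sum.cong[OF refl])
      fix i assume i: "i \<in> Dv"
      show "Mu (K0_class R (Sm i) [^]\<^bsub>K0 R\<^esub> v i) j = (if j = i then v j else 0)"
        using hom_vec_pow[OF comm_group_K0 Mu(1) K0_Sm_closed[OF i], of "v i"]
          Mu(2)[OF Sm_fg[OF Dv_V[OF i]] j] mu_Sm[OF Dv_V[OF i] Dv_V[OF j]] by simp
    qed
    also have "\<dots> = v j" using j finite_Dv by simp
    finally show ?thesis .
  qed
  then show ?thesis using v w eq by (metis (no_types) ext)
qed

text \<open>On \<open>K\<^sub>0\<close> the operator \<open>\<Omega>\<close> factors through the vectors of interior multiplicities, on which it acts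
  by the adjacency matrix.\<close>

lemma omega_bar_structure:
  obtains Om where "\<And>x j. x \<in> carrier (K0 R) \<Longrightarrow> j \<notin> Dv \<Longrightarrow> Om x j = 0"
    and "\<And>x m. x \<in> carrier (K0 R) \<Longrightarrow> (omega_bar R ^^ Suc m) x = K0_vec ((mat_act Dv adj ^^ m) (Om x))"
proof -
  obtain Om where Om: "Om \<in> hom (K0 R) vec_group"
    "\<And>M. M \<in> fg_modules R \<Longrightarrow> Om (K0_class R M) = om_vec M"
    by (rule om_hom_exists) blast
  interpret K: comm_group "K0 R" by (rule comm_group_K0)
  interpret h: group_hom "K0 R" vec_group Om
    using Om(1) group_vec_group by (simp add: group_hom_def group_hom_axioms_def K.is_group)
  have "(\<lambda>x. K0_vec (Om x)) \<in> hom (K0 R) (K0 R)"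
    using hom_compose[OF Om(1) K0_vec_hom] by (simp add: o_def)
  then have ob: "omega_bar R x = K0_vec (Om x)" if "x \<in> carrier (K0 R)" for x
    using that Om(2) K0_syzygy by (intro omega_bar_eq[of "\<lambda>x. K0_vec (Om x)"]) auto
  have supp: "Om x j = 0" if "x \<in> carrier (K0 R)" "j \<notin> Dv" for x j
    using that(1)
  proof (induction rule: K0_induct)
    case one
    show ?case by simp
  next
    case (diff x y)
    then show ?case by (simp add: vec_group_inv)
  next
    case (generator M)
    then show ?case using that(2) by (simp add: Om(2) om_vec_def)
  qed
  have step: "Om (K0_vec v) = mat_act Dv adj v" for v
  proof -
    have "Om (K0_vec v) = (\<lambda>j. \<Sum>i\<in>Dv. Om (K0_class R (Sm i) [^]\<^bsub>K0 R\<^esub> v i) j)"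
      unfolding K0_vec_def
      using K0_Sm_closed by (intro hom_vec_finprod[OF comm_group_K0 Om(1) finite_Dv]) auto
    also have "\<dots> = mat_act Dv adj v"
    proof
      fix j
      have "Om (K0_class R (Sm i) [^]\<^bsub>K0 R\<^esub> v i) j = (if j \<in> Dv then v i * adj i j else 0)" if i: "i \<in> Dv" for i
        using hom_vec_pow[OF comm_group_K0 Om(1) K0_Sm_closed[OF i], of "v i"] Om(2)[OF Sm_fg[OF Dv_V[OF i]]]
          om_Sm[OF Dv_V[OF i], of j] by (simp add: om_vec_def)
      then show "(\<Sum>i\<in>Dv. Om (K0_class R (Sm i) [^]\<^bsub>K0 R\<^esub> v i) j) = mat_act Dv adj v j"
        by (simp add: mat_act_def)
    qed
    finally show ?thesis .
  qed
  \<comment> \<open>The shift in the exponent: the first application of \<Omega> produces the vector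
    \<open>Om x\<close>, and only the following ones act by the matrix.\<close>
  have "(omega_bar R ^^ Suc m) x = K0_vec ((mat_act Dv adj ^^ m) (Om x))" if "x \<in> carrier (K0 R)" for x m
    using ob[OF that] by (induction m) (simp_all add: ob K0_vec_closed step)
  then show thesis using that supp by blast
qed

text \<open>If the kernels of the powers of the matrix are constant from the d-th on, \<Omega> is
  injective on the images of its own powers from the (d+1)-st on; the extra 1 is the application
  that enters the interior part. As \<open>phi\<close> is an infimum, one admissible number bounds
  it.\<close>

lemma phi_dim_le:
  assumes ker: "\<And>u s. \<forall>j. j \<notin> Dv \<longrightarrow> u j = 0 \<Longrightarrow> (mat_act Dv adj ^^ Suc (d + s)) u = (\<lambda>_. 0) \<Longrightarrow>
      (mat_act Dv adj ^^ (d + s)) u = (\<lambda>_. 0)"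
  shows "phi_dim R \<le> enat (Suc d)"
proof -
  obtain Om where supp: "\<And>x j. x \<in> carrier (K0 R) \<Longrightarrow> j \<notin> Dv \<Longrightarrow> Om x j = 0"
    and Om: "\<And>x m. x \<in> carrier (K0 R) \<Longrightarrow> (omega_bar R ^^ Suc m) x = K0_vec ((mat_act Dv adj ^^ m) (Om x))"
    by (rule omega_bar_structure) blast
  interpret K: comm_group "K0 R" by (rule comm_group_K0)
  have "phi R M \<le> enat (Suc d)" if M: "M \<in> fg_modules R" for M
  proof -
    have sub: "add_subgroup R M \<subseteq> carrier (K0 R)"
      unfolding add_subgroup_def using K0_class_closed by (intro K.generate_incl) auto
    have "inj_on (omega_bar R) ((omega_bar R ^^ (Suc d + s)) ` add_subgroup R M)" for s
    proof (rule inj_onI)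
      fix x y assume "x \<in> (omega_bar R ^^ (Suc d + s)) ` add_subgroup R M"
        "y \<in> (omega_bar R ^^ (Suc d + s)) ` add_subgroup R M" and eq: "omega_bar R x = omega_bar R y"
      then obtain x' y' where x': "x' \<in> carrier (K0 R)" "x = (omega_bar R ^^ Suc (d + s)) x'"
        and y': "y' \<in> carrier (K0 R)" "y = (omega_bar R ^^ Suc (d + s)) y'" using sub by auto
      let ?T = "mat_act Dv adj"
      have "K0_vec ((?T ^^ Suc (d + s)) (Om x')) = K0_vec ((?T ^^ Suc (d + s)) (Om y'))"
        using eq Om[OF x'(1), of "Suc (d + s)"] Om[OF y'(1), of "Suc (d + s)"]
        by (simp only: x'(2) y'(2) funpow.simps(2) o_apply)
      then have e: "(?T ^^ Suc (d + s)) (Om x') = (?T ^^ Suc (d + s)) (Om y')"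
        using supp[OF x'(1)] supp[OF y'(1)] by (intro K0_vec_inj mat_act_pow_supp) auto
      \<comment> \<open>\<open>ker\<close> speaks of a single vector, so it is applied to the
        difference of the two.\<close>
      have "(?T ^^ Suc (d + s)) (\<lambda>j. Om x' j - Om y' j) = (\<lambda>_. 0)"
        unfolding mat_act_pow_diff e by simp
      then have "(?T ^^ (d + s)) (\<lambda>j. Om x' j - Om y' j) = (\<lambda>_. 0)"
        using supp[OF x'(1)] supp[OF y'(1)] by (intro ker) auto
      then have "(?T ^^ (d + s)) (Om x') = (?T ^^ (d + s)) (Om y')"
        unfolding mat_act_pow_diff by (simp add: fun_eq_iff)
      then show "x = y" by (simp only: x'(2) y'(2) Om[OF x'(1)] Om[OF y'(1)])
    qed
    then show ?thesis unfolding phi_def by (intro INF_lower) simp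
  qed
  then show ?thesis unfolding phi_dim_def by (rule SUP_least)
qed

end

section \<open>Minimal projective resolutions and a bound for the global dimension\<close>

context rad_sq_zero
begin

lemma cover_step:
  assumes M: "M \<in> fg_modules R"
  obtains P f where "projective_cover R P f M"
    and "P\<lparr>carrier := mod_kernel P M f\<rparr> \<in> fg_modules R"
    and "semisimple (P\<lparr>carrier := mod_kernel P M f\<rparr>)"
    and "\<And>j. j \<in> V \<Longrightarrow>
      dm (P\<lparr>carrier := mod_kernel P M f\<rparr>) (comp (P\<lparr>carrier := mod_kernel P M f\<rparr>) j) = om M j"
proof -
  obtain n w f where w: "\<And>l. l < n \<Longrightarrow> w l \<in> V" and P: "projective_cover R (Pmod n w) f M"
    and ker: "mod_kernel (Pmod n w) M f \<subseteq> rad (Pmod n w)"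
    by (rule fg_cover[OF M]) blast
  show thesis
    by (rule that[OF P]) (rule kernel_of_cover[OF M w P ker]; assumption)+
qed

text \<open>The kernels are kept as submodules of \<open>P i\<close> instead of chosen syzygies, so
  that the covers \<open>f (Suc i)\<close> are themselves maps to \<open>P i\<close> and serve as
  differentials.\<close>

lemma minimal_resolution:
  assumes M: "M \<in> fg_modules R"
  obtains N P f where "N 0 = M" and "\<And>i. projective_cover R (P i) (f i) (N i)"
    and "\<And>i. N (Suc i) = (P i)\<lparr>carrier := mod_kernel (P i) (N i) (f i)\<rparr>"
    and "\<And>i. N i \<in> fg_modules R" and "\<And>i. semisimple (N (Suc i))"
    and "\<And>i j. j \<in> V \<Longrightarrow> dm (N (Suc i)) (comp (N (Suc i)) j) = om (N i) j"
proof -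
  let ?G = "\<lambda>M P f. projective_cover R P f M \<and> P\<lparr>carrier := mod_kernel P M f\<rparr> \<in> fg_modules R \<and>
    semisimple (P\<lparr>carrier := mod_kernel P M f\<rparr>) \<and>
    (\<forall>j\<in>V. dm (P\<lparr>carrier := mod_kernel P M f\<rparr>) (comp (P\<lparr>carrier := mod_kernel P M f\<rparr>) j) = om M j)"
  have "\<exists>P f. ?G M P f" if "M \<in> fg_modules R" for M
    by (rule cover_step[OF that]) blast
  then obtain c g where cg: "\<And>M. M \<in> fg_modules R \<Longrightarrow> ?G M (c M) (g M)" by metis
  define N where "N i = ((\<lambda>M. (c M)\<lparr>carrier := mod_kernel (c M) M (g M)\<rparr>) ^^ i) M" for i
  have N0: "N 0 = M" by (simp add: N_def)
  have NS: "N (Suc i) = (c (N i))\<lparr>carrier := mod_kernel (c (N i)) (N i) (g (N i))\<rparr>" for i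
    by (simp add: N_def)
  have Nfg: "N i \<in> fg_modules R" for i
  proof (induction i)
    case (Suc i)
    show ?case unfolding NS using cg[OF Suc] by blast
  qed (simp add: N0 M)
  show thesis
  proof (rule that[of N "\<lambda>i. c (N i)" "\<lambda>i. g (N i)"])
    fix i
    show "N (Suc i) = (c (N i))\<lparr>carrier := mod_kernel (c (N i)) (N i) (g (N i))\<rparr>" by (rule NS)
    note G = cg[OF Nfg[of i], folded NS]
    show "projective_cover R (c (N i)) (g (N i)) (N i)" "semisimple (N (Suc i))" using G by blast+
    show "dm (N (Suc i)) (comp (N (Suc i)) j) = om (N i) j" if "j \<in> V" for j using G that by blast
  qed (rule N0 Nfg)+
qed

text \<open>From the first kernel on, the interior dimension vectors are multiplied by the matrix in
  each step. Once they vanish, only projective simple modules at sinks are left in a kernel, and the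
  next kernel is 0. The two extra steps are the one that makes the module semisimple and the one
  that removes the sinks.\<close>

lemma global_dim_le:
  assumes nil: "\<And>v. \<forall>j. j \<notin> Dv \<longrightarrow> v j = 0 \<Longrightarrow> (mat_act Dv adj ^^ d) v = (\<lambda>_. 0)"
  shows "global_dim R \<le> enat (Suc (Suc d))"
proof -
  have "proj_dim R M \<le> enat (Suc (Suc d))" if M: "M \<in> fg_modules R" for M
  proof -
    obtain N P f where N0: "N 0 = M" and cov: "\<And>i. projective_cover R (P i) (f i) (N i)"
      and NS: "\<And>i. N (Suc i) = (P i)\<lparr>carrier := mod_kernel (P i) (N i) (f i)\<rparr>"
      and fg: "\<And>i. N i \<in> fg_modules R" and ss: "\<And>i. semisimple (N (Suc i))"
      and dim: "\<And>i j. j \<in> V \<Longrightarrow> dm (N (Suc i)) (comp (N (Suc i)) j) = om (N i) j"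
      by (rule minimal_resolution[OF M]) blast
    define nv where "nv i j = dm (N i) (comp (N i) j)" for i j
    have source: "nv (Suc i) j = 0" if "j \<in> V" "\<not> (\<exists>\<alpha>\<in>E. trg \<alpha> = j)" for i j
      using dim[OF that(1)] om_no_incoming[OF fgD(1)[OF fg] fgD(2)[OF fg] that(2)] by (simp add: nv_def)
    have step: "nv (Suc (Suc i)) j = (\<Sum>\<alpha>\<in>{\<alpha>\<in>E. trg \<alpha> = j}. nv (Suc i) (src \<alpha>))" if "j \<in> V" for i j
      using dim[OF that] semisimple_om(1)[OF fgD(1)[OF fg] fgD(2)[OF fg] ss] by (simp add: nv_def)
    define v where "v i j = (if j \<in> Dv then nv (Suc i) j else 0)" for i j
    \<comment> \<open>The source of an arrow is not a sink; if it is not interior, it has no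
      incoming arrow and its component is 0.\<close>
    have arrow_src: "nv (Suc i) (src \<alpha>) = v i (src \<alpha>)" if "\<alpha> \<in> E" for i \<alpha>
      using source[OF src_in[OF that]] that src_in[OF that] by (auto simp: v_def Dv_def)
    have vstep: "v (Suc i) = mat_act Dv adj (v i)" for i
    proof
      fix j
      show "v (Suc i) j = mat_act Dv adj (v i) j"
      proof (cases "j \<in> Dv")
        case True
        have "v (Suc i) j = (\<Sum>\<alpha>\<in>{\<alpha>\<in>E. trg \<alpha> = j}. v i (src \<alpha>))"
          using True step[OF Dv_V[OF True]] arrow_src by (simp add: v_def[of "Suc i"])
        \<comment> \<open>The arrows ending at \<open>j\<close> are grouped by their sources,
          \<open>adj k j\<close> of them for each \<open>k\<close>.\<close>
        also have "\<dots> = (\<Sum>\<alpha>\<in>{\<alpha>\<in>E. trg \<alpha> = j}. \<Sum>k\<in>Dv. if src \<alpha> = k then v i k else 0)"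
          by (rule sum.cong) (auto simp: finite_Dv v_def)
        also have "\<dots> = (\<Sum>k\<in>Dv. \<Sum>\<alpha>\<in>{\<alpha>\<in>E. trg \<alpha> = j}. if src \<alpha> = k then v i k else 0)"
          by (rule sum.swap)
        also have "\<dots> = (\<Sum>k\<in>Dv. v i k * adj k j)"
        proof (rule sum.cong[OF refl])
          fix k
          have "{\<alpha>\<in>E. trg \<alpha> = j} \<inter> {\<alpha>. src \<alpha> = k} = {\<alpha>\<in>E. src \<alpha> = k \<and> trg \<alpha> = j}" by blast
          then show "(\<Sum>\<alpha>\<in>{\<alpha>\<in>E. trg \<alpha> = j}. if src \<alpha> = k then v i k else 0) = v i k * adj k j"
            using finite_E by (simp add: sum.If_cases adj_def)
        qed
        finally show ?thesis using True by (simp add: mat_act_def)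
      qed (simp add: v_def mat_act_def)
    qed
    have vpow: "v i = (mat_act Dv adj ^^ i) (v 0)" for i
    proof (induction i)
      case (Suc i)
      then show ?case by (simp only: vstep funpow.simps o_apply)
    qed simp
    have "(mat_act Dv adj ^^ d) (v 0) = (\<lambda>_. 0)" by (rule nil) (simp add: v_def)
    then have vd: "v d = (\<lambda>_. 0)" by (simp only: vpow[of d])
    have vz: "v (d + i) = (\<lambda>_. 0)" for i
    proof (induction i)
      case (Suc i)
      then show ?case by (simp add: vstep mat_act_def fun_eq_iff)
    qed (simp add: vd)
    have "nv (Suc (Suc (d + i))) j = 0" if "j \<in> V" for i j
      using step[OF that] arrow_src vz by simp
    then have Nz: "carrier (N (Suc (Suc (d + i)))) = {\<zero>\<^bsub>N (Suc (Suc (d + i)))\<^esub>}" for i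
      by (intro comp_zero_module[OF fgD(1)[OF fg] fgD(2)[OF fg]]) (simp add: nv_def)
    have Pz: "zero_module (P (Suc (Suc (d + i))))" for i
    proof -
      let ?i = "Suc (Suc (d + i))"
      note c = projective_coverD[OF cov[of ?i]]
      interpret P: right_module R "P ?i" by (rule fgD(1)[OF c(1)])
      have "f ?i x = \<zero>\<^bsub>N ?i\<^esub>" if "x \<in> carrier (P ?i)" for x
        using mod_hom_closed[OF c(3) that] Nz by simp
      then have k: "mod_kernel (P ?i) (N ?i) (f ?i) = carrier (P ?i)" unfolding mod_kernel_def by blast
      have s: "{\<zero>\<^bsub>P ?i\<^esub>} <+>\<^bsub>P ?i\<^esub> carrier (P ?i) = carrier (P ?i)"
        using P.subset_sum_right[OF P.submodule_0 P.submodule_carrier]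
          submodule_subset[OF P.submodule_sum[OF P.submodule_0 P.submodule_carrier]] by (rule subset_antisym[rotated])
      have "{\<zero>\<^bsub>P ?i\<^esub>} = carrier (P ?i)" by (rule c(5)[OF P.submodule_0]) (simp only: k s)
      then show ?thesis by (simp add: zero_module_def)
    qed
    have "projective_resolution R M P f"
      unfolding projective_resolution_def
    proof (intro conjI allI)
      fix i
      note c = projective_coverD[OF cov]
      have cN: "carrier (N (Suc i)) = mod_kernel (P i) (N i) (f i)" for i by (simp add: NS)
      show "P i \<in> fg_modules R" "projective R (P i)" by (rule c)+
      show "f 0 \<in> mod_hom R (P 0) M" using c(3)[of 0] by (simp only: N0)
      show "f 0 ` carrier (P 0) = carrier M" using c(4)[of 0] by (simp only: N0)
      have "mod_kernel (P i) (N i) (f i) \<subseteq> carrier (P i)" for i by (auto simp: mod_kernel_def)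
      then show "f (Suc i) \<in> mod_hom R (P (Suc i)) (P i)"
        using mod_hom_comp[OF c(3)[of "Suc i"], of "\<lambda>x. x" "P i"] mod_hom_incl[of "mod_kernel (P i) (N i) (f i)" "P i" R]
        by (simp add: NS)
      show "f 1 ` carrier (P 1) = mod_kernel (P 0) M (f 0)" using c(4)[of 1] cN[of 0] by (simp add: N0)
      have "\<zero>\<^bsub>N (Suc i)\<^esub> = \<zero>\<^bsub>P i\<^esub>" by (simp add: NS)
      then have "mod_kernel (P (Suc i)) (N (Suc i)) (f (Suc i)) = mod_kernel (P (Suc i)) (P i) (f (Suc i))"
        by (simp add: mod_kernel_def)
      then show "f (Suc (Suc i)) ` carrier (P (Suc (Suc i))) = mod_kernel (P (Suc i)) (P i) (f (Suc i))"
        using c(4)[of "Suc (Suc i)"] cN[of "Suc i"] by simp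
    qed
    moreover have "zero_module (P i)" if "i > Suc (Suc d)" for i
    proof -
      have "i = Suc (Suc (d + (i - Suc (Suc d))))" using that by simp
      then show ?thesis using Pz by metis
    qed
    ultimately show ?thesis unfolding proj_dim_def by (intro INF_lower) blast
  qed
  then show ?thesis unfolding global_dim_def by (rule SUP_least)
qed

text \<open>By infinite global dimension some \<open>w\<close> survives the power
  \<open>card Dv\<close> of the matrix. With \<open>card Dv = Suc d\<close>, a vector killed by the
  (d+1)-st but not by the d-th power would contradict this by
  \<open>nilpotent_if_kernel_grows\<close>.\<close>

theorem phi_dim_le_interior:
  assumes "global_dim R = \<infinity>"
  shows "phi_dim R \<le> enat (card Dv)"
proof -
  obtain w where w: "\<forall>j. j \<notin> Dv \<longrightarrow> w j = 0" "(mat_act Dv adj ^^ card Dv) w \<noteq> (\<lambda>_. 0)"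
    using global_dim_le[of "card Dv"] assms by fastforce
  have "card Dv \<noteq> 0"
  proof
    assume "card Dv = 0"
    then have "w = (\<lambda>_. 0)" using w(1) finite_Dv by auto
    then show False using w(2) \<open>card Dv = 0\<close> by simp
  qed
  then obtain d where d: "card Dv = Suc d" using not0_implies_Suc by blast
  have "phi_dim R \<le> enat (Suc d)"
  proof (rule phi_dim_le)
    fix u :: "'v \<Rightarrow> int" and s
    assume u: "\<forall>j. j \<notin> Dv \<longrightarrow> u j = 0" and z: "(mat_act Dv adj ^^ Suc (d + s)) u = (\<lambda>_. 0)"
    \<comment> \<open>Replacing \<open>u\<close> by its s-th iterate reduces the claim at d + s to
      the claim at d.\<close>
    let ?u = "(mat_act Dv adj ^^ s) u"
    have "(mat_act Dv adj ^^ Suc d) ?u = (\<lambda>_. 0)"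
      using z by (simp only: funpow_add[of "Suc d" s, simplified, THEN fun_cong, symmetric] o_apply funpow.simps(2))
         (simp add: funpow_add)
    then have "(mat_act Dv adj ^^ d) ?u = (\<lambda>_. 0)"
      using nilpotent_if_kernel_grows[OF finite_Dv d mat_act_pow_supp[OF u] _ _ w(1)] w(2) d by metis
    then show "(mat_act Dv adj ^^ (d + s)) u = (\<lambda>_. 0)" by (simp add: funpow_add)
  qed
  then show ?thesis using d by simp
qed

section \<open>Counting isomorphism classes of simple modules\<close>

lemma Sm_iso_class_inj: "inj_on (\<lambda>i. iso_class R (Sm i)) V"
proof (rule inj_onI)
  fix i j assume i: "i \<in> V" and j: "j \<in> V" and eq: "iso_class R (Sm i) = iso_class R (Sm j)"
  have "mod_iso R (Sm i) (Sm j)" by (rule iso_class_eqD[OF Sm_fg[OF j] eq])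
  from iso_invariants(1)[OF right_module_Sm[OF i] right_module_Sm[OF j] fin_dim_Sm[OF i] this, of j]
  show "i = j" using dm_comp_Sm[OF i j] dm_comp_Sm[OF j j] by (auto split: if_splits)
qed

text \<open>\<open>Q\<close> is an arbitrary isomorphism invariant property, so that both kinds of
  simple modules are counted by the same correspondence with vertices.\<close>

lemma simple_classes:
  assumes Q: "\<And>M N. M \<in> fg_modules R \<Longrightarrow> N \<in> fg_modules R \<Longrightarrow> mod_iso R M N \<Longrightarrow> Q M \<Longrightarrow> Q N"
  shows "{iso_class R S | S. S \<in> fg_modules R \<and> simple_module R S \<and> Q S}
    = (\<lambda>i. iso_class R (Sm i)) ` {i \<in> V. Q (Sm i)}"
proof
  show "(\<lambda>i. iso_class R (Sm i)) ` {i \<in> V. Q (Sm i)} \<subseteq>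
      {iso_class R S | S. S \<in> fg_modules R \<and> simple_module R S \<and> Q S}"
    using Sm_fg simple_Sm by blast
  show "{iso_class R S | S. S \<in> fg_modules R \<and> simple_module R S \<and> Q S} \<subseteq>
      (\<lambda>i. iso_class R (Sm i)) ` {i \<in> V. Q (Sm i)}"
  proof clarify
    fix S assume S: "S \<in> fg_modules R" "simple_module R S" "Q S"
    obtain i where i: "i \<in> V" "mod_iso R (Sm i) S"
      by (rule simple_iso_Sm[OF fgD(1)[OF S(1)] S(2)])
    have iso: "mod_iso R S (Sm i)" by (rule mod_iso_sym[OF right_module_Sm[OF i(1)] fgD(1)[OF S(1)] i(2)])
    have "Q (Sm i)" by (rule Q[OF S(1) Sm_fg[OF i(1)] iso S(3)])
    moreover have "iso_class R S = iso_class R (Sm i)" by (rule iso_class_eq[OF S(1) Sm_fg[OF i(1)] iso])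
    ultimately show "iso_class R S \<in> (\<lambda>i. iso_class R (Sm i)) ` {i \<in> V. Q (Sm i)}" using i(1) by blast
  qed
qed

lemma card_simple_classes:
  assumes "\<And>M N. M \<in> fg_modules R \<Longrightarrow> N \<in> fg_modules R \<Longrightarrow> mod_iso R M N \<Longrightarrow> Q M \<Longrightarrow> Q N"
  shows "card {iso_class R S | S. S \<in> fg_modules R \<and> simple_module R S \<and> Q S} = card {i \<in> V. Q (Sm i)}"
proof -
  have eq: "{iso_class R S | S. S \<in> fg_modules R \<and> simple_module R S \<and> Q S}
      = (\<lambda>i. iso_class R (Sm i)) ` {i \<in> V. Q (Sm i)}"
    by (rule simple_classes[of Q]) (rule assms)
  have "inj_on (\<lambda>i. iso_class R (Sm i)) {i \<in> V. Q (Sm i)}"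
    by (rule inj_on_subset[OF Sm_iso_class_inj]) blast
  then show ?thesis unfolding eq by (rule card_image)
qed

text \<open>S_i has multiplicity 1 in itself, whereas \<open>mu\<close> at a vertex with an outgoing
  arrow is 0 on projectives.\<close>

lemma not_projective_Sm: "i \<in> Dv \<Longrightarrow> \<not> projective R (Sm i)"
proof
  assume i: "i \<in> Dv" and p: "projective R (Sm i)"
  then obtain \<alpha> where "\<alpha> \<in> E" "src \<alpha> = i" by (auto simp: Dv_def)
  then have "mu (Sm i) i = 0" using projective_invariants(2)[OF Sm_fg[OF Dv_V[OF i]] p] by blast
  then show False using mu_Sm[OF Dv_V[OF i] Dv_V[OF i]] by simp
qed

text \<open>An arrow \<open>\<alpha>\<close> ending at \<open>i\<close> embeds \<open>S\<^sub>i\<close> into the radical of \<open>e\<^bsub>src \<alpha>\<^esub>R\<close>, and this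
  embedding does not split.\<close>

lemma not_injective_Sm: "i \<in> Dv \<Longrightarrow> \<not> injective R (Sm i)"
proof
  assume i: "i \<in> Dv" and inj: "injective R (Sm i)"
  then obtain \<alpha> where \<alpha>: "\<alpha> \<in> E" "trg \<alpha> = i" by (auto simp: Dv_def)
  note iV = Dv_V[OF i]
  define w :: "nat \<Rightarrow> 'v" where "w = (\<lambda>_. src \<alpha>)"
  let ?P = "Pmod 1 w"
  interpret P: rsz_module R V E src trg vc ac ?P by (rule rsz_moduleI[OF right_module_pmod])
  let ?y = "{pgen w 0}"
  have y: "?y \<in> carrier ?P" using pgen_in[of 0 1 w] by simp
  let ?x = "arr \<alpha> \<odot>\<^bsub>?P\<^esub> ?y"
  have x: "?x \<in> comp ?P i" using P.arr_act_comp[OF \<alpha>(1) y] \<alpha>(2) by simp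
  have xv: "?x = {\<lambda>l. pgen w 0 l \<otimes>\<^bsub>R\<^esub> arr \<alpha>}" by simp
  have nz: "?x \<noteq> \<zero>\<^bsub>?P\<^esub>"
  proof
    assume "?x = \<zero>\<^bsub>?P\<^esub>"
    then have "(\<lambda>l. pgen w 0 l \<otimes>\<^bsub>R\<^esub> arr \<alpha>) = (\<lambda>_. \<zero>\<^bsub>R\<^esub>)" unfolding xv by simp
    then have "pgen w 0 0 \<otimes>\<^bsub>R\<^esub> arr \<alpha> = \<zero>\<^bsub>R\<^esub>" by (rule fun_cong)
    then have "arr \<alpha> = \<zero>\<^bsub>R\<^esub>" by (simp add: pgen_def w_def idem_arr[OF \<alpha>(1)])
    then have "ac (arr \<alpha>) \<alpha> = ac \<zero>\<^bsub>R\<^esub> \<alpha>" by simp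
    then show False using \<alpha>(1) by simp
  qed
  have kill: "arr \<beta> \<odot>\<^bsub>?P\<^esub> ?x = \<zero>\<^bsub>?P\<^esub>" for \<beta> by (rule P.act_arr_arr[OF y])
  note e = Sm_embed[OF iV right_module_pmod x nz kill]
  have wV: "w l \<in> V" if "l < 1" for l using src_in[OF \<alpha>(1)] by (simp add: w_def)
  have Pfg: "?P \<in> fg_modules R" by (rule pmod_fg[OF wV])
  from inj[unfolded injective_def, rule_format, OF Sm_fg[OF iV] Pfg e(1) mod_hom_id e(2)]
  obtain h where h: "h \<in> mod_hom R ?P (Sm i)"
    and hu: "\<forall>u\<in>carrier (Sm i). h (the_elem u 0 \<odot>\<^bsub>?P\<^esub> ?x) = u"
    by (rule bexE)
  let ?one = "{\<lambda>_::nat. sc 1}"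
  have one: "?one \<in> carrier (Sm i)" by (simp only: Sm_simps(1) Sm_rangeI)
  have "the_elem ?one 0 \<odot>\<^bsub>?P\<^esub> ?x = ?x"
    using P.smult_one[of ?x] P.smult_closed[OF arr_closed y, of \<alpha>] by (simp only: the_elem_eq sc_1)
  then have "h ?x = ?one" using bspec[OF hu one] by (simp only:)
  \<comment> \<open>A retraction \<open>h\<close> sends y \<alpha> to h(y) \<alpha>, which is 0
    because arrows kill S_i, although \<open>?x\<close> = y \<alpha> has to go to 1.\<close>
  moreover have "h ?x = arr \<alpha> \<odot>\<^bsub>Sm i\<^esub> h ?y" by (rule mod_hom_smult[OF h arr_closed y])
  moreover have "arr \<alpha> \<odot>\<^bsub>Sm i\<^esub> h ?y = \<zero>\<^bsub>Sm i\<^esub>"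
    using semisimple_Sm[OF iV] mod_hom_closed[OF h y] \<alpha>(1) unfolding semisimple_def by blast
  ultimately have "?one = {\<lambda>_. \<zero>\<^bsub>R\<^esub>}" by simp
  then have "(\<lambda>_::nat. sc 1) = (\<lambda>_. sc 0)" by (simp add: sc_0)
  then have "sc 1 = sc 0" by (rule fun_cong)
  then show False using sc_eq_iff[OF iV] by simp
qed

theorem phi_dim_le_card_simples:
  assumes "global_dim R = \<infinity>"
  shows "phi_dim R \<le> enat (card {iso_class R S | S. S \<in> fg_modules R \<and> simple_module R S \<and>
    \<not> projective R S \<and> \<not> injective R S})"
proof -
  have inv: "\<not> projective R N \<and> \<not> injective R N"
    if "M \<in> fg_modules R" "N \<in> fg_modules R" "mod_iso R M N" "\<not> projective R M \<and> \<not> injective R M" for M N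
  proof -
    have "mod_iso R N M" by (rule mod_iso_sym[OF fgD(1)[OF that(1)] fgD(1)[OF that(2)] that(3)])
    then show ?thesis using projective_iso[OF that(2,1)] injective_iso[OF that(2,1)] that(4) by blast
  qed
  have "Dv \<subseteq> {i \<in> V. \<not> projective R (Sm i) \<and> \<not> injective R (Sm i)}"
    using Dv_V not_projective_Sm not_injective_Sm by blast
  then have "card Dv \<le> card {i \<in> V. \<not> projective R (Sm i) \<and> \<not> injective R (Sm i)}"
    using finite_V by (intro card_mono) auto
  then have "enat (card Dv) \<le> enat (card {i \<in> V. \<not> projective R (Sm i) \<and> \<not> injective R (Sm i)})" by simp
  note le = order_trans[OF phi_dim_le_interior[OF assms] this]
  have eq: "card {iso_class R S | S. S \<in> fg_modules R \<and> simple_module R S \<and>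
      \<not> projective R S \<and> \<not> injective R S} = card {i \<in> V. \<not> projective R (Sm i) \<and> \<not> injective R (Sm i)}"
    by (rule card_simple_classes[of "\<lambda>S. \<not> projective R S \<and> \<not> injective R S"]) (rule inv)
  show ?thesis unfolding eq by (rule le)
qed

theorem card_simples:
  "card {iso_class R S | S. S \<in> fg_modules R \<and> simple_module R S \<and> \<not> projective R S \<and> \<not> injective R S} +
    card {iso_class R S | S. S \<in> fg_modules R \<and> simple_module R S \<and> (projective R S \<or> injective R S)} = card V"
proof -
  have inv: "projective R N \<or> injective R N"
    if "M \<in> fg_modules R" "N \<in> fg_modules R" "mod_iso R M N" "projective R M \<or> injective R M" for M N
    using projective_iso[OF that(1-3)] injective_iso[OF that(1-3)] that(4) by blast
  have inv': "\<not> projective R N \<and> \<not> injective R N"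
    if "M \<in> fg_modules R" "N \<in> fg_modules R" "mod_iso R M N" "\<not> projective R M \<and> \<not> injective R M" for M N
  proof -
    have "mod_iso R N M" by (rule mod_iso_sym[OF fgD(1)[OF that(1)] fgD(1)[OF that(2)] that(3)])
    then show ?thesis using projective_iso[OF that(2,1)] injective_iso[OF that(2,1)] that(4) by blast
  qed
  have "card {i \<in> V. \<not> projective R (Sm i) \<and> \<not> injective R (Sm i)} +
      card {i \<in> V. projective R (Sm i) \<or> injective R (Sm i)} =
    card ({i \<in> V. \<not> projective R (Sm i) \<and> \<not> injective R (Sm i)} \<union> {i \<in> V. projective R (Sm i) \<or> injective R (Sm i)})"
    using finite_V by (intro card_Un_disjoint[symmetric]) auto
  also have "{i \<in> V. \<not> projective R (Sm i) \<and> \<not> injective R (Sm i)} \<union>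
      {i \<in> V. projective R (Sm i) \<or> injective R (Sm i)} = V" by blast
  finally have sum: "card {i \<in> V. \<not> projective R (Sm i) \<and> \<not> injective R (Sm i)} +
      card {i \<in> V. projective R (Sm i) \<or> injective R (Sm i)} = card V" .
  have p: "card {iso_class R S | S. S \<in> fg_modules R \<and> simple_module R S \<and>
      \<not> projective R S \<and> \<not> injective R S} = card {i \<in> V. \<not> projective R (Sm i) \<and> \<not> injective R (Sm i)}"
    by (rule card_simple_classes[of "\<lambda>S. \<not> projective R S \<and> \<not> injective R S"]) (rule inv')
  have q: "card {iso_class R S | S. S \<in> fg_modules R \<and> simple_module R S \<and>
      (projective R S \<or> injective R S)} = card {i \<in> V. projective R (Sm i) \<or> injective R (Sm i)}"
    by (rule card_simple_classes[of "\<lambda>S. projective R S \<or> injective R S"]) (rule inv)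
  show ?thesis unfolding p q by (rule sum)
qed

end

section \<open>The algebra of a quiver\<close>

text \<open>Concatenation as a total function that ignores whether the ends match; associativity
  then needs no side conditions, and \<open>composable\<close> is tracked separately.\<close>

definition path_cat :: "('v, 'a) path \<Rightarrow> ('v, 'a) path \<Rightarrow> ('v, 'a) path" where
  "path_cat x y = (fst x, fst (snd x) @ fst (snd y), snd (snd y))"

definition composable :: "('v, 'a) path \<Rightarrow> ('v, 'a) path \<Rightarrow> bool" where
  "composable x y \<longleftrightarrow> snd (snd x) = fst y"

lemma path_cat_simps [simp]:
  "fst (path_cat x y) = fst x" "snd (snd (path_cat x y)) = snd (snd y)"
  "fst (snd (path_cat x y)) = fst (snd x) @ fst (snd y)"
  by (simp_all add: path_cat_def)

lemma path_cat_assoc: "path_cat (path_cat x y) z = path_cat x (path_cat y z)"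
  by (simp add: path_cat_def)

lemma path_algebra_simps:
  "carrier (path_algebra Q) = {f. finite {x. f x \<noteq> 0} \<and> {x. f x \<noteq> 0} \<subseteq> quiver_paths Q}"
  "f \<otimes>\<^bsub>path_algebra Q\<^esub> g = (\<lambda>z. \<Sum>(x, y)\<in>factorizations Q z. f x * g y)"
  "\<one>\<^bsub>path_algebra Q\<^esub> = (\<lambda>z. \<Sum>i\<in>verts Q. path_elt (i, [], i) z)"
  "\<zero>\<^bsub>path_algebra Q\<^esub> = (\<lambda>z. 0)" "f \<oplus>\<^bsub>path_algebra Q\<^esub> g = (\<lambda>z. f z + g z)"
  by (simp_all add: path_algebra_def)

context fin_digraph
begin

lemma factorizations_iff:
  "(x, y) \<in> factorizations G z \<longleftrightarrow>
    x \<in> quiver_paths G \<and> y \<in> quiver_paths G \<and> composable x y \<and> z = path_cat x y"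
  by (cases x; cases y) (auto simp: factorizations_def composable_def path_cat_def)

lemma path_cat_in: "x \<in> quiver_paths G \<Longrightarrow> y \<in> quiver_paths G \<Longrightarrow> composable x y \<Longrightarrow> path_cat x y \<in> quiver_paths G"
  by (cases x; cases y) (auto simp: quiver_paths_def composable_def path_cat_def)

lemma quiver_path_ends:
  "x \<in> quiver_paths G \<Longrightarrow> fst x \<in> verts G" "x \<in> quiver_paths G \<Longrightarrow> snd (snd x) \<in> verts G"
  by (cases x; auto simp: quiver_paths_def intro: awalk_hd_in_verts awalk_last_in_verts)+

lemma nil_path_iff: "(u, [], v) \<in> quiver_paths G \<longleftrightarrow> u = v \<and> u \<in> verts G"
  by (auto simp: quiver_paths_def awalk_Nil_iff)

lemma cons_path_iff:
  "(u, a # p, v) \<in> quiver_paths G \<longleftrightarrow> a \<in> arcs G \<and> u = tail G a \<and> (head G a, p, v) \<in> quiver_paths G"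
  by (auto simp: quiver_paths_def awalk_Cons_iff)

text \<open>A factorisation is determined by the position of the cut and the middle vertex, and
  there are finitely many of either.\<close>

lemma finite_factorizations: "finite (factorizations G z)"
proof -
  obtain u p w where z: "z = (u, p, w)" by (cases z)
  let ?f = "\<lambda>(k, v). ((u, take k p, v), (v, drop k p, w))"
  have "factorizations G z \<subseteq> ?f ` ({..length p} \<times> verts G)"
  proof clarify
    fix u1 p1 v1 v2 p2 w2
    assume "((u1, p1, v1), (v2, p2, w2)) \<in> factorizations G z"
    then have *: "v1 = v2" "u = u1" "p = p1 @ p2" "w = w2" "v1 \<in> verts G"
      using quiver_path_ends(2)[of "(u1, p1, v1)"]
      by (auto simp: factorizations_iff composable_def path_cat_def z)
    then show "((u1, p1, v1), (v2, p2, w2)) \<in> ?f ` ({..length p} \<times> verts G)"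
      by (intro image_eqI[of _ _ "(length p1, v1)"]) auto
  qed
  then show ?thesis by (rule finite_subset) simp
qed

lemma factorizations_nonpath: "z \<notin> quiver_paths G \<Longrightarrow> factorizations G z = {}"
proof (rule ccontr)
  assume z: "z \<notin> quiver_paths G" and "factorizations G z \<noteq> {}"
  then obtain x y where "(x, y) \<in> factorizations G z" by auto
  then show False using z path_cat_in[of x y] by (simp add: factorizations_iff)
qed

lemma factorizations_nil:
  assumes i: "i \<in> verts G"
  shows "factorizations G (i, [], i) = {((i, [], i), (i, [], i))}"
proof -
  have "(x, y) \<in> factorizations G (i, [], i) \<longleftrightarrow> x = (i, [], i) \<and> y = (i, [], i)" for x y
    using i by (cases x; cases y) (auto simp: factorizations_iff composable_def path_cat_def nil_path_iff)
  then show ?thesis by auto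
qed

text \<open>The two factorisations of an arrow are the source of the two terms in the product rule
  for arrow coordinates.\<close>

lemma factorizations_arc:
  assumes a: "a \<in> arcs G"
  shows "factorizations G (tail G a, [a], head G a) =
    {((tail G a, [], tail G a), (tail G a, [a], head G a)), ((tail G a, [a], head G a), (head G a, [], head G a))}"
proof -
  have "(x, y) \<in> factorizations G (tail G a, [a], head G a) \<longleftrightarrow>
      x = (tail G a, [], tail G a) \<and> y = (tail G a, [a], head G a) \<or>
      x = (tail G a, [a], head G a) \<and> y = (head G a, [], head G a)" for x y
    using a by (cases x; cases y)
      (auto simp: factorizations_iff composable_def path_cat_def nil_path_iff cons_path_iff append_eq_Cons_conv Cons_eq_append_conv)
  then show ?thesis by auto
qed

abbreviation PA :: "(('a, 'b) path \<Rightarrow> 'k::field) ring" where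
  "PA \<equiv> path_algebra G"

lemma path_algebra_outside: "f \<in> carrier PA \<Longrightarrow> z \<notin> quiver_paths G \<Longrightarrow> f z = 0"
  by (auto simp: path_algebra_simps)

lemma path_algebra_mult_closed:
  assumes f: "f \<in> carrier PA" and g: "g \<in> carrier (PA :: (('a, 'b) path \<Rightarrow> 'k::field) ring)"
  shows "f \<otimes>\<^bsub>PA\<^esub> g \<in> carrier PA"
proof -
  have "{z. (f \<otimes>\<^bsub>PA\<^esub> g) z \<noteq> 0} \<subseteq> (\<lambda>(x, y). path_cat x y) ` ({x. f x \<noteq> 0} \<times> {y. g y \<noteq> 0})"
  proof
    fix z assume "z \<in> {z. (f \<otimes>\<^bsub>PA\<^esub> g) z \<noteq> 0}"
    then have "(\<Sum>(x, y)\<in>factorizations G z. f x * g y) \<noteq> 0" by (simp add: path_algebra_simps)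
    then obtain w where w: "w \<in> factorizations G z" "(case w of (x, y) \<Rightarrow> f x * g y) \<noteq> 0"
      by (rule sum.not_neutral_contains_not_neutral)
    obtain x y where "w = (x, y)" by (cases w)
    then show "z \<in> (\<lambda>(x, y). path_cat x y) ` ({x. f x \<noteq> 0} \<times> {y. g y \<noteq> 0})"
      using w by (intro image_eqI[of _ _ "(x, y)"]) (auto simp: factorizations_iff)
  qed
  moreover have "finite ({x. f x \<noteq> 0} \<times> {y. g y \<noteq> 0})" using f g by (simp add: path_algebra_simps)
  ultimately have "finite {z. (f \<otimes>\<^bsub>PA\<^esub> g) z \<noteq> 0}" by (meson finite_imageI finite_subset)
  moreover have "{z. (f \<otimes>\<^bsub>PA\<^esub> g) z \<noteq> 0} \<subseteq> quiver_paths G"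
  proof (rule subsetI, rule ccontr)
    fix z assume "z \<in> {z. (f \<otimes>\<^bsub>PA\<^esub> g) z \<noteq> 0}" "z \<notin> quiver_paths G"
    then show False by (simp add: path_algebra_simps(2) factorizations_nonpath)
  qed
  ultimately show ?thesis by (simp add: path_algebra_simps(1))
qed

text \<open>Both sides are sums over the factorisations of a path into three pieces, encoded as a
  cut whose left, respectively right, piece is cut again.\<close>

lemma path_algebra_mult_assoc:
  fixes f g h :: "('a, 'b) path \<Rightarrow> 'k::field"
  shows "f \<otimes>\<^bsub>PA\<^esub> g \<otimes>\<^bsub>PA\<^esub> h = f \<otimes>\<^bsub>PA\<^esub> (g \<otimes>\<^bsub>PA\<^esub> h)"
proof
  fix z
  let ?F = "factorizations G"
  have "(f \<otimes>\<^bsub>PA\<^esub> g \<otimes>\<^bsub>PA\<^esub> h) z = (\<Sum>s\<in>?F z. \<Sum>t\<in>?F (fst s). f (fst t) * g (snd t) * h (snd s))"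
    by (simp add: path_algebra_simps case_prod_unfold sum_distrib_right)
  also have "\<dots> = (\<Sum>(s, t)\<in>Sigma (?F z) (\<lambda>s. ?F (fst s)). f (fst t) * g (snd t) * h (snd s))"
    by (rule sum.Sigma) (simp_all add: finite_factorizations)
  also have "\<dots> = (\<Sum>(s, t)\<in>Sigma (?F z) (\<lambda>s. ?F (snd s)). f (fst s) * (g (fst t) * h (snd t)))"
  \<comment> \<open>The witnesses rebracket (x1 x2) y as x1 (x2 y) and back.\<close>
  proof (rule sum.reindex_bij_witness[where
      j = "\<lambda>(s, t). ((fst t, path_cat (snd t) (snd s)), (snd t, snd s))" and
      i = "\<lambda>(s, t). ((path_cat (fst s) (fst t), snd t), (fst s, fst t))"])
    fix w assume "w \<in> Sigma (?F z) (\<lambda>s. ?F (fst s))"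
    then obtain x y x1 x2 where w: "w = ((x, y), (x1, x2))" "(x, y) \<in> ?F z" "(x1, x2) \<in> ?F x" by auto
    then show "(case case w of (s, t) \<Rightarrow> ((fst t, path_cat (snd t) (snd s)), (snd t, snd s)) of
        (s, t) \<Rightarrow> ((path_cat (fst s) (fst t), snd t), (fst s, fst t))) = w"
      by (simp add: factorizations_iff)
    show "(case w of (s, t) \<Rightarrow> ((fst t, path_cat (snd t) (snd s)), (snd t, snd s))) \<in> Sigma (?F z) (\<lambda>s. ?F (snd s))"
      using w by (auto simp: factorizations_iff path_cat_assoc composable_def intro!: path_cat_in)
    show "(case case w of (s, t) \<Rightarrow> ((fst t, path_cat (snd t) (snd s)), (snd t, snd s)) of
        (s, t) \<Rightarrow> f (fst s) * (g (fst t) * h (snd t))) = (case w of (s, t) \<Rightarrow> f (fst t) * g (snd t) * h (snd s))"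
      using w by simp
  next
    fix w assume "w \<in> Sigma (?F z) (\<lambda>s. ?F (snd s))"
    then obtain x y y1 y2 where w: "w = ((x, y), (y1, y2))" "(x, y) \<in> ?F z" "(y1, y2) \<in> ?F y" by auto
    then show "(case case w of (s, t) \<Rightarrow> ((path_cat (fst s) (fst t), snd t), (fst s, fst t)) of
        (s, t) \<Rightarrow> ((fst t, path_cat (snd t) (snd s)), (snd t, snd s))) = w"
      by (simp add: factorizations_iff)
    show "(case w of (s, t) \<Rightarrow> ((path_cat (fst s) (fst t), snd t), (fst s, fst t))) \<in> Sigma (?F z) (\<lambda>s. ?F (fst s))"
      using w by (auto simp: factorizations_iff path_cat_assoc composable_def intro!: path_cat_in)
  qed
  also have "\<dots> = (\<Sum>s\<in>?F z. \<Sum>t\<in>?F (snd s). f (fst s) * (g (fst t) * h (snd t)))"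
    by (rule sum.Sigma[symmetric]) (simp_all add: finite_factorizations)
  also have "\<dots> = (f \<otimes>\<^bsub>PA\<^esub> (g \<otimes>\<^bsub>PA\<^esub> h)) z"
    by (simp add: path_algebra_simps case_prod_unfold sum_distrib_left)
  finally show "(f \<otimes>\<^bsub>PA\<^esub> g \<otimes>\<^bsub>PA\<^esub> h) z = (f \<otimes>\<^bsub>PA\<^esub> (g \<otimes>\<^bsub>PA\<^esub> h)) z" .
qed

lemma path_algebra_one: "\<one>\<^bsub>PA\<^esub> z = (if fst z \<in> verts G \<and> z = (fst z, [], fst z) then 1 else (0::'k::field))"
proof -
  have "(\<Sum>i\<in>verts G. path_elt (i, [], i) z) = (\<Sum>i\<in>verts G. if fst z = i then (if z = (fst z, [], fst z) then 1 else (0::'k)) else 0)"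
    by (rule sum.cong) (auto simp: path_elt_def)
  then show ?thesis by (simp add: path_algebra_simps)
qed

lemma ring_path_algebra: "ring (PA :: (('a, 'b) path \<Rightarrow> 'k::field) ring)"
proof (rule ringI)
  let ?A = "PA :: (('a, 'b) path \<Rightarrow> 'k) ring"
  show "abelian_group ?A"
  proof (rule abelian_groupI)
    fix f g :: "('a, 'b) path \<Rightarrow> 'k"
    assume f: "f \<in> carrier ?A"
    show "\<exists>h\<in>carrier ?A. h \<oplus>\<^bsub>?A\<^esub> f = \<zero>\<^bsub>?A\<^esub>"
      using f by (intro bexI[of _ "\<lambda>z. - f z"]) (auto simp: path_algebra_simps)
    assume g: "g \<in> carrier ?A"
    have "{z. f z + g z \<noteq> 0} \<subseteq> {z. f z \<noteq> 0} \<union> {z. g z \<noteq> 0}" by auto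
    then show "f \<oplus>\<^bsub>?A\<^esub> g \<in> carrier ?A"
      using f g finite_subset[of "{z. f z + g z \<noteq> 0}" "{z. f z \<noteq> 0} \<union> {z. g z \<noteq> 0}"]
      by (auto simp: path_algebra_simps)
  qed (auto simp: path_algebra_simps fun_eq_iff)
  show "Group.monoid ?A"
  proof (rule monoidI)
    fix f g h :: "('a, 'b) path \<Rightarrow> 'k"
    assume f: "f \<in> carrier ?A"
    show "\<one>\<^bsub>?A\<^esub> \<otimes>\<^bsub>?A\<^esub> f = f"
    proof
      fix z
      have 1: "(\<one>\<^bsub>?A\<^esub> \<otimes>\<^bsub>?A\<^esub> f) z = (\<Sum>w\<in>factorizations G z. \<one>\<^bsub>?A\<^esub> (fst w) * f (snd w))"
        unfolding path_algebra_simps(2) case_prod_unfold by (rule refl)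
      show "(\<one>\<^bsub>?A\<^esub> \<otimes>\<^bsub>?A\<^esub> f) z = f z"
      proof (cases "z \<in> quiver_paths G")
        case True
        let ?w = "((fst z, [], fst z), z)"
        have w: "?w \<in> factorizations G z"
          using True quiver_path_ends(1)[OF True]
          by (auto simp: factorizations_iff composable_def path_cat_def nil_path_iff)
        \<comment> \<open>The identity is supported on trivial paths, so only the cut before the
          first arrow contributes.\<close>
        have "(\<Sum>w\<in>factorizations G z. \<one>\<^bsub>?A\<^esub> (fst w) * f (snd w)) = (\<Sum>w\<in>{?w}. \<one>\<^bsub>?A\<^esub> (fst w) * f (snd w))"
        proof (rule sum.mono_neutral_right[OF finite_factorizations])
          show "\<forall>w\<in>factorizations G z - {?w}. \<one>\<^bsub>?A\<^esub> (fst w) * f (snd w) = 0"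
          proof
            fix w assume "w \<in> factorizations G z - {?w}"
            moreover obtain x y where w: "w = (x, y)" by (cases w)
            ultimately have xy: "w = (x, y)" "composable x y" "z = path_cat x y" "w \<noteq> ?w"
              unfolding Diff_iff w factorizations_iff by blast+
            have "x \<noteq> (fst x, [], fst x)"
            proof
              assume "x = (fst x, [], fst x)"
              then have yz: "y = z" "x = (fst z, [], fst z)"
                using xy(2,3) by (cases x; cases y; auto simp: composable_def path_cat_def)+
              have "w = ?w" by (simp only: xy(1) yz)
              then show False using xy(4) by simp
            qed
            then show "\<one>\<^bsub>?A\<^esub> (fst w) * f (snd w) = 0" using xy(1) by (simp add: path_algebra_one)
          qed
        qed (use w in simp)
        then show ?thesis using quiver_path_ends(1)[OF True] by (simp add: 1 path_algebra_one)
      next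
        case False
        then show ?thesis using path_algebra_outside[OF f False] by (simp add: 1 factorizations_nonpath)
      qed
    qed
    show "f \<otimes>\<^bsub>?A\<^esub> \<one>\<^bsub>?A\<^esub> = f"
    proof
      fix z
      have 1: "(f \<otimes>\<^bsub>?A\<^esub> \<one>\<^bsub>?A\<^esub>) z = (\<Sum>w\<in>factorizations G z. f (fst w) * \<one>\<^bsub>?A\<^esub> (snd w))"
        unfolding path_algebra_simps(2) case_prod_unfold by (rule refl)
      show "(f \<otimes>\<^bsub>?A\<^esub> \<one>\<^bsub>?A\<^esub>) z = f z"
      proof (cases "z \<in> quiver_paths G")
        case True
        let ?e = "snd (snd z)"
        let ?w = "(z, (?e, [], ?e))"
        have w: "?w \<in> factorizations G z"
          using True quiver_path_ends(2)[OF True]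
          by (auto simp: factorizations_iff composable_def path_cat_def nil_path_iff)
        have "(\<Sum>w\<in>factorizations G z. f (fst w) * \<one>\<^bsub>?A\<^esub> (snd w)) = (\<Sum>w\<in>{?w}. f (fst w) * \<one>\<^bsub>?A\<^esub> (snd w))"
        proof (rule sum.mono_neutral_right[OF finite_factorizations])
          show "\<forall>w\<in>factorizations G z - {?w}. f (fst w) * \<one>\<^bsub>?A\<^esub> (snd w) = 0"
          proof
            fix w assume "w \<in> factorizations G z - {?w}"
            moreover obtain x y where w: "w = (x, y)" by (cases w)
            ultimately have xy: "w = (x, y)" "composable x y" "z = path_cat x y" "w \<noteq> ?w"
              unfolding Diff_iff w factorizations_iff by blast+
            have "y \<noteq> (fst y, [], fst y)"
            proof
              assume "y = (fst y, [], fst y)"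
              then have yz: "x = z" "y = (?e, [], ?e)"
                using xy(2,3) by (cases x; cases y; auto simp: composable_def path_cat_def)+
              have "w = ?w" by (simp only: xy(1) yz)
              then show False using xy(4) by simp
            qed
            then show "f (fst w) * \<one>\<^bsub>?A\<^esub> (snd w) = 0" using xy(1) by (simp add: path_algebra_one)
          qed
        qed (use w in simp)
        then show ?thesis using quiver_path_ends(2)[OF True] by (simp add: 1 path_algebra_one)
      next
        case False
        then show ?thesis using path_algebra_outside[OF f False] by (simp add: 1 factorizations_nonpath)
      qed
    qed
    show "f \<otimes>\<^bsub>?A\<^esub> g \<otimes>\<^bsub>?A\<^esub> h = f \<otimes>\<^bsub>?A\<^esub> (g \<otimes>\<^bsub>?A\<^esub> h)" by (rule path_algebra_mult_assoc)
    assume "g \<in> carrier ?A"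
    then show "f \<otimes>\<^bsub>?A\<^esub> g \<in> carrier ?A" by (rule path_algebra_mult_closed[OF f])
  next
    have "{z. \<one>\<^bsub>?A\<^esub> z \<noteq> 0} \<subseteq> (\<lambda>i. (i, [], i)) ` verts G"
      by (auto simp: path_algebra_one split: if_splits)
    moreover have "(\<lambda>i. (i, [], i)) ` verts G \<subseteq> quiver_paths G" by (auto simp: nil_path_iff)
    moreover have "finite ((\<lambda>i. (i, [], i)) ` verts G)" by simp
    ultimately show "\<one>\<^bsub>?A\<^esub> \<in> carrier ?A"
      unfolding path_algebra_simps(1) by (blast intro: finite_subset)
  qed
qed (auto simp: path_algebra_simps(2,5) case_prod_unfold distrib_left distrib_right sum.distrib)

text \<open>The filtration of the path algebra by path length. Its term for m = 2 turns out to be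
  J^2, so that membership in J^2 becomes a condition on coefficients.\<close>

definition long_part :: "nat \<Rightarrow> (('a, 'b) path \<Rightarrow> 'k::field) set" where
  "long_part m = {f \<in> carrier PA. \<forall>z. length (fst (snd z)) < m \<longrightarrow> f z = 0}"

lemma long_part_mult:
  fixes f g :: "('a, 'b) path \<Rightarrow> 'k::field"
  assumes "f \<in> long_part m" and "g \<in> long_part m'"
  shows "f \<otimes>\<^bsub>PA\<^esub> g \<in> long_part (m + m')"
proof -
  have "(f \<otimes>\<^bsub>PA\<^esub> g) z = 0" if l: "length (fst (snd z)) < m + m'" for z
  proof -
    have "f x * g y = 0" if "(x, y) \<in> factorizations G z" for x y
    proof -
      have "length (fst (snd x)) < m \<or> length (fst (snd y)) < m'"
        using that l by (auto simp: factorizations_iff)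
      moreover have "f x = 0" if "length (fst (snd x)) < m"
        using assms(1) that unfolding long_part_def by blast
      moreover have "g y = 0" if "length (fst (snd y)) < m'"
        using assms(2) that unfolding long_part_def by blast
      ultimately show ?thesis by auto
    qed
    then show ?thesis unfolding path_algebra_simps(2) by (intro sum.neutral) auto
  qed
  then show ?thesis using assms by (simp add: long_part_def path_algebra_mult_closed)
qed

lemma long_part_0: "long_part 0 = carrier PA"
  by (simp add: long_part_def)

lemma ideal_long_part: "ideal (long_part m) (PA :: (('a, 'b) path \<Rightarrow> 'k::field) ring)"
proof -
  let ?A = "PA :: (('a, 'b) path \<Rightarrow> 'k) ring"
  let ?L = "long_part m :: (('a, 'b) path \<Rightarrow> 'k) set"
  interpret A: ring ?A by (rule ring_path_algebra)
  show ?thesis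
  proof (rule idealI)
    show "ring ?A" by (rule ring_path_algebra)
    show "subgroup ?L (add_monoid ?A)"
    proof (rule group.subgroupI[OF A.a_group])
      show "?L \<subseteq> carrier (add_monoid ?A)" by (auto simp: long_part_def)
      have "\<zero>\<^bsub>?A\<^esub> \<in> ?L" using A.zero_closed by (simp add: long_part_def path_algebra_simps(4))
      then show "?L \<noteq> {}" by blast
      fix f :: "('a, 'b) path \<Rightarrow> 'k" assume f: "f \<in> ?L"
      have "\<ominus>\<^bsub>?A\<^esub> f = (\<lambda>z. - f z)"
        using f by (intro A.minus_equality) (auto simp: long_part_def path_algebra_simps)
      then have "\<ominus>\<^bsub>?A\<^esub> f \<in> ?L" using f A.a_inv_closed[of f] by (simp add: long_part_def)
      then show "inv\<^bsub>add_monoid ?A\<^esub> f \<in> ?L" by (simp add: a_inv_def)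
      fix g :: "('a, 'b) path \<Rightarrow> 'k" assume g: "g \<in> ?L"
      then show "f \<otimes>\<^bsub>add_monoid ?A\<^esub> g \<in> ?L"
        using f A.a_closed[of f g] by (simp add: long_part_def) (simp add: path_algebra_simps(5))
    qed
    show "g \<otimes>\<^bsub>?A\<^esub> f \<in> ?L" "f \<otimes>\<^bsub>?A\<^esub> g \<in> ?L"
      if "f \<in> ?L" "g \<in> carrier ?A" for f g
      using long_part_mult[of g 0 f m] long_part_mult[of f m g 0] that by (simp_all add: long_part_0)
  qed
qed

text \<open>A path with a coefficient: it lets the scalar travel with the path when elements of J^2
  are assembled.\<close>

definition pelt :: "'k::field \<Rightarrow> ('a, 'b) path \<Rightarrow> ('a, 'b) path \<Rightarrow> 'k" where
  "pelt c x = (\<lambda>z. if z = x then c else 0)"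

lemma pelt_closed: "x \<in> quiver_paths G \<Longrightarrow> pelt c x \<in> carrier PA"
proof -
  assume "x \<in> quiver_paths G"
  moreover have "{z. pelt c x z \<noteq> 0} \<subseteq> {x}" by (auto simp: pelt_def)
  ultimately show ?thesis
    unfolding path_algebra_simps(1) by (auto intro: finite_subset)
qed

lemma pelt_mult:
  assumes x: "x \<in> quiver_paths G" and y: "y \<in> quiver_paths G" and xy: "composable x y"
  shows "pelt c x \<otimes>\<^bsub>PA\<^esub> pelt d y = pelt (c * d :: 'k::field) (path_cat x y)"
proof
  fix z
  have "(pelt c x \<otimes>\<^bsub>PA\<^esub> pelt d y) z = (\<Sum>w\<in>factorizations G z. if w = (x, y) then c * d else 0)"
    unfolding path_algebra_simps(2)
  proof (rule sum.cong[OF refl])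
    fix w :: "('a, 'b) path \<times> ('a, 'b) path"
    obtain x' y' where "w = (x', y')" by (cases w)
    then show "(case w of (x', y') \<Rightarrow> pelt c x x' * pelt d y y') = (if w = (x, y) then c * d else 0)"
      by (cases "x' = x"; cases "y' = y") (simp_all add: pelt_def)
  qed
  also have "\<dots> = (if (x, y) \<in> factorizations G z then c * d else 0)"
    using finite_factorizations[of z] by simp
  finally show "(pelt c x \<otimes>\<^bsub>PA\<^esub> pelt d y) z = pelt (c * d) (path_cat x y) z"
    using x y xy by (simp add: factorizations_iff pelt_def)
qed

lemma arrow_ideal_subset: "(arrow_ideal G :: (('a, 'b) path \<Rightarrow> 'k::field) set) \<subseteq> long_part 1"
proof -
  interpret A: ring "PA :: (('a, 'b) path \<Rightarrow> 'k) ring" by (rule ring_path_algebra)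
  have "path_elt (tail G \<alpha>, [\<alpha>], head G \<alpha>) \<in> (long_part 1 :: (('a, 'b) path \<Rightarrow> 'k) set)" if "\<alpha> \<in> arcs G" for \<alpha>
  proof -
    have "(tail G \<alpha>, [\<alpha>], head G \<alpha>) \<in> quiver_paths G" using that by (simp add: cons_path_iff nil_path_iff)
    from pelt_closed[OF this, of "1::'k"] show ?thesis
      by (auto simp: long_part_def pelt_def path_elt_def)
  qed
  then show ?thesis unfolding arrow_ideal_def by (intro A.genideal_minimal ideal_long_part) auto
qed

text \<open>The length filtration is multiplicative and contains the arrows in degree 1, which gives
  one inclusion. Conversely a path of length at least 2 is an arrow times a path of positive length,
  both in J, and finite sums follow by induction on the support.\<close>

lemma rad_square_eq: "rad_square G = (long_part 2 :: (('a, 'b) path \<Rightarrow> 'k::field) set)"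
proof
  let ?A = "PA :: (('a, 'b) path \<Rightarrow> 'k) ring" and ?I = "arrow_ideal G :: (('a, 'b) path \<Rightarrow> 'k) set"
  interpret A: ring ?A by (rule ring_path_algebra)
  interpret L: ideal "long_part 2" ?A by (rule ideal_long_part)
  show "rad_square G \<subseteq> (long_part 2 :: (('a, 'b) path \<Rightarrow> 'k) set)"
  proof
    fix f :: "('a, 'b) path \<Rightarrow> 'k" assume "f \<in> rad_square G"
    then show "f \<in> long_part 2"
      unfolding rad_square_def
    proof (induction rule: ideal_prod.induct)
      case (prod i j)
      then have "i \<otimes>\<^bsub>?A\<^esub> j \<in> long_part (1 + 1)"
        using arrow_ideal_subset by (intro long_part_mult) blast+
      then show ?case by (simp only: one_add_one)
    next
      case (sum s1 s2)
      then show ?case by (simp add: additive_subgroup.a_closed[OF ideal.axioms(1)[OF ideal_long_part]])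
    qed
  qed
  have gens: "{path_elt (tail G \<alpha>, [\<alpha>], head G \<alpha>) | \<alpha>. \<alpha> \<in> arcs G} \<subseteq> carrier ?A"
  proof clarify
    fix \<alpha> assume "\<alpha> \<in> arcs G"
    then have "(tail G \<alpha>, [\<alpha>], head G \<alpha>) \<in> quiver_paths G" by (simp add: cons_path_iff nil_path_iff)
    from pelt_closed[OF this, of "1::'k"] show "path_elt (tail G \<alpha>, [\<alpha>], head G \<alpha>) \<in> carrier ?A"
      by (simp add: pelt_def path_elt_def)
  qed
  have idI: "ideal ?I ?A" unfolding arrow_ideal_def by (rule A.genideal_ideal[OF gens])
  interpret I: ideal ?I ?A by (rule idI)
  interpret J: ideal "rad_square G" ?A unfolding rad_square_def by (rule A.ideal_prod_is_ideal[OF idI idI])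
  have arrI: "pelt 1 (tail G \<alpha>, [\<alpha>], head G \<alpha>) \<in> ?I" if "\<alpha> \<in> arcs G" for \<alpha>
    using A.genideal_self[OF gens] that unfolding arrow_ideal_def pelt_def path_elt_def by blast
  have consI: "pelt c (u, \<alpha> # p, w) \<in> ?I" if x: "(u, \<alpha> # p, w) \<in> quiver_paths G" for c u \<alpha> p w
  proof -
    have a: "\<alpha> \<in> arcs G" "u = tail G \<alpha>" "(head G \<alpha>, p, w) \<in> quiver_paths G" using x by (simp_all add: cons_path_iff)
    have "pelt 1 (tail G \<alpha>, [\<alpha>], head G \<alpha>) \<otimes>\<^bsub>?A\<^esub> pelt c (head G \<alpha>, p, w) \<in> ?I"
      by (rule I.I_r_closed[OF arrI[OF a(1)] pelt_closed[OF a(3)]])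
    moreover have "(tail G \<alpha>, [\<alpha>], head G \<alpha>) \<in> quiver_paths G" using a by (simp add: cons_path_iff nil_path_iff)
    ultimately show ?thesis
      using pelt_mult[of "(tail G \<alpha>, [\<alpha>], head G \<alpha>)" "(head G \<alpha>, p, w)" "1::'k" c] a
      by (simp add: composable_def path_cat_def)
  qed
  have longJ: "pelt c x \<in> rad_square G" if x: "x \<in> quiver_paths G" "length (fst (snd x)) \<ge> 2" for c :: 'k and x
  proof -
    obtain u \<alpha> \<beta> p w where xx: "x = (u, \<alpha> # \<beta> # p, w)"
      using x(2) by (cases x; cases "fst (snd x)"; cases "tl (fst (snd x))") auto
    have a: "\<alpha> \<in> arcs G" "u = tail G \<alpha>" "(head G \<alpha>, \<beta> # p, w) \<in> quiver_paths G"
      using x(1) unfolding xx by (simp_all add: cons_path_iff)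
    have "pelt 1 (tail G \<alpha>, [\<alpha>], head G \<alpha>) \<otimes>\<^bsub>?A\<^esub> pelt c (head G \<alpha>, \<beta> # p, w) \<in> rad_square G"
      unfolding rad_square_def by (rule ideal_prod.prod[OF arrI[OF a(1)] consI[OF a(3)]])
    moreover have "(tail G \<alpha>, [\<alpha>], head G \<alpha>) \<in> quiver_paths G" using a(3) quiver_path_ends(1)[OF a(3)] a(1)
      by (simp add: cons_path_iff nil_path_iff)
    ultimately show ?thesis
      using pelt_mult[of "(tail G \<alpha>, [\<alpha>], head G \<alpha>)" "(head G \<alpha>, \<beta> # p, w)" "1::'k" c] a
      by (simp add: composable_def path_cat_def xx)
  qed
  have "f \<in> rad_square G" if "finite S" "{x. f x \<noteq> 0} = S" "S \<subseteq> {x \<in> quiver_paths G. length (fst (snd x)) \<ge> 2}"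
    for f :: "('a, 'b) path \<Rightarrow> 'k" and S
    using that
  proof (induction S arbitrary: f rule: finite_induct)
    case empty
    then have "f = \<zero>\<^bsub>?A\<^esub>" by (auto simp: path_algebra_simps(4))
    then show ?case using additive_subgroup.zero_closed[OF ideal.axioms(1)[OF J.ideal_axioms]] by simp
  next
    case (insert x S)
    let ?g = "\<lambda>z. if z = x then 0 else f z"
    have "{z. ?g z \<noteq> 0} = {z. f z \<noteq> 0} - {x}" by auto
    then have "{z. ?g z \<noteq> 0} = S" unfolding insert.prems(1) using insert.hyps(2) by simp
    moreover have "S \<subseteq> {x \<in> quiver_paths G. length (fst (snd x)) \<ge> 2}" using insert.prems(2) by simp
    ultimately have "?g \<in> rad_square G" by (rule insert.IH)
    moreover have "pelt (f x) x \<in> rad_square G" using insert.prems(2) by (intro longJ) auto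
    ultimately have "pelt (f x) x \<oplus>\<^bsub>?A\<^esub> ?g \<in> rad_square G" by (intro additive_subgroup.a_closed[OF ideal.axioms(1)[OF J.ideal_axioms]])
    moreover have "pelt (f x) x \<oplus>\<^bsub>?A\<^esub> ?g = f" by (auto simp: path_algebra_simps(5) pelt_def)
    ultimately show ?case by simp
  qed
  note main = this
  show "(long_part 2 :: (('a, 'b) path \<Rightarrow> 'k) set) \<subseteq> rad_square G"
  proof
    fix f :: "('a, 'b) path \<Rightarrow> 'k" assume f: "f \<in> long_part 2"
    then have "finite {x. f x \<noteq> 0}" "{x. f x \<noteq> 0} \<subseteq> {x \<in> quiver_paths G. length (fst (snd x)) \<ge> 2}"
      by (auto simp: long_part_def path_algebra_simps(1) not_less[symmetric])
    then show "f \<in> rad_square G" by (intro main[OF _ refl])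
  qed
qed

text \<open>Evaluated on the whole coset: elements of J^2 vanish on paths of length below 2, so all
  representatives agree and the image is a singleton. The formula is that of the scalar action in
  \<open>vertex_simple\<close>.\<close>

definition vcoef :: "(('a, 'b) path \<Rightarrow> 'k::field) set \<Rightarrow> 'a \<Rightarrow> 'k" where
  "vcoef r i = the_elem ((\<lambda>f. f (i, [], i)) ` r)"

definition acoef :: "(('a, 'b) path \<Rightarrow> 'k::field) set \<Rightarrow> 'b \<Rightarrow> 'k" where
  "acoef r \<alpha> = the_elem ((\<lambda>f. f (tail G \<alpha>, [\<alpha>], head G \<alpha>)) ` r)"

text \<open>Modulo \<open>long_part 2\<close> exactly the coefficients at trivial paths and arrows
  remain, and the product rules come from the factorisations of these short paths.\<close>

theorem rad_sq_zero_quiver: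
  "rad_sq_zero (rad_square_zero_algebra G :: (('a, 'b) path \<Rightarrow> 'k::field) set ring)
    (verts G) (arcs G) (tail G) (head G) vcoef acoef"
proof -
  let ?A = "PA :: (('a, 'b) path \<Rightarrow> 'k) ring" and ?J = "rad_square G :: (('a, 'b) path \<Rightarrow> 'k) set"
  let ?R = "rad_square_zero_algebra G :: (('a, 'b) path \<Rightarrow> 'k) set ring"
  interpret A: ring ?A by (rule ring_path_algebra)
  interpret J: ideal ?J ?A unfolding rad_square_eq by (rule ideal_long_part)
  define cl where "cl f = ?J +>\<^bsub>?A\<^esub> f" for f
  have car: "carrier ?R = cl ` carrier ?A"
    by (auto simp: rad_square_zero_algebra_def FactRing_def A_RCOSETS_def' cl_def a_r_coset_def)
  have add: "cl f \<oplus>\<^bsub>?R\<^esub> cl g = cl (f \<oplus>\<^bsub>?A\<^esub> g)" if "f \<in> carrier ?A" "g \<in> carrier ?A" for f g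
    using J.a_rcos_sum[OF that] by (simp add: rad_square_zero_algebra_def FactRing_def cl_def)
  have mult: "cl f \<otimes>\<^bsub>?R\<^esub> cl g = cl (f \<otimes>\<^bsub>?A\<^esub> g)" if "f \<in> carrier ?A" "g \<in> carrier ?A" for f g
    using J.rcoset_mult_add[OF that] by (simp add: rad_square_zero_algebra_def FactRing_def cl_def)
  have one: "\<one>\<^bsub>?R\<^esub> = cl \<one>\<^bsub>?A\<^esub>" by (simp add: rad_square_zero_algebra_def FactRing_def cl_def)
  have cle: "cl f = {(\<lambda>z. j z + f z) | j. j \<in> ?J}" for f
    by (auto simp: cl_def a_r_coset_def' path_algebra_simps(5))
  have cleI: "(\<lambda>z. j z + f z) \<in> cl f" if "j \<in> ?J" for j f
    unfolding cle by (rule CollectI, rule exI[of _ j]) (simp add: that)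
  have Jz: "j z = 0" if "j \<in> ?J" "length (fst (snd z)) < 2" for j z
    using that unfolding rad_square_eq long_part_def by blast
  have ev: "the_elem ((\<lambda>g. g z) ` cl f) = f z" if len: "length (fst (snd z)) < 2" for f z
  proof -
    have "(\<lambda>_. 0) \<in> ?J"
      using additive_subgroup.zero_closed[OF ideal.axioms(1)[OF J.ideal_axioms]] by (simp only: path_algebra_simps(4))
    then have "(\<lambda>z. 0 + f z) \<in> cl f" by (rule cleI)
    then have "(\<lambda>z. 0 + f z) z \<in> (\<lambda>g. g z) ` cl f" by (rule imageI)
    then have "f z \<in> (\<lambda>g. g z) ` cl f" by simp
    moreover have "h \<in> {f z}" if h: "h \<in> (\<lambda>g. g z) ` cl f" for h
    proof -
      obtain g where g: "h = g z" "g \<in> cl f" using h by (rule imageE)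
      then obtain j where "g = (\<lambda>z. j z + f z)" "j \<in> ?J" unfolding cle by blast
      then show ?thesis using Jz[OF _ len] g(1) by simp
    qed
    ultimately have "(\<lambda>g. g z) ` cl f = {f z}" by blast
    then show ?thesis by simp
  qed
  have vcl: "vcoef (cl f) i = f (i, [], i)" for f i by (simp add: vcoef_def ev)
  have acl: "acoef (cl f) \<alpha> = f (tail G \<alpha>, [\<alpha>], head G \<alpha>)" for f \<alpha> by (simp add: acoef_def ev)
  have short: "\<exists>i\<in>verts G. z = (i, [], i) \<or> (\<exists>\<alpha>\<in>arcs G. z = (tail G \<alpha>, [\<alpha>], head G \<alpha>))"
    if z: "z \<in> quiver_paths G" "length (fst (snd z)) < 2" for z
  proof -
    obtain u p w where zz: "z = (u, p, w)" by (cases z)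
    show ?thesis
    proof (cases p)
      case Nil
      then show ?thesis using z(1) zz by (auto simp: nil_path_iff)
    next
      case (Cons a q)
      then have "q = []" using z(2) zz by simp
      then show ?thesis using z(1) zz Cons quiver_path_ends(1)[OF z(1)] by (auto simp: cons_path_iff nil_path_iff)
    qed
  qed
  show ?thesis
  proof (intro rad_sq_zero.intro rad_sq_zero_axioms.intro)
    show "ring ?R" unfolding rad_square_zero_algebra_def by (rule J.quotient_is_ring)
    show "finite (verts G)" "finite (arcs G)" by simp_all
    show "tail G \<alpha> \<in> verts G" "head G \<alpha> \<in> verts G" if "\<alpha> \<in> arcs G" for \<alpha> using that by simp_all
  next
    fix r s assume "r \<in> carrier ?R" "s \<in> carrier ?R"
      and v: "\<And>i. i \<in> verts G \<Longrightarrow> vcoef r i = vcoef s i" and a: "\<And>\<alpha>. \<alpha> \<in> arcs G \<Longrightarrow> acoef r \<alpha> = acoef s \<alpha>"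
    then obtain f g where fg: "f \<in> carrier ?A" "r = cl f" "g \<in> carrier ?A" "s = cl g" unfolding car by blast
    have eq: "f z = g z" if l: "length (fst (snd z)) < 2" for z
    proof (cases "z \<in> quiver_paths G")
      case True
      from short[OF True l] show ?thesis using v a by (auto simp: fg vcl acl)
    next
      case False
      then show ?thesis using path_algebra_outside[OF fg(1)] path_algebra_outside[OF fg(3)] by simp
    qed
    have neg: "\<ominus>\<^bsub>?A\<^esub> g = (\<lambda>z. - g z)"
      using fg(3) by (intro A.minus_equality) (auto simp: path_algebra_simps)
    \<comment> \<open>Agreement on all paths of length below 2 puts f - g into
      \<open>long_part 2\<close>, that is, into J^2.\<close>
    have "f \<oplus>\<^bsub>?A\<^esub> \<ominus>\<^bsub>?A\<^esub> g \<in> carrier ?A" using fg by simp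
    then have "f \<oplus>\<^bsub>?A\<^esub> \<ominus>\<^bsub>?A\<^esub> g \<in> ?J"
      unfolding rad_square_eq long_part_def using eq by (simp add: neg path_algebra_simps(5))
    then have "(\<lambda>z. (f \<oplus>\<^bsub>?A\<^esub> \<ominus>\<^bsub>?A\<^esub> g) z + g z) \<in> cl g" by (rule cleI)
    then have "f \<in> ?J +>\<^bsub>?A\<^esub> g" by (simp add: neg path_algebra_simps(5) cl_def)
    then have "?J +>\<^bsub>?A\<^esub> g = ?J +>\<^bsub>?A\<^esub> f" by (rule J.a_repr_independence'[OF _ fg(3)])
    then show "r = s" by (simp add: fg cl_def)
  next
    fix F :: "'a \<Rightarrow> 'k" and H :: "'b \<Rightarrow> 'k"
    define f where "f z = (if z \<in> quiver_paths G then (case fst (snd z) of [] \<Rightarrow> F (fst z) | [\<alpha>] \<Rightarrow> H \<alpha> | _ \<Rightarrow> 0) else 0)" for z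
    have "{z. f z \<noteq> 0} \<subseteq> (\<lambda>i. (i, [], i)) ` verts G \<union> (\<lambda>\<alpha>. (tail G \<alpha>, [\<alpha>], head G \<alpha>)) ` arcs G"
    proof
      fix z assume "z \<in> {z. f z \<noteq> 0}"
      then have "z \<in> quiver_paths G" "length (fst (snd z)) < 2"
        by (auto simp: f_def split: if_splits list.splits)
      from short[OF this] show "z \<in> (\<lambda>i. (i, [], i)) ` verts G \<union> (\<lambda>\<alpha>. (tail G \<alpha>, [\<alpha>], head G \<alpha>)) ` arcs G"
        by auto
    qed
    then have "finite {z. f z \<noteq> 0}" by (rule finite_subset) simp
    then have "f \<in> carrier ?A" by (auto simp: path_algebra_simps(1) f_def split: if_splits)
    moreover have "f (i, [], i) = F i" if "i \<in> verts G" for i using that by (simp add: f_def nil_path_iff)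
    moreover have "f (tail G \<alpha>, [\<alpha>], head G \<alpha>) = H \<alpha>" if "\<alpha> \<in> arcs G" for \<alpha>
      using that by (simp add: f_def cons_path_iff nil_path_iff)
    ultimately show "\<exists>r\<in>carrier ?R. (\<forall>i\<in>verts G. vcoef r i = F i) \<and> (\<forall>\<alpha>\<in>arcs G. acoef r \<alpha> = H \<alpha>)"
      unfolding car by (intro bexI[of _ "cl f"]) (auto simp: vcl acl)
  next
    fix r s assume "r \<in> carrier ?R" "s \<in> carrier ?R"
    then obtain f g where fg: "f \<in> carrier ?A" "r = cl f" "g \<in> carrier ?A" "s = cl g" unfolding car by blast
    show "vcoef (r \<oplus>\<^bsub>?R\<^esub> s) i = vcoef r i + vcoef s i" for i
      by (simp add: fg add vcl) (simp add: path_algebra_simps(5))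
    show "acoef (r \<oplus>\<^bsub>?R\<^esub> s) \<alpha> = acoef r \<alpha> + acoef s \<alpha>" for \<alpha>
      by (simp add: fg add acl) (simp add: path_algebra_simps(5))
    show "vcoef (r \<otimes>\<^bsub>?R\<^esub> s) i = vcoef r i * vcoef s i" if "i \<in> verts G" for i
      by (simp add: fg mult vcl) (simp add: path_algebra_simps(2) factorizations_nil[OF that])
    show "acoef (r \<otimes>\<^bsub>?R\<^esub> s) \<alpha> = vcoef r (tail G \<alpha>) * acoef s \<alpha> + acoef r \<alpha> * vcoef s (head G \<alpha>)"
      if "\<alpha> \<in> arcs G" for \<alpha>
      by (simp add: fg mult vcl acl) (simp add: path_algebra_simps(2) factorizations_arc[OF that])
  next
    show "vcoef \<one>\<^bsub>?R\<^esub> i = 1" if "i \<in> verts G" for i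
      unfolding one vcl path_algebra_one using that by simp
    show "acoef \<one>\<^bsub>?R\<^esub> \<alpha> = 0" for \<alpha>
      unfolding one acl path_algebra_one by simp
  qed
qed

end

section \<open>The bound for the algebra of a quiver\<close>

theorem proposition4p19:
  fixes Q :: "('v, 'a) pre_digraph"
    and A :: "(('v, 'a) path \<Rightarrow> 'k::field) set ring"
    and n k :: nat
    and S_D :: "(('v, 'a) path \<Rightarrow> 'k) set umodule set set"
  assumes "fin_digraph Q" and "connected Q"
    and "A = rad_square_zero_algebra Q"
    and "n = card (verts Q)"
    and "S_D = {iso_class A S | S. S \<in> fg_modules A \<and> simple_module A S \<and>
                  \<not> projective A S \<and> \<not> injective A S}"
    and "k = card {iso_class A S | S. S \<in> fg_modules A \<and> simple_module A S \<and>
                  (projective A S \<or> injective A S)}"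
    and "global_dim A = \<infinity>"
    and "verts (member TYPE('k) Q) \<noteq> {}"
  shows "phi_dim A \<le> enat (card S_D) \<and> int (card S_D) = int n - int k"
proof -
  interpret Q: fin_digraph Q by fact
  interpret rad_sq_zero A "verts Q" "arcs Q" "tail Q" "head Q" Q.vcoef Q.acoef
    unfolding assms(3) by (rule Q.rad_sq_zero_quiver)
  \<comment> \<open>The classes correspond to the vertices, each of which falls on exactly one side;
    the additive form avoids truncated subtraction of natural numbers.\<close>
  have "card S_D + k = n" unfolding assms(4-6) by (rule card_simples)
  then have "int (card S_D) = int n - int k" by simp
  moreover have "phi_dim A \<le> enat (card S_D)"
    unfolding assms(5) by (rule phi_dim_le_card_simples[OF assms(7)])
  ultimately show ?thesis by blast
qed

end
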